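(* Let $\varphi$ be an automorphic form on $SL(4,\mathbb{A})$, let $\alpha\in\{\alpha_1,\alpha_2,\alpha_3\}$ be a simple root and $P_\alpha=L_\alpha U_\alpha$ the corresponding standard maximal parabolic subgroup (the Lie algebra of $U_\alpha$ contains the single simple root $\alpha$). Let $\psi_U$ be a non-trivial unitary character of $U_\alpha(\mathbb{Q})\backslash U_\alpha(\mathbb{A})$ with character matrix $M$, and $F_{\psi_U}(g)=\int_{U_\alpha(\mathbb{Q})\backslash U_\alpha(\mathbb{A})}\varphi(ug)\overline{\psi_U(u)}du$. Then either $M$ lies in the orbit $G(\mathbb{Q})\cdot M_{\mathcal{O}_{\min}}$ and $F_{\psi_U}$ is completely determined by the orbit Fourier coefficients $F_{\mathcal{O}_{\min}}$ of $\varphi$, or $M$ lies in $G(\mathbb{Q})\cdot M_{\mathcal{O}_{\mathrm{ntm}}}$ and $F_{\psi_U}$ is completely determined by the orbit Fourier coefficients $F_{\mathcal{O}_{\mathrm{ntm}}}$ of $\varphi$; the latter case is only possible for $\alpha=\alpha_2$.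
   Context: $\mathbb{A}$ denotes the adeles of $\mathbb{Q}$, $\mathbf{e}(x)=\exp(2\pi ix)$ the standard character of $\mathbb{Q}\backslash\mathbb{A}$. Simple roots $\alpha_1,\alpha_2,\alpha_3$ of $\mathfrak{sl}(4)$ are the standard ones (corresponding to matrix entries $(1,2),(2,3),(3,4)$). $U_{\alpha_1}$ consists of unipotent matrices with arbitrary entries in positions $(1,2),(1,3),(1,4)$; $U_{\alpha_2}$ in positions $(1,3),(1,4),(2,3),(2,4)$; $U_{\alpha_3}$ in positions $(1,4),(2,4),(3,4)$; these are abelian. A character matrix is a matrix $M=1+\sum_{(i,j)}m_{ij}E_{ij}$ of the same shape as $U_\alpha$ with $m_{ij}\in\mathbb{Q}$, defining $\psi_U(u)=\mathbf{e}(\sum_{ij}m_{ij}u_{ij})$. $G(\mathbb{Q})=SL(4,\mathbb{Q})$ acts on character matrices by conjugation (for $l\in L_\alpha(\mathbb{Q})$ one has $F_{M}(lg)$ equal to the coefficient with matrix $(l^T)^{-1}Ml^T$ wait—precisely $F_U(M;g)=F_U(M';lg)$ with $M'=(l^T)^{-1}Ml^T$). $M_{\mathcal{O}_{\min}}=1+E_{14}$ and $M_{\mathcal{O}_{\mathrm{ntm}}}=1+E_{13}+E_{24}$ are representatives for which $M-1$ lies in the nilpotent orbit $\mathcal{O}_{\min}=(21^2)$, respectively $\mathcal{O}_{\mathrm{ntm}}=(2^2)$. Orbit Fourier coefficients: $F_{(21^2)}(\varphi,m;g)=\int_{\mathbb{Q}\backslash\mathbb{A}}\varphi((1+xE_{14})g)\overline{\mathbf{e}(mx)}dx$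 ($m\ne0$), and $F_{(2^2)}(\varphi,m_1,m_2,m_3,m_4;g)=\int\varphi((1+x_1E_{13}+x_2E_{14}+x_3E_{23}+x_4E_{24})g)\overline{\mathbf{e}(m_1x_1+m_2x_2+m_3x_3+m_4x_4)}d^4x$ with $m_1m_4-m_2m_3\ne0$. "Completely determined by" means $F_{\psi_U}$ can be written as an integral of such orbit coefficients evaluated at translates of $g$.
   Formalization: In the ntm case, M in G(Q)·M_ntm fails, e.g. for M=1+E13+2E24; it is replaced by: M lies in the SL(4,C)-orbit of M_ntm and in the G(Q)-orbit of 1+E13+dE24 for some nonzero rational d, with M in G(Q)·M_ntm exactly when d is a square. *)

theory Defs
  imports "HOL-Analysis.Analysis" "HOL-Computational_Algebra.Primes"
begin

section \<open>The p-adic absolute value on the rationals\<close>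

definition padic_abs :: "nat \<Rightarrow> rat \<Rightarrow> real" where
  "padic_abs p x = (if x = 0 then 0 else
     real p powi (int (multiplicity (int p) (snd (quotient_of x)))
                - int (multiplicity (int p) (fst (quotient_of x)))))"

lemma padic_abs_0 [simp]: "padic_abs p 0 = 0"
  by (simp add: padic_abs_def)

lemma padic_abs_quot:
  assumes p: "prime p" and a: "a \<noteq> 0" and b: "b \<noteq> 0"
  shows "padic_abs p (of_int a / of_int b) =
     real p powi (int (multiplicity (int p) b) - int (multiplicity (int p) a))"
proof -
  define x :: rat where "x = of_int a / of_int b"
  obtain c d where cd: "quotient_of x = (c, d)" by force
  have d: "d > 0" using cd quotient_of_denom_pos by blast
  have x: "x = of_int c / of_int d" using cd quotient_of_div by blast
  have "x \<noteq> 0" using a b by (simp add: x_def)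
  then have c: "c \<noteq> 0" using x by auto
  have "of_int (a * d) = (of_int (c * b) :: rat)"
    using x b d unfolding x_def by (simp add: field_simps)
  then have eq: "a * d = c * b" using of_int_eq_iff by blast
  have pe: "prime_elem (int p)" using p by simp
  have "multiplicity (int p) a + multiplicity (int p) d = multiplicity (int p) c + multiplicity (int p) b"
    using arg_cong[OF eq, of "multiplicity (int p)"] pe a b c d
    by (simp add: prime_elem_multiplicity_mult_distrib)
  then have "int (multiplicity (int p) d) - int (multiplicity (int p) c)
     = int (multiplicity (int p) b) - int (multiplicity (int p) a)" by linarith
  then show ?thesis using \<open>x \<noteq> 0\<close> cd unfolding x_def[symmetric] by (simp add: padic_abs_def)
qed

lemma rat_quotE:
  obtains a b :: int where "(x::rat) = of_int a / of_int b" "b \<noteq> 0"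
  by (metis quotient_of_div quotient_of_denom_pos less_irrefl surj_pair)

lemma padic_abs_mult:
  assumes p: "prime p"
  shows "padic_abs p (x * y) = padic_abs p x * padic_abs p y"
proof (cases "x = 0 \<or> y = 0")
  case False
  obtain a b where x: "x = of_int a / of_int b" "b \<noteq> 0" by (rule rat_quotE)
  obtain c d where y: "y = of_int c / of_int d" "d \<noteq> 0" by (rule rat_quotE)
  have a: "a \<noteq> 0" and c: "c \<noteq> 0" using False x y by auto
  have pe: "prime_elem (int p)" using p by simp
  have p0: "real p \<noteq> 0" using p prime_gt_0_nat by force
  have xy: "x * y = of_int (a * c) / of_int (b * d)" by (simp add: x y)
  have "padic_abs p (x * y) = real p powi (int (multiplicity (int p) (b * d)) - int (multiplicity (int p) (a * c)))"
    unfolding xy by (rule padic_abs_quot) (use p a c x y in auto)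
  also have "\<dots> = real p powi ((int (multiplicity (int p) b) - int (multiplicity (int p) a))
      + (int (multiplicity (int p) d) - int (multiplicity (int p) c)))"
    using pe a c x y by (simp add: prime_elem_multiplicity_mult_distrib algebra_simps)
  also have "\<dots> = padic_abs p x * padic_abs p y"
    using padic_abs_quot[OF p a x(2)] padic_abs_quot[OF p c y(2)] x y p0
    by (simp add: power_int_add)
  finally show ?thesis .
qed auto

lemma padic_abs_nonneg [simp]: "padic_abs p x \<ge> 0"
  by (simp add: padic_abs_def)

lemma padic_abs_1 [simp]: "padic_abs p 1 = 1"
  by (simp add: padic_abs_def)

lemma padic_abs_minus [simp]: "padic_abs p (- x) = padic_abs p x"
proof -
  obtain c d where cd: "quotient_of x = (c, d)" by force
  then have "quotient_of (- x) = (- c, d)" by (simp add: rat_uminus_code)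
  moreover have "multiplicity (int p) (- c) = multiplicity (int p) c" by (simp add: multiplicity_def)
  ultimately show ?thesis using cd by (simp add: padic_abs_def)
qed

lemma padic_abs_minus_commute: "padic_abs p (x - y) = padic_abs p (y - x)"
  by (metis minus_diff_eq padic_abs_minus)

lemma padic_abs_add:
  assumes p: "prime p"
  shows "padic_abs p (x + y) \<le> max (padic_abs p x) (padic_abs p y)"
proof (cases "x = 0 \<or> y = 0 \<or> x + y = 0")
  case True then show ?thesis by (auto simp: le_max_iff_disj)
next
  case False
  obtain a b where x: "x = of_int a / of_int b" "b \<noteq> 0" by (rule rat_quotE)
  obtain c d where y: "y = of_int c / of_int d" "d \<noteq> 0" by (rule rat_quotE)
  define u v where "u = a * d" and "v = c * b"
  define w where "w = b * d"
  have w0: "w \<noteq> 0" using x y by (simp add: w_def)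
  have xu: "x = of_int u / of_int w" using x y by (simp add: u_def w_def)
  have yv: "y = of_int v / of_int w" using x y by (simp add: v_def w_def)
  have xy: "x + y = of_int (u + v) / of_int w" by (simp add: xu yv add_divide_distrib)
  have u0: "u \<noteq> 0" and v0: "v \<noteq> 0" and uv0: "u + v \<noteq> 0" using False xu yv xy by auto
  have unit: "\<not> is_unit (int p)" using p by auto
  let ?m = "multiplicity (int p)"
  have "int p ^ min (?m u) (?m v) dvd u + v"
    by (intro dvd_add multiplicity_dvd') auto
  then have m: "min (?m u) (?m v) \<le> ?m (u + v)"
    using uv0 unit by (intro multiplicity_geI) auto
  have p1: "real p \<ge> 1" using p prime_ge_1_nat by force
  have mono: "real p powi i \<le> real p powi j" if "i \<le> j" for i j
    using p1 that by (rule power_int_increasing[rotated])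
  show ?thesis
  proof (cases "?m u \<le> ?m v")
    case True
    then have "padic_abs p (x + y) \<le> padic_abs p x"
      using m padic_abs_quot[OF p uv0 w0] padic_abs_quot[OF p u0 w0]
      by (simp only: xy[symmetric] xu[symmetric]) (intro mono, auto)
    then show ?thesis by simp
  next
    case False
    then have "padic_abs p (x + y) \<le> padic_abs p y"
      using m padic_abs_quot[OF p uv0 w0] padic_abs_quot[OF p v0 w0]
      by (simp only: xy[symmetric] yv[symmetric]) (intro mono, auto)
    then show ?thesis by simp
  qed
qed

lemma padic_abs_triangle:
  assumes "prime p" shows "padic_abs p (x + y) \<le> padic_abs p x + padic_abs p y"
  using padic_abs_add[OF assms, of x y] padic_abs_nonneg[of p x] padic_abs_nonneg[of p y] by linarith

lemma padic_abs_triangle_diff: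
  assumes "prime p" shows "\<bar>padic_abs p x - padic_abs p y\<bar> \<le> padic_abs p (x - y)"
  using padic_abs_triangle[OF assms, of "x - y" y] padic_abs_triangle[OF assms, of "y - x" x]
    padic_abs_minus_commute[of p x y] by auto

lemma padic_abs_le_1:
  assumes p: "prime p" and "\<not> int p dvd snd (quotient_of x)"
  shows "padic_abs p x \<le> 1"
proof -
  have "multiplicity (int p) (snd (quotient_of x)) = 0"
    using assms by (intro not_dvd_imp_multiplicity_0) auto
  moreover have "real p \<ge> 1" using p prime_ge_1_nat by force
  ultimately show ?thesis
    using power_int_increasing[of "- int (multiplicity (int p) (fst (quotient_of x)))" 0 "real p"]
    by (auto simp: padic_abs_def)
qed

lemma finite_padic_abs_gt_1: "finite {p. prime p \<and> padic_abs p x > 1}"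
proof (rule finite_subset)
  let ?d = "snd (quotient_of x)"
  have d: "?d > 0" by (rule quotient_of_denom_pos')
  show "{p. prime p \<and> padic_abs p x > 1} \<subseteq> {..nat ?d}"
  proof
    fix p assume "p \<in> {p. prime p \<and> padic_abs p x > 1}"
    then have "int p dvd ?d" using padic_abs_le_1[of p x] by force
    then show "p \<in> {..nat ?d}" using d zdvd_imp_le by fastforce
  qed
qed simp

section \<open>The ring of adeles of the rationals\<close>

text \<open>
  An adele is represented by a real number together with, for every prime \<open>p\<close>, a \<open>p\<close>-adic
  Cauchy sequence of rationals (i.e. an element of the completion \<open>Q\<^sub>p\<close>), almost all of which
  represent \<open>p\<close>-adic integers.  Two representatives are identified iff they agree at the real
  place and at every \<open>p\<close> differ by a null sequence.  The entries at non-prime indices are ignored.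
\<close>

definition padic_Cauchy :: "nat \<Rightarrow> (nat \<Rightarrow> rat) \<Rightarrow> bool" where
  "padic_Cauchy p X \<longleftrightarrow> (\<forall>e>0. \<exists>N. \<forall>m\<ge>N. \<forall>n\<ge>N. padic_abs p (X m - X n) < e)"

definition padic_integral :: "nat \<Rightarrow> (nat \<Rightarrow> rat) \<Rightarrow> bool" where
  "padic_integral p X \<longleftrightarrow> (\<forall>\<^sub>F n in sequentially. padic_abs p (X n) \<le> 1)"

definition adele_rep :: "real \<times> (nat \<Rightarrow> nat \<Rightarrow> rat) \<Rightarrow> bool" where
  "adele_rep x \<longleftrightarrow> (\<forall>p. prime p \<longrightarrow> padic_Cauchy p (snd x p)) \<and>
     finite {p. prime p \<and> \<not> padic_integral p (snd x p)}"

definition adele_rel ::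
  "real \<times> (nat \<Rightarrow> nat \<Rightarrow> rat) \<Rightarrow> real \<times> (nat \<Rightarrow> nat \<Rightarrow> rat) \<Rightarrow> bool" where
  "adele_rel x y \<longleftrightarrow> adele_rep x \<and> adele_rep y \<and> fst x = fst y \<and>
     (\<forall>p. prime p \<longrightarrow> (\<lambda>n. padic_abs p (snd x p n - snd y p n)) \<longlonglongrightarrow> 0)"

lemma padic_CauchyD:
  "padic_Cauchy p X \<Longrightarrow> e > 0 \<Longrightarrow> \<exists>N. \<forall>m\<ge>N. \<forall>n\<ge>N. padic_abs p (X m - X n) < e"
  by (simp add: padic_Cauchy_def)

lemma padic_Cauchy_const [simp]: "padic_Cauchy p (\<lambda>_. c)"
  by (auto simp: padic_Cauchy_def)

lemma padic_Cauchy_uminus: "padic_Cauchy p X \<Longrightarrow> padic_Cauchy p (\<lambda>n. - X n)"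
  unfolding padic_Cauchy_def by (simp add: padic_abs_minus_commute)

lemma padic_Cauchy_add:
  assumes p: "prime p" and X: "padic_Cauchy p X" and Y: "padic_Cauchy p Y"
  shows "padic_Cauchy p (\<lambda>n. X n + Y n)"
  unfolding padic_Cauchy_def
proof (intro allI impI)
  fix e :: real assume e: "e > 0"
  obtain N1 where N1: "\<forall>m\<ge>N1. \<forall>n\<ge>N1. padic_abs p (X m - X n) < e" using padic_CauchyD[OF X e] by blast
  obtain N2 where N2: "\<forall>m\<ge>N2. \<forall>n\<ge>N2. padic_abs p (Y m - Y n) < e" using padic_CauchyD[OF Y e] by blast
  have "padic_abs p (X m + Y m - (X n + Y n)) < e" if "m \<ge> max N1 N2" "n \<ge> max N1 N2" for m n
  proof -
    have "X m + Y m - (X n + Y n) = (X m - X n) + (Y m - Y n)" by simp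
    then have "padic_abs p (X m + Y m - (X n + Y n))
        \<le> max (padic_abs p (X m - X n)) (padic_abs p (Y m - Y n))"
      using padic_abs_add[OF p] by metis
    also have "\<dots> < e" using N1 N2 that by auto
    finally show ?thesis .
  qed
  then show "\<exists>N. \<forall>m\<ge>N. \<forall>n\<ge>N. padic_abs p (X m + Y m - (X n + Y n)) < e" by blast
qed

lemma padic_Cauchy_bounded:
  assumes p: "prime p" and X: "padic_Cauchy p X"
  obtains B where "B > 0" "\<And>n. padic_abs p (X n) \<le> B"
proof -
  obtain N where N: "\<forall>m\<ge>N. \<forall>n\<ge>N. padic_abs p (X m - X n) < 1" using padic_CauchyD[OF X] zero_less_one by blast
  define B where "B = Max ((\<lambda>n. padic_abs p (X n)) ` {..N}) + 1"
  have M: "padic_abs p (X n) \<le> B - 1" if "n \<le> N" for n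
    unfolding B_def using that by (auto intro!: Max_ge)
  have "B \<ge> 1" using M[of 0] padic_abs_nonneg[of p "X 0"] by linarith
  moreover have "padic_abs p (X n) \<le> B" for n
  proof (cases "n \<le> N")
    case True then show ?thesis using M[of n] by linarith
  next
    case False
    then have "padic_abs p (X n - X N) < 1" using N by auto
    then show ?thesis using padic_abs_triangle[OF p, of "X n - X N" "X N"] M[of N] by simp
  qed
  ultimately show ?thesis using that[of B] by auto
qed

lemma padic_Cauchy_mult:
  assumes p: "prime p" and X: "padic_Cauchy p X" and Y: "padic_Cauchy p Y"
  shows "padic_Cauchy p (\<lambda>n. X n * Y n)"
  unfolding padic_Cauchy_def
proof (intro allI impI)
  fix e :: real assume e: "e > 0"
  obtain A where A: "A > 0" "\<And>n. padic_abs p (X n) \<le> A" using padic_Cauchy_bounded[OF p X] by metis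
  obtain B where B: "B > 0" "\<And>n. padic_abs p (Y n) \<le> B" using padic_Cauchy_bounded[OF p Y] by metis
  have eB: "e / (2 * B) > 0" and eA: "e / (2 * A) > 0" using e A B by auto
  obtain N1 where N1: "\<forall>m\<ge>N1. \<forall>n\<ge>N1. padic_abs p (X m - X n) < e / (2 * B)" using padic_CauchyD[OF X eB] by blast
  obtain N2 where N2: "\<forall>m\<ge>N2. \<forall>n\<ge>N2. padic_abs p (Y m - Y n) < e / (2 * A)" using padic_CauchyD[OF Y eA] by blast
  have "padic_abs p (X m * Y m - X n * Y n) < e" if mn: "m \<ge> max N1 N2" "n \<ge> max N1 N2" for m n
  proof -
    have eq: "X m * Y m - X n * Y n = (X m - X n) * Y m + X n * (Y m - Y n)" by (simp add: algebra_simps)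
    have 1: "padic_abs p ((X m - X n) * Y m) < e / 2"
    proof -
      have "padic_abs p ((X m - X n) * Y m) \<le> padic_abs p (X m - X n) * B"
        unfolding padic_abs_mult[OF p] by (intro mult_left_mono B) auto
      also have "\<dots> < e / (2 * B) * B" using N1 mn B by (intro mult_strict_right_mono) auto
      finally show ?thesis using B by simp
    qed
    have 2: "padic_abs p (X n * (Y m - Y n)) < e / 2"
    proof -
      have "padic_abs p (X n * (Y m - Y n)) \<le> A * padic_abs p (Y m - Y n)"
        unfolding padic_abs_mult[OF p] by (intro mult_right_mono A) auto
      also have "\<dots> < A * (e / (2 * A))" using N2 mn A by (intro mult_strict_left_mono) auto
      finally show ?thesis using A by simp
    qed
    show ?thesis unfolding eq using padic_abs_triangle[OF p, of "(X m - X n) * Y m" "X n * (Y m - Y n)"] 1 2 by linarith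
  qed
  then show "\<exists>N. \<forall>m\<ge>N. \<forall>n\<ge>N. padic_abs p (X m * Y m - X n * Y n) < e" by blast
qed

lemma padic_integral_uminus: "padic_integral p X \<Longrightarrow> padic_integral p (\<lambda>n. - X n)"
  by (simp add: padic_integral_def)

lemma padic_integral_add:
  assumes p: "prime p" and X: "padic_integral p X" and Y: "padic_integral p Y"
  shows "padic_integral p (\<lambda>n. X n + Y n)"
  using eventually_conj[OF X[unfolded padic_integral_def] Y[unfolded padic_integral_def]]
  unfolding padic_integral_def
  by (rule eventually_mono) (meson padic_abs_add[OF p] max.bounded_iff order_trans max.boundedI)

lemma padic_integral_mult:
  assumes p: "prime p" and X: "padic_integral p X" and Y: "padic_integral p Y"
  shows "padic_integral p (\<lambda>n. X n * Y n)"
  using eventually_conj[OF X[unfolded padic_integral_def] Y[unfolded padic_integral_def]]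
  unfolding padic_integral_def
  by (rule eventually_mono) (simp add: padic_abs_mult[OF p] mult_le_one)

lemma adele_rep_const: "adele_rep (r, \<lambda>_ _. q)"
proof -
  have "{p. prime p \<and> \<not> padic_integral p (\<lambda>_. q)} \<subseteq> {p. prime p \<and> padic_abs p q > 1}"
    by (auto simp: padic_integral_def not_le[symmetric])
  then show ?thesis
    using finite_subset[OF _ finite_padic_abs_gt_1] by (auto simp: adele_rep_def)
qed

lemma adele_rep_uminus: "adele_rep x \<Longrightarrow> adele_rep (- fst x, \<lambda>p n. - snd x p n)"
  unfolding adele_rep_def
  by (auto simp: padic_Cauchy_uminus intro: finite_subset[rotated] dest: padic_integral_uminus)

lemma adele_rep_add:
  assumes "adele_rep x" "adele_rep y"
  shows "adele_rep (fst x + fst y, \<lambda>p n. snd x p n + snd y p n)"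
proof -
  have "{p. prime p \<and> \<not> padic_integral p (\<lambda>n. snd x p n + snd y p n)}
     \<subseteq> {p. prime p \<and> \<not> padic_integral p (snd x p)} \<union> {p. prime p \<and> \<not> padic_integral p (snd y p)}"
    using padic_integral_add by blast
  then show ?thesis using assms finite_subset unfolding adele_rep_def
    by (auto simp: padic_Cauchy_add)
qed

lemma adele_rep_mult:
  assumes "adele_rep x" "adele_rep y"
  shows "adele_rep (fst x * fst y, \<lambda>p n. snd x p n * snd y p n)"
proof -
  have "{p. prime p \<and> \<not> padic_integral p (\<lambda>n. snd x p n * snd y p n)}
     \<subseteq> {p. prime p \<and> \<not> padic_integral p (snd x p)} \<union> {p. prime p \<and> \<not> padic_integral p (snd y p)}"
    using padic_integral_mult by blast
  then show ?thesis using assms finite_subset unfolding adele_rep_def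
    by (auto simp: padic_Cauchy_mult)
qed

lemma adele_relI: "adele_rep y \<Longrightarrow> x = y \<Longrightarrow> adele_rel x y"
  by (simp add: adele_rel_def)

lemma part_equivp_adele_rel: "part_equivp adele_rel"
proof (rule part_equivpI)
  have "adele_rel (0, \<lambda>_ _. 0) (0, \<lambda>_ _. 0)" by (simp add: adele_rel_def adele_rep_const)
  then show "\<exists>x. adele_rel x x" by blast
  show "symp adele_rel" by (auto intro!: sympI simp: adele_rel_def padic_abs_minus_commute)
  show "transp adele_rel"
  proof (rule transpI)
    fix x y z assume xy: "adele_rel x y" and yz: "adele_rel y z"
    have "(\<lambda>n. padic_abs p (snd x p n - snd z p n)) \<longlonglongrightarrow> 0" if p: "prime p" for p
    proof (rule tendsto_sandwich[OF _ _ tendsto_const])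
      have "(\<lambda>n. padic_abs p (snd x p n - snd y p n) + padic_abs p (snd y p n - snd z p n)) \<longlonglongrightarrow> 0 + 0"
        using xy yz p by (intro tendsto_add) (auto simp: adele_rel_def)
      then show "(\<lambda>n. padic_abs p (snd x p n - snd y p n) + padic_abs p (snd y p n - snd z p n)) \<longlonglongrightarrow> 0" by simp
      show "\<forall>\<^sub>F n in sequentially. padic_abs p (snd x p n - snd z p n)
          \<le> padic_abs p (snd x p n - snd y p n) + padic_abs p (snd y p n - snd z p n)"
        using padic_abs_triangle[OF p] by (metis (no_types, lifting) always_eventually diff_add_cancel add_diff_eq)
    qed auto
    then show "adele_rel x z" using xy yz by (auto simp: adele_rel_def)
  qed
qed

quotient_type adele = "real \<times> (nat \<Rightarrow> nat \<Rightarrow> rat)" / partial: adele_rel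
  by (rule part_equivp_adele_rel)

lift_definition adele_of_rat :: "rat \<Rightarrow> adele" is "\<lambda>q. (of_rat q, \<lambda>_ _. q)"
  by (simp add: adele_rel_def adele_rep_const)

lift_definition arch_part :: "adele \<Rightarrow> real" is fst
  by (simp add: adele_rel_def)

text \<open>\<open>adele_padic_abs p x\<close> is the \<open>p\<close>-adic absolute value of the \<open>p\<close>-component of \<open>x\<close>.\<close>

lift_definition adele_padic_abs :: "nat \<Rightarrow> adele \<Rightarrow> real"
  is "\<lambda>p x. if prime p then lim (\<lambda>n. padic_abs p (snd x p n)) else 0"
proof -
  fix p :: nat and x y assume xy: "adele_rel x y"
  show "(if prime p then lim (\<lambda>n. padic_abs p (snd x p n)) else 0) =
        (if prime p then lim (\<lambda>n. padic_abs p (snd y p n)) else 0)"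
  proof (cases "prime p")
    case True
    let ?a = "\<lambda>n. padic_abs p (snd x p n)" and ?b = "\<lambda>n. padic_abs p (snd y p n)"
    have d: "(\<lambda>n. padic_abs p (snd x p n - snd y p n)) \<longlonglongrightarrow> 0"
      using xy True by (simp add: adele_rel_def)
    have ab: "(\<lambda>n. ?a n - ?b n) \<longlonglongrightarrow> 0"
      by (rule Lim_null_comparison[OF _ d]) (simp add: padic_abs_triangle_diff[OF True])
    have "?a \<longlonglongrightarrow> L \<longleftrightarrow> ?b \<longlonglongrightarrow> L" for L
      by (rule Lim_transform_eq[OF ab])
    then show ?thesis using True by (simp only: lim_def if_True)
  qed simp
qed

text \<open>\<open>with_arch_part t x\<close> is \<open>x\<close> with its real component replaced by \<open>t\<close>.\<close>

lift_definition with_arch_part :: "real \<Rightarrow> adele \<Rightarrow> adele" is "\<lambda>t x. (t, snd x)"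
  by (simp add: adele_rel_def adele_rep_def)

lemma adele_cases:
  obtains x where "a = abs_adele x" "adele_rep x"
proof -
  have "adele_rel (rep_adele a) (rep_adele a)" by (rule Quotient3_rep_reflp[OF Quotient3_adele])
  then have "adele_rep (rep_adele a)" by (simp add: adele_rel_def)
  moreover have "a = abs_adele (rep_adele a)" by (simp add: Quotient3_abs_rep[OF Quotient3_adele])
  ultimately show ?thesis using that by blast
qed

lemma abs_adele_eqD: "abs_adele x = abs_adele y \<Longrightarrow> adele_rep x \<Longrightarrow> adele_rep y \<Longrightarrow> adele_rel x y"
  using Quotient3_rel[OF Quotient3_adele, of x y] adele_relI by blast

instantiation adele :: comm_ring_1
begin

lift_definition zero_adele :: adele is "(0, \<lambda>_ _. 0)"
  by (simp add: adele_rel_def adele_rep_const)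

lift_definition one_adele :: adele is "(1, \<lambda>_ _. 1)"
  by (simp add: adele_rel_def adele_rep_const)

lift_definition plus_adele :: "adele \<Rightarrow> adele \<Rightarrow> adele"
  is "\<lambda>x y. (fst x + fst y, \<lambda>p n. snd x p n + snd y p n)"
proof -
  fix x x' y y' assume x: "adele_rel x x'" and y: "adele_rel y y'"
  have "(\<lambda>n. padic_abs p (snd x p n + snd y p n - (snd x' p n + snd y' p n))) \<longlonglongrightarrow> 0" if p: "prime p" for p
  proof (rule tendsto_sandwich[OF _ _ tendsto_const])
    have "(\<lambda>n. padic_abs p (snd x p n - snd x' p n) + padic_abs p (snd y p n - snd y' p n)) \<longlonglongrightarrow> 0 + 0"
      using x y p by (intro tendsto_add) (auto simp: adele_rel_def)
    then show "(\<lambda>n. padic_abs p (snd x p n - snd x' p n) + padic_abs p (snd y p n - snd y' p n)) \<longlonglongrightarrow> 0" by simp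
    show "\<forall>\<^sub>F n in sequentially. padic_abs p (snd x p n + snd y p n - (snd x' p n + snd y' p n))
        \<le> padic_abs p (snd x p n - snd x' p n) + padic_abs p (snd y p n - snd y' p n)"
      using padic_abs_triangle[OF p] by (metis (no_types, lifting) always_eventually add_diff_add)
  qed auto
  then show "adele_rel (fst x + fst y, \<lambda>p n. snd x p n + snd y p n) (fst x' + fst y', \<lambda>p n. snd x' p n + snd y' p n)"
    using x y unfolding adele_rel_def by (intro conjI adele_rep_add) simp_all
qed

lift_definition uminus_adele :: "adele \<Rightarrow> adele"
  is "\<lambda>x. (- fst x, \<lambda>p n. - snd x p n)"
proof -
  fix x y assume xy: "adele_rel x y"
  have "padic_abs p (- snd x p n - - snd y p n) = padic_abs p (snd x p n - snd y p n)" for p n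
    using padic_abs_minus_commute[of p "snd y p n"] by (simp add: algebra_simps)
  then show "adele_rel (- fst x, \<lambda>p n. - snd x p n) (- fst y, \<lambda>p n. - snd y p n)"
    using xy unfolding adele_rel_def by (intro conjI adele_rep_uminus) simp_all
qed

definition minus_adele :: "adele \<Rightarrow> adele \<Rightarrow> adele" where "minus_adele x y = x + (- y)"

lift_definition times_adele :: "adele \<Rightarrow> adele \<Rightarrow> adele"
  is "\<lambda>x y. (fst x * fst y, \<lambda>p n. snd x p n * snd y p n)"
proof -
  fix x x' y y' assume x: "adele_rel x x'" and y: "adele_rel y y'"
  have "(\<lambda>n. padic_abs p (snd x p n * snd y p n - (snd x' p n * snd y' p n))) \<longlonglongrightarrow> 0" if p: "prime p" for p
  proof -
    obtain A where A: "A > 0" "\<And>n. padic_abs p (snd y p n) \<le> A"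
      using padic_Cauchy_bounded[OF p, of "snd y p"] y p by (auto simp: adele_rel_def adele_rep_def)
    obtain B where B: "B > 0" "\<And>n. padic_abs p (snd x' p n) \<le> B"
      using padic_Cauchy_bounded[OF p, of "snd x' p"] x p by (auto simp: adele_rel_def adele_rep_def)
    show ?thesis
    proof (rule tendsto_sandwich[OF _ _ tendsto_const])
      have "(\<lambda>n. padic_abs p (snd x p n - snd x' p n) * A + B * padic_abs p (snd y p n - snd y' p n)) \<longlonglongrightarrow> 0 * A + B * 0"
        using x y p by (intro tendsto_add tendsto_mult tendsto_const) (auto simp: adele_rel_def)
      then show "(\<lambda>n. padic_abs p (snd x p n - snd x' p n) * A + B * padic_abs p (snd y p n - snd y' p n)) \<longlonglongrightarrow> 0" by simp
      show "\<forall>\<^sub>F n in sequentially. padic_abs p (snd x p n * snd y p n - snd x' p n * snd y' p n)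
        \<le> padic_abs p (snd x p n - snd x' p n) * A + B * padic_abs p (snd y p n - snd y' p n)"
      proof (intro always_eventually allI)
        fix n
        have eq: "snd x p n * snd y p n - snd x' p n * snd y' p n
          = (snd x p n - snd x' p n) * snd y p n + snd x' p n * (snd y p n - snd y' p n)" by (simp add: algebra_simps)
        have "padic_abs p (snd x p n * snd y p n - snd x' p n * snd y' p n)
           \<le> padic_abs p (snd x p n - snd x' p n) * padic_abs p (snd y p n)
            + padic_abs p (snd x' p n) * padic_abs p (snd y p n - snd y' p n)"
          unfolding eq padic_abs_mult[OF p, symmetric] by (rule padic_abs_triangle[OF p])
        also have "\<dots> \<le> padic_abs p (snd x p n - snd x' p n) * A + B * padic_abs p (snd y p n - snd y' p n)"
          by (intro add_mono mult_left_mono mult_right_mono A B) auto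
        finally show "padic_abs p (snd x p n * snd y p n - snd x' p n * snd y' p n)
            \<le> padic_abs p (snd x p n - snd x' p n) * A + B * padic_abs p (snd y p n - snd y' p n)" .
      qed
    qed auto
  qed
  then show "adele_rel (fst x * fst y, \<lambda>p n. snd x p n * snd y p n) (fst x' * fst y', \<lambda>p n. snd x' p n * snd y' p n)"
    using x y unfolding adele_rel_def by (intro conjI adele_rep_mult) simp_all
qed

instance
proof
  fix a b c :: adele
  obtain x where x: "a = abs_adele x" "adele_rep x" by (rule adele_cases)
  obtain y where y: "b = abs_adele y" "adele_rep y" by (rule adele_cases)
  obtain z where z: "c = abs_adele z" "adele_rep z" by (rule adele_cases)
  note r = adele_relI[OF _ refl]
  have plus: "abs_adele u + abs_adele v = abs_adele (fst u + fst v, \<lambda>p n. snd u p n + snd v p n)"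
    if "adele_rep u" "adele_rep v" for u v
    using that by (intro plus_adele.abs_eq r)
  have times: "abs_adele u * abs_adele v = abs_adele (fst u * fst v, \<lambda>p n. snd u p n * snd v p n)"
    if "adele_rep u" "adele_rep v" for u v
    using that by (intro times_adele.abs_eq r)
  have uminus: "- abs_adele u = abs_adele (- fst u, \<lambda>p n. - snd u p n)" if "adele_rep u" for u
    using that by (intro uminus_adele.abs_eq r)
  note ops = plus times uminus adele_rep_add adele_rep_mult adele_rep_uminus adele_rep_const
    zero_adele.abs_eq one_adele.abs_eq
  show "a * b * c = a * (b * c)"
    unfolding x y z using x(2) y(2) z(2) by (simp add: ops mult.assoc)
  show "a * b = b * a"
    unfolding x y using x(2) y(2) by (simp add: ops mult.commute)
  show "1 * a = a"
    unfolding x using x(2) by (simp add: ops)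
  show "a + b + c = a + (b + c)"
    unfolding x y z using x(2) y(2) z(2) by (simp add: ops add.assoc)
  show "a + b = b + a"
    unfolding x y using x(2) y(2) by (simp add: ops add.commute)
  show "0 + a = a"
    unfolding x using x(2) by (simp add: ops)
  show "- a + a = 0"
    unfolding x using x(2) by (simp add: ops)
  show "a - b = a + - b" by (rule minus_adele_def)
  show "(a + b) * c = a * c + b * c"
    unfolding x y z using x(2) y(2) z(2) by (simp add: ops distrib_right)
  show "(0::adele) \<noteq> 1"
  proof
    assume "(0::adele) = 1"
    then have "adele_rel (0, \<lambda>_ _. 0) (1, \<lambda>_ _. 1)"
      unfolding zero_adele.abs_eq one_adele.abs_eq
      by (rule abs_adele_eqD) (rule adele_rep_const)+
    then show False by (simp add: adele_rel_def)
  qed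
qed

end

text \<open>
  The restricted product topology: a basic neighbourhood of \<open>x\<close> restricts finitely many places
  to small balls, and all remaining primes to the maximal compact subring.
\<close>

instantiation adele :: topological_space
begin

definition open_adele :: "adele set \<Rightarrow> bool" where
  "open_adele U \<longleftrightarrow> (\<forall>x\<in>U. \<exists>e>0. \<exists>S. finite S \<and>
     (\<forall>y. \<bar>arch_part (y - x)\<bar> < e \<and>
          (\<forall>p\<in>S. prime p \<longrightarrow> adele_padic_abs p (y - x) < e) \<and>
          (\<forall>p. prime p \<longrightarrow> adele_padic_abs p (y - x) \<le> 1) \<longrightarrow> y \<in> U))"

instance
proof
  show "open (UNIV :: adele set)" unfolding open_adele_def by (auto intro: exI[of _ 1])
next
  fix U V :: "adele set" assume U: "open U" and V: "open V"
  show "open (U \<inter> V)" unfolding open_adele_def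
  proof
    fix x assume x: "x \<in> U \<inter> V"
    obtain e S where e: "e > 0" "finite S" "\<And>y. \<bar>arch_part (y - x)\<bar> < e \<and>
          (\<forall>p\<in>S. prime p \<longrightarrow> adele_padic_abs p (y - x) < e) \<and>
          (\<forall>p. prime p \<longrightarrow> adele_padic_abs p (y - x) \<le> 1) \<Longrightarrow> y \<in> U"
      using U x unfolding open_adele_def by (metis IntD1)
    obtain d T where d: "d > 0" "finite T" "\<And>y. \<bar>arch_part (y - x)\<bar> < d \<and>
          (\<forall>p\<in>T. prime p \<longrightarrow> adele_padic_abs p (y - x) < d) \<and>
          (\<forall>p. prime p \<longrightarrow> adele_padic_abs p (y - x) \<le> 1) \<Longrightarrow> y \<in> V"
      using V x unfolding open_adele_def by (metis IntD2)
    show "\<exists>e>0. \<exists>S. finite S \<and> (\<forall>y. \<bar>arch_part (y - x)\<bar> < e \<and>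
          (\<forall>p\<in>S. prime p \<longrightarrow> adele_padic_abs p (y - x) < e) \<and>
          (\<forall>p. prime p \<longrightarrow> adele_padic_abs p (y - x) \<le> 1) \<longrightarrow> y \<in> U \<inter> V)"
      using e d by (intro exI[of _ "min e d"] conjI exI[of _ "S \<union> T"]) auto
  qed
next
  fix K :: "adele set set" assume K: "\<forall>U\<in>K. open U"
  show "open (\<Union>K)" unfolding open_adele_def
  proof
    fix x assume "x \<in> \<Union>K"
    then obtain U where U: "U \<in> K" "x \<in> U" by blast
    with K have "open U" by blast
    then obtain e S where e: "e > 0" "finite S" "\<And>y. \<bar>arch_part (y - x)\<bar> < e \<and>
          (\<forall>p\<in>S. prime p \<longrightarrow> adele_padic_abs p (y - x) < e) \<and>
          (\<forall>p. prime p \<longrightarrow> adele_padic_abs p (y - x) \<le> 1) \<Longrightarrow> y \<in> U"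
      using U(2) unfolding open_adele_def by meson
    then show "\<exists>e>0. \<exists>S. finite S \<and> (\<forall>y. \<bar>arch_part (y - x)\<bar> < e \<and>
          (\<forall>p\<in>S. prime p \<longrightarrow> adele_padic_abs p (y - x) < e) \<and>
          (\<forall>p. prime p \<longrightarrow> adele_padic_abs p (y - x) \<le> 1) \<longrightarrow> y \<in> \<Union>K)"
      using U(1) by (intro exI[of _ e] conjI exI[of _ S]) auto
  qed
qed

end

section \<open>The standard character and integration over the quotient of the adeles by the rationals\<close>

text \<open>The \<open>p\<close>-adic fractional part: the representative in \<open>Z[1/p] \<inter> [0,1)\<close> of \<open>x\<^sub>p + Z\<^sub>p\<close>.\<close>

definition padic_frac :: "nat \<Rightarrow> adele \<Rightarrow> rat" where
  "padic_frac p x = (THE r. 0 \<le> r \<and> r < 1 \<and> (\<exists>k. of_nat p ^ k * r \<in> \<int>) \<and>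
     adele_padic_abs p (x - adele_of_rat r) \<le> 1)"

text \<open>\<open>\<^bold>e(x) = exp(2 \<pi> i x\<^sub>\<infinity>) \<Prod>\<^sub>p exp(- 2 \<pi> i {x\<^sub>p})\<close>, with opposite signs at the real and
  the finite places so that the rationals lie in the kernel; only primes at which \<open>x\<close> is not
  integral contribute.\<close>

definition adele_char :: "adele \<Rightarrow> complex" where
  "adele_char x = cis (2 * pi * (arch_part x -
     (\<Sum>p\<in>{p. prime p \<and> adele_padic_abs p x > 1}. of_rat (padic_frac p x))))"

definition haar_measure :: "'a::{ab_group_add, topological_space} measure \<Rightarrow> bool" where
  "haar_measure \<mu> \<longleftrightarrow> sets \<mu> = sets borel \<and>
     (\<forall>a. \<forall>B\<in>sets borel. emeasure \<mu> ((+) a ` B) = emeasure \<mu> B) \<and>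
     (\<forall>K. compact K \<longrightarrow> emeasure \<mu> K < \<infinity>) \<and>
     (\<forall>U. open U \<and> U \<noteq> {} \<longrightarrow> emeasure \<mu> U > 0)"

text \<open>\<open>[0,1) \<times> \<Prod>\<^sub>p Z\<^sub>p\<close>, a strict fundamental domain for the translation action of the rationals.\<close>

definition adele_fund_domain :: "adele set" where
  "adele_fund_domain = {x. 0 \<le> arch_part x \<and> arch_part x < 1 \<and>
     (\<forall>p. prime p \<longrightarrow> adele_padic_abs p x \<le> 1)}"

text \<open>The invariant measure on the quotient of the adeles by the rationals induced by a Haar
  measure of the adeles, carried by the fundamental domain: the integral over the quotient of a
  function invariant under rational translations is its integral against this measure.\<close>

definition adele_quot_measure :: "adele measure \<Rightarrow> adele measure" where
  "adele_quot_measure dx = density dx (indicator adele_fund_domain)"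

section \<open>Matrix groups\<close>

definition SL4 :: "(('a::comm_ring_1)^4^4) set" where
  "SL4 = {g. det g = 1}"

abbreviation rat_matrix :: "rat^4^4 \<Rightarrow> adele^4^4" where
  "rat_matrix \<equiv> map_matrix adele_of_rat"

definition matrix_unit :: "4 \<Rightarrow> 4 \<Rightarrow> 'a \<Rightarrow> ('a::zero)^4^4" where
  "matrix_unit i j c = (\<chi> k l. if k = i \<and> l = j then c else 0)"

text \<open>The unipotent matrix with entries \<open>x (i, j)\<close> at the off-diagonal positions \<open>(i, j) \<in> S\<close>.\<close>

definition unip_matrix :: "(4 \<times> 4) set \<Rightarrow> (4 \<times> 4 \<Rightarrow> 'a) \<Rightarrow> ('a::zero_neq_one)^4^4" where
  "unip_matrix S x = (\<chi> i j. if i = j then 1 else if (i, j) \<in> S then x (i, j) else 0)"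

definition unip_group :: "(4 \<times> 4) set \<Rightarrow> (('a::zero_neq_one)^4^4) set" where
  "unip_group S = range (unip_matrix S)"

text \<open>Shapes \<open>S\<close> of strictly upper triangular matrices for which \<open>unip_group S\<close> is an abelian
  group with \<open>unip_matrix S x ** unip_matrix S y = unip_matrix S (x + y)\<close>.\<close>

definition abelian_shape :: "(4 \<times> 4) set \<Rightarrow> bool" where
  "abelian_shape S \<longleftrightarrow> S \<subseteq> {(1,2), (1,3), (1,4), (2,3), (2,4), (3,4)} \<and>
     (\<forall>i j k. (i, j) \<in> S \<longrightarrow> (j, k) \<notin> S)"

text \<open>Integration over the quotient of \<open>unip_group S\<close> at the adeles by its rational points, with
  respect to the product measure in the coordinates \<open>u\<^sub>i\<^sub>j\<close>, \<open>(i, j) \<in> S\<close>.\<close>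

definition unip_integral ::
  "adele measure \<Rightarrow> (4 \<times> 4) set \<Rightarrow> (adele^4^4 \<Rightarrow> complex) \<Rightarrow> complex" where
  "unip_integral dx S f =
     (\<integral>x. f (unip_matrix S x) \<partial>(PiM S (\<lambda>_. adele_quot_measure dx)))"

section \<open>Automorphic forms on SL(4)\<close>

text \<open>Functions on \<open>SL(4)\<close> over the adeles are functions on all adelic matrices whose values
  outside of \<open>SL4\<close> are irrelevant.\<close>

primrec Ck_on :: "nat \<Rightarrow> ('a::real_normed_vector \<Rightarrow> 'b::real_normed_vector) \<Rightarrow> 'a set \<Rightarrow> bool" where
  "Ck_on 0 f U \<longleftrightarrow> continuous_on U f"
| "Ck_on (Suc k) f U \<longleftrightarrow> (\<forall>x\<in>U. f differentiable (at x)) \<and>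
     (\<forall>v. Ck_on k (\<lambda>x. frechet_derivative f (at x) v) U)"

definition smooth_on_SL4R :: "(real^4^4 \<Rightarrow> complex) \<Rightarrow> bool" where
  "smooth_on_SL4R f \<longleftrightarrow> (\<forall>x\<in>SL4. \<exists>U F. open U \<and> x \<in> U \<and> (\<forall>k. Ck_on k F U) \<and>
     (\<forall>y\<in>U \<inter> SL4. F y = f y))"

definition smooth_adelic :: "(adele^4^4 \<Rightarrow> complex) \<Rightarrow> bool" where
  "smooth_adelic \<phi> \<longleftrightarrow> (\<forall>g\<in>SL4. \<exists>W f. open W \<and> g \<in> W \<and> smooth_on_SL4R f \<and>
     (\<forall>h\<in>W \<inter> SL4. \<phi> h = f (map_matrix arch_part h)))"

definition finite_dim_on :: "'a set \<Rightarrow> ('a \<Rightarrow> complex) set \<Rightarrow> bool" where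
  "finite_dim_on A F \<longleftrightarrow> (\<exists>B. finite B \<and>
     (\<forall>f\<in>F. \<exists>c. \<forall>x\<in>A. f x = (\<Sum>b\<in>B. c b * b x)))"

text \<open>The standard maximal compact subgroup \<open>SO(4) \<times> \<Prod>\<^sub>p SL(4, Z\<^sub>p)\<close>.\<close>

definition max_compact :: "(adele^4^4) set" where
  "max_compact = {k\<in>SL4. orthogonal_matrix (map_matrix arch_part k) \<and>
     (\<forall>p i j. prime p \<longrightarrow> adele_padic_abs p (k $ i $ j) \<le> 1)}"

definition mat_exp :: "real^4^4 \<Rightarrow> real^4^4" where
  "mat_exp X = (\<Sum>k. (1 / fact k) *\<^sub>R (((**) X ^^ k) (mat 1)))"

text \<open>\<open>arch_matrix A\<close> has real component \<open>A\<close> and identity components at all primes.\<close>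

definition arch_matrix :: "real^4^4 \<Rightarrow> adele^4^4" where
  "arch_matrix A = (\<chi> i j. with_arch_part (A $ i $ j) (mat 1 $ i $ j))"

definition lie_deriv :: "real^4^4 \<Rightarrow> (adele^4^4 \<Rightarrow> complex) \<Rightarrow> adele^4^4 \<Rightarrow> complex" where
  "lie_deriv X f g = vector_derivative (\<lambda>t. f (g ** arch_matrix (mat_exp (t *\<^sub>R X)))) (at 0)"

text \<open>An element \<open>\<Sum> c X\<^sub>1 \<dots> X\<^sub>k\<close> of the universal enveloping algebra of the complexification
  of \<open>sl(4, R)\<close> is represented by the list of its terms \<open>(c, [X\<^sub>1, \<dots>, X\<^sub>k])\<close>.\<close>

definition enveloping_element :: "(complex \<times> (real^4^4) list) list \<Rightarrow> bool" where
  "enveloping_element T \<longleftrightarrow> (\<forall>(c, Xs)\<in>set T. \<forall>X\<in>set Xs. trace X = 0)"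

definition enveloping_act ::
  "(complex \<times> (real^4^4) list) list \<Rightarrow> (adele^4^4 \<Rightarrow> complex) \<Rightarrow> adele^4^4 \<Rightarrow> complex" where
  "enveloping_act T f g = (\<Sum>(c, Xs)\<leftarrow>T. c * foldr lie_deriv Xs f g)"

text \<open>The enveloping algebra acts faithfully on smooth functions, so its centre consists of the
  elements whose action commutes with that of the Lie algebra.\<close>

definition central_element :: "(complex \<times> (real^4^4) list) list \<Rightarrow> bool" where
  "central_element T \<longleftrightarrow> enveloping_element T \<and>
     (\<forall>X f. trace X = 0 \<and> smooth_adelic f \<longrightarrow>
        (\<forall>g\<in>SL4. enveloping_act T (lie_deriv X f) g = lie_deriv X (enveloping_act T f) g))"

text \<open>\<open>\<parallel>g\<parallel> = \<Prod>\<^sub>v max\<^sub>i\<^sub>j {|g\<^sub>i\<^sub>j|\<^sub>v, |(g\<^sup>-\<^sup>1)\<^sub>i\<^sub>j|\<^sub>v}\<close> over all places \<open>v\<close>;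
  for \<open>g \<in> SL4\<close> almost all factors are 1.\<close>

definition local_norm :: "(adele \<Rightarrow> real) \<Rightarrow> adele^4^4 \<Rightarrow> real" where
  "local_norm v g = Max (range (\<lambda>(i, j). max (v (g $ i $ j)) (v (matrix_inv g $ i $ j))))"

definition adelic_norm :: "adele^4^4 \<Rightarrow> real" where
  "adelic_norm g = local_norm (\<lambda>x. \<bar>arch_part x\<bar>) g *
     (\<Prod>p\<in>{p. prime p \<and> local_norm (adele_padic_abs p) g \<noteq> 1}. local_norm (adele_padic_abs p) g)"

definition automorphic_form :: "(adele^4^4 \<Rightarrow> complex) \<Rightarrow> bool" where
  "automorphic_form \<phi> \<longleftrightarrow>
     smooth_adelic \<phi> \<and>
     (\<forall>\<gamma>\<in>SL4. \<forall>g\<in>SL4. \<phi> (rat_matrix \<gamma> ** g) = \<phi> g) \<and>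
     finite_dim_on SL4 {\<lambda>g. \<phi> (g ** k) | k. k \<in> max_compact} \<and>
     finite_dim_on SL4 {enveloping_act T \<phi> | T. central_element T} \<and>
     (\<exists>C n. \<forall>g\<in>SL4. norm (\<phi> g) \<le> C * adelic_norm g ^ n)"

section \<open>Fourier coefficients\<close>

datatype simple_root = Alpha1 | Alpha2 | Alpha3

fun root_shape :: "simple_root \<Rightarrow> (4 \<times> 4) set" where
  "root_shape Alpha1 = {(1,2), (1,3), (1,4)}"
| "root_shape Alpha2 = {(1,3), (1,4), (2,3), (2,4)}"
| "root_shape Alpha3 = {(1,4), (2,4), (3,4)}"

text \<open>Unitary characters of the adelic points of \<open>U\<^sub>\<alpha>\<close> that are trivial on the rational points.\<close>

definition unitary_character :: "simple_root \<Rightarrow> (adele^4^4 \<Rightarrow> complex) \<Rightarrow> bool" where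
  "unitary_character \<alpha> \<psi> \<longleftrightarrow>
     (\<forall>u\<in>unip_group (root_shape \<alpha>). \<forall>v\<in>unip_group (root_shape \<alpha>). \<psi> (u ** v) = \<psi> u * \<psi> v) \<and>
     (\<forall>u\<in>unip_group (root_shape \<alpha>). norm (\<psi> u) = 1) \<and>
     continuous_on (unip_group (root_shape \<alpha>)) \<psi> \<and>
     (\<forall>\<gamma>\<in>unip_group (root_shape \<alpha>). \<psi> (rat_matrix \<gamma>) = 1)"

definition character_matrix :: "simple_root \<Rightarrow> (adele^4^4 \<Rightarrow> complex) \<Rightarrow> rat^4^4 \<Rightarrow> bool" where
  "character_matrix \<alpha> \<psi> M \<longleftrightarrow> M \<in> unip_group (root_shape \<alpha>) \<and>
     (\<forall>u\<in>unip_group (root_shape \<alpha>).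
        \<psi> u = adele_char (\<Sum>(i, j)\<in>root_shape \<alpha>. adele_of_rat (M $ i $ j) * u $ i $ j))"

definition fourier_coeff :: "adele measure \<Rightarrow> simple_root \<Rightarrow> (adele^4^4 \<Rightarrow> complex) \<Rightarrow>
    (adele^4^4 \<Rightarrow> complex) \<Rightarrow> adele^4^4 \<Rightarrow> complex" where
  "fourier_coeff dx \<alpha> \<psi> \<phi> g = unip_integral dx (root_shape \<alpha>) (\<lambda>u. \<phi> (u ** g) * cnj (\<psi> u))"

definition coeff_min :: "adele measure \<Rightarrow> (adele^4^4 \<Rightarrow> complex) \<Rightarrow> rat \<Rightarrow> adele^4^4 \<Rightarrow> complex" where
  "coeff_min dx \<phi> m g =
     (\<integral>x. \<phi> ((mat 1 + matrix_unit 1 4 x) ** g) * cnj (adele_char (adele_of_rat m * x))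
        \<partial>adele_quot_measure dx)"

definition coeff_ntm :: "adele measure \<Rightarrow> (adele^4^4 \<Rightarrow> complex) \<Rightarrow> rat \<Rightarrow> rat \<Rightarrow> rat \<Rightarrow> rat \<Rightarrow>
    adele^4^4 \<Rightarrow> complex" where
  "coeff_ntm dx \<phi> m1 m2 m3 m4 g =
     unip_integral dx {(1,3), (1,4), (2,3), (2,4)}
       (\<lambda>u. \<phi> (u ** g) * cnj (adele_char (adele_of_rat m1 * u $ 1 $ 3 + adele_of_rat m2 * u $ 1 $ 4 +
                                       adele_of_rat m3 * u $ 2 $ 3 + adele_of_rat m4 * u $ 2 $ 4)))"

definition orbit_coeffs_min ::
  "adele measure \<Rightarrow> (adele^4^4 \<Rightarrow> complex) \<Rightarrow> (adele^4^4 \<Rightarrow> complex) set" where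
  "orbit_coeffs_min dx \<phi> = {coeff_min dx \<phi> m | m. m \<noteq> 0}"

definition orbit_coeffs_ntm ::
  "adele measure \<Rightarrow> (adele^4^4 \<Rightarrow> complex) \<Rightarrow> (adele^4^4 \<Rightarrow> complex) set" where
  "orbit_coeffs_ntm dx \<phi> = {coeff_ntm dx \<phi> m1 m2 m3 m4 | m1 m2 m3 m4. m1 * m4 - m2 * m3 \<noteq> 0}"

text \<open>\<open>F\<close> is an integral, over the compact quotient \<open>V(Q)\V(A)\<close> of a unipotent
  group \<open>V = unip_group S\<close>, of an orbit coefficient evaluated at the translates \<open>v l g\<close> of \<open>g\<close>, where
  \<open>l \<in> SL(4, Q)\<close>.  For \<open>S = {}\<close> the group is trivial and \<open>F g = f (l g)\<close>.\<close>

definition determined_by :: "adele measure \<Rightarrow> (adele^4^4 \<Rightarrow> complex) set \<Rightarrow>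
    (adele^4^4 \<Rightarrow> complex) \<Rightarrow> bool" where
  "determined_by dx \<C> F \<longleftrightarrow> (\<exists>f\<in>\<C>. \<exists>S l. abelian_shape S \<and> l \<in> SL4 \<and>
     (\<forall>g\<in>SL4. F g = unip_integral dx S (\<lambda>v. f (v ** rat_matrix l ** g))))"

section \<open>Orbits of character matrices\<close>

definition SL4_orbit :: "('a::field)^4^4 \<Rightarrow> ('a^4^4) set" where
  "SL4_orbit M = {\<gamma> ** M ** matrix_inv \<gamma> | \<gamma>. \<gamma> \<in> SL4}"

definition M_min :: "('a::field)^4^4" where
  "M_min = mat 1 + matrix_unit 1 4 1"

text \<open>\<open>M_ntm 1\<close> is the representative \<open>1 + E\<^sub>1\<^sub>3 + E\<^sub>2\<^sub>4\<close>.  All \<open>M_ntm d - 1\<close> with \<open>d \<noteq> 0\<close> lie in the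
  nilpotent orbit \<open>(2\<^sup>2)\<close>, but over a field with non-squares that orbit splits into several
  \<open>SL4\<close>-orbits, with representatives \<open>M_ntm d\<close> for \<open>d\<close> running through the classes of
  nonzero elements modulo squares; see the lemma below.\<close>

definition M_ntm :: "'a \<Rightarrow> ('a::field)^4^4" where
  "M_ntm d = mat 1 + matrix_unit 1 3 1 + matrix_unit 2 4 d"

lemma SL4_orbit_iff:
  "N \<in> SL4_orbit M \<longleftrightarrow> (\<exists>\<gamma>\<in>SL4. \<gamma> ** M = N ** \<gamma>)"
proof -
  have inv: "matrix_inv \<gamma> ** \<gamma> = mat 1" "\<gamma> ** matrix_inv \<gamma> = mat 1" if "\<gamma> \<in> SL4" for \<gamma> :: "'a^4^4"
  proof -
    have "invertible \<gamma>" using that by (simp add: invertible_det_nz SL4_def)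
    then have "\<exists>B. \<gamma> ** B = mat 1 \<and> B ** \<gamma> = mat 1" by (simp add: invertible_def)
    then have "\<gamma> ** matrix_inv \<gamma> = mat 1 \<and> matrix_inv \<gamma> ** \<gamma> = mat 1"
      unfolding matrix_inv_def by (rule someI_ex)
    then show "matrix_inv \<gamma> ** \<gamma> = mat 1" "\<gamma> ** matrix_inv \<gamma> = mat 1" by auto
  qed
  have "N = \<gamma> ** M ** matrix_inv \<gamma> \<longleftrightarrow> \<gamma> ** M = N ** \<gamma>" if "\<gamma> \<in> SL4" for \<gamma>
    using inv[OF that] by (metis matrix_mul_assoc matrix_mul_rid)
  then show ?thesis unfolding SL4_orbit_def by blast
qed

lemma det_4:
  "det (A::'a::comm_ring_1^4^4) =
    A$1$1 * (A$2$2 * (A$3$3 * A$4$4 - A$3$4 * A$4$3) - A$2$3 * (A$3$2 * A$4$4 - A$3$4 * A$4$2)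
           + A$2$4 * (A$3$2 * A$4$3 - A$3$3 * A$4$2))
  - A$1$2 * (A$2$1 * (A$3$3 * A$4$4 - A$3$4 * A$4$3) - A$2$3 * (A$3$1 * A$4$4 - A$3$4 * A$4$1)
           + A$2$4 * (A$3$1 * A$4$3 - A$3$3 * A$4$1))
  + A$1$3 * (A$2$1 * (A$3$2 * A$4$4 - A$3$4 * A$4$2) - A$2$2 * (A$3$1 * A$4$4 - A$3$4 * A$4$1)
           + A$2$4 * (A$3$1 * A$4$2 - A$3$2 * A$4$1))
  - A$1$4 * (A$2$1 * (A$3$2 * A$4$3 - A$3$3 * A$4$2) - A$2$2 * (A$3$1 * A$4$3 - A$3$3 * A$4$1)
           + A$2$3 * (A$3$1 * A$4$2 - A$3$2 * A$4$1))"
proof -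
  have f1234: "finite {2::4, 3, 4}" "1 \<notin> {2::4, 3, 4}" by auto
  have f234: "finite {3::4, 4}" "2 \<notin> {3::4, 4}" by auto
  have f34: "finite {4::4}" "3 \<notin> {4::4}" by auto
  show ?thesis
    unfolding det_def UNIV_4
    unfolding sum_over_permutations_insert[OF f1234]
    unfolding sum_over_permutations_insert[OF f234]
    unfolding sum_over_permutations_insert[OF f34]
    unfolding permutes_sing
    by (simp add: sign_swap_id permutation_swap_id permutation_compose sign_compose sign_id swap_id_eq
        algebra_simps)
qed

lemma M_ntm_in_orbit_iff:
  assumes d: "d \<noteq> 0"
  shows "M_ntm d \<in> SL4_orbit (M_ntm 1) \<longleftrightarrow> (\<exists>q. d = q\<^sup>2)"
proof
  assume "M_ntm d \<in> SL4_orbit (M_ntm 1)"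
  then obtain g where g: "det g = 1" "g ** M_ntm 1 = M_ntm d ** g"
    by (auto simp: SL4_orbit_iff SL4_def)
  have e: "(g ** M_ntm 1) $ i $ j = (M_ntm d ** g) $ i $ j" for i j using g(2) by simp
  have z: "g$3$1 = 0" "g$3$2 = 0" "g$4$1 = 0" "g$4$2 = 0"
    "g$1$1 = g$3$3" "g$2$1 = d * g$4$3" "g$1$2 = g$3$4" "g$2$2 = d * g$4$4"
    using e[of 1 1] e[of 1 2] e[of 2 1] e[of 2 2] e[of 1 3] e[of 2 3] e[of 1 4] e[of 2 4] d
    by (simp_all add: matrix_matrix_mult_def sum_4 M_ntm_def matrix_unit_def mat_def)
  have "d * (g$3$3 * g$4$4 - g$3$4 * g$4$3)\<^sup>2 = 1"
    using g(1) unfolding det_4 z by (simp add: power2_eq_square algebra_simps)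
  moreover from this have "g$3$3 * g$4$4 - g$3$4 * g$4$3 \<noteq> 0" by auto
  ultimately have "d = (1 / (g$3$3 * g$4$4 - g$3$4 * g$4$3))\<^sup>2"
    by (simp add: field_simps)
  then show "\<exists>q. d = q\<^sup>2" by blast
next
  assume "\<exists>q. d = q\<^sup>2"
  then obtain q where q: "d = q\<^sup>2" by blast
  with d have q0: "q \<noteq> 0" by auto
  define g :: "'a^4^4" where "g = (\<chi> i j. if i = j then (if i = 2 then q else if i = 4 then 1 / q else 1) else (0::'a))"
  have "det g = 1" using q0 by (simp add: det_4 g_def)
  moreover have "g ** M_ntm 1 = M_ntm d ** g"
    using q0 by (simp add: vec_eq_iff forall_4 matrix_matrix_mult_def sum_4 M_ntm_def matrix_unit_def
        mat_def g_def q power2_eq_square)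
  ultimately show "M_ntm d \<in> SL4_orbit (M_ntm 1)" by (auto simp: SL4_orbit_iff SL4_def)
qed

end

theory Submission
  imports Defs
begin

text \<open>
  Each root shape is a rectangle \<open>R \<times> C\<close> with \<open>1 \<in> R\<close>, \<open>4 \<in> C\<close>, and the Levi subgroup acts on the
  character block \<open>M - 1\<close> by row operations within \<open>R\<close> and column operations within \<open>C\<close>.  If the block
  has rank one, \<open>M - 1 = v w\<^sup>T\<close>, then transvections alone move it to a multiple of \<open>E\<^sub>1\<^sub>4\<close>.  Conjugating
  the integration variable by a rational transvection shifts some coordinates by rational
  combinations of the others, so by Fubini its effect on the integral reduces to the translation
  invariance of the integral over \<open>Q\A\<close>; scalings, and with them the product formula, never
  enter.  Fubini then splits off the \<open>(1, 4)\<close> coordinate, and the inner integral is an orbit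
  coefficient for \<open>O\<^sub>m\<^sub>i\<^sub>n\<close>.  If the block has rank two, which forces \<open>\<alpha> = \<alpha>\<^sub>2\<close>, the Fourier
  coefficient is itself an orbit coefficient for \<open>O\<^sub>n\<^sub>t\<^sub>m\<close>.  The rank of \<open>M - 1\<close> separates the orbits.
\<close>

section \<open>Absolute values on the adeles\<close>

text \<open>The integrals are Bochner integrals against a measure carried by a fixed fundamental
  domain, and this shapes the argument twice. A shift of the variable moves the domain, so
  invariance is proved for functions that are periodic under rational translations, from a strict
  tiling of the adeles by the rational translates of the domain. Fubini requires integrability for
  the product measure, which is secured by measurability for the product sigma-algebra together with
  a bound. The class \<open>periodic\<close> collects these conditions and is stable under the
  conjugations used. The reduction of a rank-one character is one identity. The character pairs the
  block Y of a unipotent matrix with v w^T as v^T Y w. If v^T = p e_1^T l and l w = q e_4, and X = l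
  Y l^(-1) is the conjugated block, then v^T Y w = p q X_14; hence the index p q of the resulting
  orbit coefficient. In rank two the determinant of the block modulo squares is an obstruction to
  rational conjugacy with 1 + E_13 + E_24, so that comparison is made over the complex numbers and
  the rational class is recorded separately.\<close>

lemma padic_abs_tendsto:
  assumes "adele_rep x" "prime p"
  shows "(\<lambda>n. padic_abs p (snd x p n)) \<longlonglongrightarrow> adele_padic_abs p (abs_adele x)"
proof -
  have X: "padic_Cauchy p (snd x p)" using assms by (simp add: adele_rep_def)
  \<comment> \<open>The reverse triangle inequality makes the absolute values a real Cauchy
    sequence, so the \<open>lim\<close> in \<open>adele_padic_abs\<close> is a genuine limit and the
    laws of \<open>padic_abs\<close> pass to it.\<close>
  have "Cauchy (\<lambda>n. padic_abs p (snd x p n))"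
    unfolding Cauchy_def
  proof (intro allI impI)
    fix e :: real assume "e > 0"
    then obtain N where N: "\<forall>m\<ge>N. \<forall>n\<ge>N. padic_abs p (snd x p m - snd x p n) < e"
      using padic_CauchyD[OF X] by blast
    show "\<exists>M. \<forall>m\<ge>M. \<forall>n\<ge>M. dist (padic_abs p (snd x p m)) (padic_abs p (snd x p n)) < e"
      using N padic_abs_triangle_diff[OF assms(2)] by (metis dist_real_def order_le_less_trans)
  qed
  then have "convergent (\<lambda>n. padic_abs p (snd x p n))" by (simp add: Cauchy_convergent_iff)
  then show ?thesis
    using assms by (simp add: adele_padic_abs.abs_eq adele_relI convergent_LIMSEQ_iff)
qed

lemma adele_padic_abs_nonneg [simp]: "adele_padic_abs p x \<ge> 0"
proof (cases "prime p")
  case True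
  obtain r where r: "x = abs_adele r" "adele_rep r" by (rule adele_cases)
  show ?thesis unfolding r(1)
    by (rule LIMSEQ_le_const[OF padic_abs_tendsto[OF r(2) True]]) simp
next
  case False
  obtain r where r: "x = abs_adele r" "adele_rep r" by (rule adele_cases)
  show ?thesis using False r by (simp add: adele_padic_abs.abs_eq adele_relI)
qed

lemma plus_abs_adele: "adele_rep u \<Longrightarrow> adele_rep v \<Longrightarrow>
    abs_adele u + abs_adele v = abs_adele (fst u + fst v, \<lambda>p n. snd u p n + snd v p n)"
  by (intro plus_adele.abs_eq adele_relI refl)

lemma times_abs_adele: "adele_rep u \<Longrightarrow> adele_rep v \<Longrightarrow>
    abs_adele u * abs_adele v = abs_adele (fst u * fst v, \<lambda>p n. snd u p n * snd v p n)"
  by (intro times_adele.abs_eq adele_relI refl)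

lemma uminus_abs_adele: "adele_rep u \<Longrightarrow>
    - abs_adele u = abs_adele (- fst u, \<lambda>p n. - snd u p n)"
  by (intro uminus_adele.abs_eq adele_relI refl)

lemma adele_padic_abs_add:
  assumes p: "prime p"
  shows "adele_padic_abs p (x + y) \<le> max (adele_padic_abs p x) (adele_padic_abs p y)"
proof -
  obtain r where r: "x = abs_adele r" "adele_rep r" by (rule adele_cases)
  obtain s where s: "y = abs_adele s" "adele_rep s" by (rule adele_cases)
  have "(\<lambda>n. padic_abs p (snd r p n + snd s p n)) \<longlonglongrightarrow> adele_padic_abs p (x + y)"
    using padic_abs_tendsto[OF adele_rep_add[OF r(2) s(2)] p] by (simp add: r s plus_abs_adele)
  moreover have "(\<lambda>n. max (padic_abs p (snd r p n)) (padic_abs p (snd s p n)))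
      \<longlonglongrightarrow> max (adele_padic_abs p x) (adele_padic_abs p y)"
    unfolding r s using r s p by (intro tendsto_max padic_abs_tendsto)
  ultimately show ?thesis
    by (rule LIMSEQ_le) (use padic_abs_add[OF p] in blast)
qed

lemma adele_padic_abs_mult:
  assumes p: "prime p"
  shows "adele_padic_abs p (x * y) = adele_padic_abs p x * adele_padic_abs p y"
proof -
  obtain r where r: "x = abs_adele r" "adele_rep r" by (rule adele_cases)
  obtain s where s: "y = abs_adele s" "adele_rep s" by (rule adele_cases)
  have "(\<lambda>n. padic_abs p (snd r p n) * padic_abs p (snd s p n)) \<longlonglongrightarrow> adele_padic_abs p (x * y)"
    using padic_abs_tendsto[OF adele_rep_mult[OF r(2) s(2)] p]
    by (simp add: r s times_abs_adele padic_abs_mult[OF p])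
  moreover have "(\<lambda>n. padic_abs p (snd r p n) * padic_abs p (snd s p n))
      \<longlonglongrightarrow> adele_padic_abs p x * adele_padic_abs p y"
    unfolding r s using r s p by (intro tendsto_mult padic_abs_tendsto)
  ultimately show ?thesis by (rule LIMSEQ_unique)
qed

lemma adele_padic_abs_of_rat [simp]:
  assumes p: "prime p"
  shows "adele_padic_abs p (adele_of_rat q) = padic_abs p q"
  using p by (simp add: adele_of_rat.abs_eq adele_padic_abs.abs_eq adele_relI adele_rep_const)

lemma arch_part_add [simp]: "arch_part (x + y) = arch_part x + arch_part y"
proof -
  obtain r where r: "x = abs_adele r" "adele_rep r" by (rule adele_cases)
  obtain s where s: "y = abs_adele s" "adele_rep s" by (rule adele_cases)
  show ?thesis
    using r(2) s(2) by (simp add: r(1) s(1) plus_abs_adele arch_part.abs_eq adele_relI adele_rep_add)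
qed

lemma arch_part_mult [simp]: "arch_part (x * y) = arch_part x * arch_part y"
proof -
  obtain r where r: "x = abs_adele r" "adele_rep r" by (rule adele_cases)
  obtain s where s: "y = abs_adele s" "adele_rep s" by (rule adele_cases)
  show ?thesis
    using r(2) s(2) by (simp add: r(1) s(1) times_abs_adele arch_part.abs_eq adele_relI adele_rep_mult)
qed

lemma arch_part_minus [simp]: "arch_part (- x) = - arch_part x"
proof -
  obtain r where r: "x = abs_adele r" "adele_rep r" by (rule adele_cases)
  show ?thesis
    using r(2) by (simp add: r(1) uminus_abs_adele arch_part.abs_eq adele_relI adele_rep_uminus)
qed

lemma arch_part_diff [simp]: "arch_part (x - y) = arch_part x - arch_part y"
  using arch_part_add[of x "- y"] by simp

lemma arch_part_of_rat [simp]: "arch_part (adele_of_rat q) = of_rat q"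
  by (simp add: adele_of_rat.abs_eq arch_part.abs_eq adele_relI adele_rep_const)

lemma adele_of_rat_0 [simp]: "adele_of_rat 0 = 0"
  by (simp add: adele_of_rat.abs_eq zero_adele.abs_eq)

lemma adele_of_rat_1 [simp]: "adele_of_rat 1 = 1"
  by (simp add: adele_of_rat.abs_eq one_adele.abs_eq)

lemma adele_of_rat_add: "adele_of_rat (a + b) = adele_of_rat a + adele_of_rat b"
  by (simp add: adele_of_rat.abs_eq plus_abs_adele adele_rep_const of_rat_add)

lemma adele_of_rat_mult: "adele_of_rat (a * b) = adele_of_rat a * adele_of_rat b"
  by (simp add: adele_of_rat.abs_eq times_abs_adele adele_rep_const of_rat_mult)

lemma adele_of_rat_minus: "adele_of_rat (- a) = - adele_of_rat a"
  by (simp add: adele_of_rat.abs_eq uminus_abs_adele adele_rep_const of_rat_minus)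

lemma adele_of_rat_sum: "adele_of_rat (sum f A) = (\<Sum>x\<in>A. adele_of_rat (f x))"
  by (induction A rule: infinite_finite_induct) (auto simp: adele_of_rat_add)

lemma arch_part_0 [simp]: "arch_part 0 = 0"
  using arch_part_of_rat[of 0] by simp

lemma arch_part_1 [simp]: "arch_part 1 = 1"
  using arch_part_of_rat[of 1] by simp

lemma adele_padic_abs_0 [simp]: "prime p \<Longrightarrow> adele_padic_abs p 0 = 0"
  using adele_padic_abs_of_rat[of p 0] by simp

lemma adele_padic_abs_1 [simp]: "prime p \<Longrightarrow> adele_padic_abs p 1 = 1"
  using adele_padic_abs_of_rat[of p 1] by simp

lemma adele_padic_abs_minus [simp]: "prime p \<Longrightarrow> adele_padic_abs p (- x) = adele_padic_abs p x"
  using adele_padic_abs_mult[of p "adele_of_rat (-1)" x] adele_padic_abs_of_rat[of p "-1"]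
  by (simp add: adele_of_rat_minus)

lemma adele_padic_abs_minus_commute:
  "prime p \<Longrightarrow> adele_padic_abs p (x - y) = adele_padic_abs p (y - x)"
  by (metis adele_padic_abs_minus minus_diff_eq)

lemma adele_padic_abs_diff:
  "prime p \<Longrightarrow> adele_padic_abs p (x - y) \<le> max (adele_padic_abs p x) (adele_padic_abs p y)"
  using adele_padic_abs_add[of p x "- y"] by simp

lemma adele_padic_abs_sum_le:
  assumes "prime p" "\<And>i. i \<in> A \<Longrightarrow> adele_padic_abs p (f i) \<le> B" "B \<ge> 0"
  shows "adele_padic_abs p (sum f A) \<le> B"
  using assms(2)
proof (induction A rule: infinite_finite_induct)
  case (insert i A)
  then show ?case using adele_padic_abs_add[OF assms(1), of "f i" "sum f A"]
    by (fastforce intro: order_trans)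
qed (use assms in auto)

lemma finite_adele_nonintegral: "finite {p. prime p \<and> adele_padic_abs p x > 1}"
proof -
  obtain r where r: "x = abs_adele r" "adele_rep r" by (rule adele_cases)
  have "{p. prime p \<and> adele_padic_abs p x > 1} \<subseteq> {p. prime p \<and> \<not> padic_integral p (snd r p)}"
  proof clarify
    fix p assume p: "prime p" and gt: "adele_padic_abs p x > 1" and i: "padic_integral p (snd r p)"
    have "adele_padic_abs p x \<le> 1" unfolding r(1)
      by (rule tendsto_upperbound[OF padic_abs_tendsto[OF r(2) p]]) (use i in \<open>auto simp: padic_integral_def\<close>)
    then show False using gt by simp
  qed
  then show ?thesis using r(2) finite_subset unfolding adele_rep_def by blast
qed

text \<open>A late term of the Cauchy sequence representing the component at \<open>p\<close> is
  itself the approximation. The tail is kept below \<open>e/2\<close> because the limit only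
  preserves \<open>\<le>\<close>.\<close>

lemma adele_approx_rat:
  assumes p: "prime p" and e: "e > 0"
  obtains q where "adele_padic_abs p (x - adele_of_rat q) < e"
proof -
  obtain r where r: "x = abs_adele r" "adele_rep r" by (rule adele_cases)
  have "padic_Cauchy p (snd r p)" using r p by (simp add: adele_rep_def)
  then obtain N where N: "\<forall>m\<ge>N. \<forall>n\<ge>N. padic_abs p (snd r p m - snd r p n) < e/2"
    using e padic_CauchyD[of p "snd r p" "e/2"] by auto
  define q where "q = snd r p N"
  have "x - adele_of_rat q = abs_adele (fst r - of_rat q, \<lambda>p n. snd r p n - q)"
    unfolding diff_conv_add_uminus r(1) adele_of_rat.abs_eq
    by (simp add: uminus_abs_adele plus_abs_adele r(2) adele_rep_const adele_rep_uminus[OF adele_rep_const, simplified])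
  moreover have "adele_rep (fst r - of_rat q, \<lambda>p n. snd r p n - q)"
    using adele_rep_add[OF r(2) adele_rep_const[of "- of_rat q" "- q"]] by simp
  ultimately have "(\<lambda>n. padic_abs p (snd r p n - q)) \<longlonglongrightarrow> adele_padic_abs p (x - adele_of_rat q)"
    using padic_abs_tendsto[OF _ p] by (metis snd_conv)
  then have "adele_padic_abs p (x - adele_of_rat q) \<le> e/2"
    by (rule tendsto_upperbound)
      (use N in \<open>auto simp: q_def eventually_sequentially intro!: exI[of _ N] less_imp_le\<close>)
  then show ?thesis using that[of q] e by linarith
qed

section \<open>The topology of the adeles\<close>

definition adele_nbhd :: "adele \<Rightarrow> real \<Rightarrow> nat set \<Rightarrow> adele set" where
  "adele_nbhd x e S = {y. \<bar>arch_part (y - x)\<bar> < e \<and>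
     (\<forall>p\<in>S. prime p \<longrightarrow> adele_padic_abs p (y - x) < e) \<and>
     (\<forall>p. prime p \<longrightarrow> adele_padic_abs p (y - x) \<le> 1)}"

lemma open_adele_iff:
  "open U \<longleftrightarrow> (\<forall>x\<in>U. \<exists>e>0. \<exists>S. finite S \<and> adele_nbhd x e S \<subseteq> U)"
  unfolding open_adele_def adele_nbhd_def subset_eq Ball_def mem_Collect_eq ..

lemma adele_nbhd_self: "e > 0 \<Longrightarrow> x \<in> adele_nbhd x e S"
  by (simp add: adele_nbhd_def)

lemma adele_nbhd_sym: "y \<in> adele_nbhd x e S \<Longrightarrow> x \<in> adele_nbhd y e S"
  unfolding adele_nbhd_def mem_Collect_eq
  by (simp add: adele_padic_abs_minus_commute[of _ x y] abs_minus_commute)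

lemma adele_nbhd_mono: "e \<le> e' \<Longrightarrow> S' \<subseteq> S \<Longrightarrow> adele_nbhd x e S \<subseteq> adele_nbhd x e' S'"
  unfolding adele_nbhd_def by (intro subsetI CollectI) (simp add: subset_eq, meson less_le_trans)

lemma adele_nbhd_add:
  assumes "y \<in> adele_nbhd x d S" "z \<in> adele_nbhd y d' S" "d + d' \<le> e" "d > 0" "d' > 0"
  shows "z \<in> adele_nbhd x e S"
proof -
  have zx: "z - x = (z - y) + (y - x)" by simp
  have max: "adele_padic_abs p (z - x) \<le> max (adele_padic_abs p (z - y)) (adele_padic_abs p (y - x))"
    if "prime p" for p unfolding zx by (rule adele_padic_abs_add[OF that])
  have "adele_padic_abs p (z - x) < e" if "p \<in> S" "prime p" for p
  proof -
    have "adele_padic_abs p (z - y) < d'" "adele_padic_abs p (y - x) < d"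
      using assms that by (auto simp: adele_nbhd_def)
    then show ?thesis using max[OF that(2)] assms by linarith
  qed
  moreover have "adele_padic_abs p (z - x) \<le> 1" if "prime p" for p
  proof -
    have "adele_padic_abs p (z - y) \<le> 1" "adele_padic_abs p (y - x) \<le> 1"
      using assms that by (auto simp: adele_nbhd_def)
    then show ?thesis using max[OF that] by linarith
  qed
  moreover have "\<bar>arch_part (z - x)\<bar> < e" using assms unfolding adele_nbhd_def zx arch_part_add by auto
  ultimately show ?thesis by (simp add: adele_nbhd_def)
qed

lemma open_adele_nbhd:
  assumes "finite S" shows "open (adele_nbhd x e S)"
  unfolding open_adele_iff
proof
  fix y assume y: "y \<in> adele_nbhd x e S"
  \<comment> \<open>Only the real place uses up radius. At the primes the ultrametric inequality
    keeps the sum below \<open>e\<close>, as \<open>d \<le> e\<close>, and sums of integral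
    differences stay integral.\<close>
  define d where "d = e - \<bar>arch_part (y - x)\<bar>"
  have d: "d > 0" "d \<le> e" using y by (auto simp: d_def adele_nbhd_def)
  have "z \<in> adele_nbhd x e S" if z: "z \<in> adele_nbhd y d S" for z
  proof -
    have zx: "z - x = (z - y) + (y - x)" by simp
    have max: "adele_padic_abs p (z - x) \<le> max (adele_padic_abs p (z - y)) (adele_padic_abs p (y - x))"
      if "prime p" for p unfolding zx by (rule adele_padic_abs_add[OF that])
    have "adele_padic_abs p (z - x) < e" if "p \<in> S" "prime p" for p
    proof -
      have "adele_padic_abs p (z - y) < d" "adele_padic_abs p (y - x) < e"
        using y z that by (auto simp: adele_nbhd_def)
      then show ?thesis using max[OF that(2)] d by linarith
    qed
    moreover have "adele_padic_abs p (z - x) \<le> 1" if "prime p" for p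
    proof -
      have "adele_padic_abs p (z - y) \<le> 1" "adele_padic_abs p (y - x) \<le> 1"
        using y z that by (auto simp: adele_nbhd_def)
      then show ?thesis using max[OF that] by linarith
    qed
    moreover have "\<bar>arch_part (z - x)\<bar> < e"
      using z unfolding adele_nbhd_def zx arch_part_add by (auto simp: d_def)
    ultimately show ?thesis by (simp add: adele_nbhd_def)
  qed
  then show "\<exists>e'>0. \<exists>S'. finite S' \<and> adele_nbhd y e' S' \<subseteq> adele_nbhd x e S"
    using d assms by blast
qed

lemma eventually_nhds_adele:
  "eventually P (nhds x) \<longleftrightarrow> (\<exists>e>0. \<exists>S. finite S \<and> (\<forall>y\<in>adele_nbhd x e S. P y))"
proof
  assume "eventually P (nhds x)"
  then obtain U where "open U" "x \<in> U" "\<forall>y\<in>U. P y" by (auto simp: eventually_nhds)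
  then show "\<exists>e>0. \<exists>S. finite S \<and> (\<forall>y\<in>adele_nbhd x e S. P y)"
    unfolding open_adele_iff by (meson subsetD)
next
  assume "\<exists>e>0. \<exists>S. finite S \<and> (\<forall>y\<in>adele_nbhd x e S. P y)"
  then show "eventually P (nhds x)"
    using open_adele_nbhd adele_nbhd_self unfolding eventually_nhds by meson
qed

lemma filterlim_nhds_adele:
  "filterlim f (nhds x) F \<longleftrightarrow>
     (\<forall>e>0. \<forall>S. finite S \<longrightarrow> eventually (\<lambda>t. f t \<in> adele_nbhd x e S) F)"
proof
  assume F: "filterlim f (nhds x) F"
  show "\<forall>e>0. \<forall>S. finite S \<longrightarrow> eventually (\<lambda>t. f t \<in> adele_nbhd x e S) F"
  proof (intro allI impI)
    fix e :: real and S :: "nat set" assume "e > 0" "finite S"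
    then have "eventually (\<lambda>y. y \<in> adele_nbhd x e S) (nhds x)"
      unfolding eventually_nhds_adele by blast
    then show "eventually (\<lambda>t. f t \<in> adele_nbhd x e S) F"
      by (rule F[unfolded filterlim_iff, rule_format])
  qed
next
  assume *: "\<forall>e>0. \<forall>S. finite S \<longrightarrow> eventually (\<lambda>t. f t \<in> adele_nbhd x e S) F"
  show "filterlim f (nhds x) F" unfolding filterlim_iff
  proof (intro allI impI)
    fix P assume "eventually P (nhds x)"
    then obtain e S where eS: "e > 0" "finite S" "\<forall>y\<in>adele_nbhd x e S. P y"
      unfolding eventually_nhds_adele by blast
    have "eventually (\<lambda>t. f t \<in> adele_nbhd x e S) F" using * eS(1,2) by simp
    then show "eventually (\<lambda>t. P (f t)) F" by (rule eventually_mono) (use eS(3) in simp)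
  qed
qed

instance adele :: topological_ab_group_add
proof
  fix a b :: adele
  show "LIM x nhds a \<times>\<^sub>F nhds b. fst x + snd x :> nhds (a + b)"
    unfolding filterlim_nhds_adele
  proof (intro allI impI)
    fix e :: real and S :: "nat set" assume e: "e > 0" "finite S"
    have e2: "e / 2 > 0" using e by simp
    have "x + y \<in> adele_nbhd (a + b) e S"
      if "x \<in> adele_nbhd a (e/2) S" "y \<in> adele_nbhd b (e/2) S" for x y
    proof (rule adele_nbhd_add[of "x + b" _ "e/2" S _ "e/2"])
      show "x + b \<in> adele_nbhd (a + b) (e/2) S" using that(1) by (simp add: adele_nbhd_def)
      show "x + y \<in> adele_nbhd (x + b) (e/2) S" using that(2) by (simp add: adele_nbhd_def)
    qed (use e in auto)
    moreover have "eventually (\<lambda>y. y \<in> adele_nbhd c (e/2) S) (nhds c)" for c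
      using e e2 unfolding eventually_nhds_adele by blast
    ultimately show "\<forall>\<^sub>F t in nhds a \<times>\<^sub>F nhds b. fst t + snd t \<in> adele_nbhd (a + b) e S"
      unfolding eventually_prod_filter
      by - (rule exI[of _ "\<lambda>y. y \<in> adele_nbhd a (e/2) S"], rule exI[of _ "\<lambda>y. y \<in> adele_nbhd b (e/2) S"], simp)
  qed
  show "(uminus \<longlongrightarrow> - a) (nhds a)"
    unfolding filterlim_nhds_adele eventually_nhds_adele
  proof (intro allI impI)
    fix e :: real and S :: "nat set" assume e: "e > 0" "finite S"
    have eq: "- y - - a = a - y" for y by (simp only: minus_diff_minus minus_diff_eq)
    have "- y \<in> adele_nbhd (- a) e S" if "y \<in> adele_nbhd a e S" for y
      using adele_nbhd_sym[OF that] unfolding adele_nbhd_def mem_Collect_eq eq .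
    then show "\<exists>e'>0. \<exists>S'. finite S' \<and> (\<forall>y\<in>adele_nbhd a e' S'. - y \<in> adele_nbhd (- a) e S)"
      using e by blast
  qed
qed

text \<open>Continuity with one factor fixed is enough for the integrands, in which a variable
  unipotent matrix multiplies a fixed \<open>g\<close>.\<close>

lemma tendsto_adele_mult_const: "((\<lambda>x. x * c) \<longlongrightarrow> a * c) (nhds (a::adele))"
  unfolding filterlim_nhds_adele eventually_nhds_adele
proof (intro allI impI)
  fix e :: real and S :: "nat set" assume e: "e > 0" "finite S"
  \<comment> \<open>Where \<open>c\<close> is not integral, multiplication by it can destroy
    integrality, so these finitely many primes also get a small radius. The minimum with 1 in
    \<open>d\<close> restores the bound 1 there.\<close>
  define S' where "S' = S \<union> {p. prime p \<and> adele_padic_abs p c > 1}"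
  define K where "K = 1 + \<bar>arch_part c\<bar> + (\<Sum>p\<in>S'. adele_padic_abs p c)"
  define d where "d = min e 1 / K"
  have fin: "finite S'" using e finite_adele_nonintegral by (simp add: S'_def)
  have K: "K \<ge> 1" unfolding K_def by (simp add: sum_nonneg)
  have Kc: "\<bar>arch_part c\<bar> < K" using sum_nonneg[of S' "\<lambda>p. adele_padic_abs p c"] by (simp add: K_def)
  have Kp: "adele_padic_abs p c \<le> K" if "p \<in> S'" for p
  proof -
    have "adele_padic_abs p c \<le> (\<Sum>p\<in>S'. adele_padic_abs p c)"
      using that fin by (intro member_le_sum) auto
    then show ?thesis by (simp add: K_def)
  qed
  have d: "d > 0" "d * K = min e 1" using e K by (auto simp: d_def)
  have "y * c \<in> adele_nbhd (a * c) e S" if y: "y \<in> adele_nbhd a d S'" for y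
  proof -
    have eq: "y * c - a * c = (y - a) * c" by (simp add: algebra_simps)
    have small: "adele_padic_abs p (y * c - a * c) < min e 1" if p: "p \<in> S'" "prime p" for p
    proof -
      have lt: "adele_padic_abs p (y - a) < d" using y p by (simp add: adele_nbhd_def)
      have "adele_padic_abs p (y * c - a * c) = adele_padic_abs p (y - a) * adele_padic_abs p c"
        unfolding eq by (rule adele_padic_abs_mult[OF p(2)])
      also have "\<dots> \<le> adele_padic_abs p (y - a) * K"
        using Kp[OF p(1)] by (intro mult_left_mono) auto
      also have "\<dots> < d * K" using lt K by (intro mult_strict_right_mono) auto
      finally show ?thesis using d by simp
    qed
    have "adele_padic_abs p (y * c - a * c) \<le> 1" if p: "prime p" for p
    proof (cases "p \<in> S'")
      case True then show ?thesis using small[OF True p] by simp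
    next
      case False
      then have "adele_padic_abs p c \<le> 1" using p by (auto simp: S'_def)
      moreover have "adele_padic_abs p (y - a) \<le> 1" using y p by (simp add: adele_nbhd_def)
      ultimately show ?thesis unfolding eq adele_padic_abs_mult[OF p]
        by (simp add: mult_le_one)
    qed
    moreover have "\<bar>arch_part (y * c - a * c)\<bar> < e"
    proof -
      have "\<bar>arch_part (y * c - a * c)\<bar> = \<bar>arch_part (y - a)\<bar> * \<bar>arch_part c\<bar>"
        unfolding eq arch_part_mult abs_mult ..
      also have "\<dots> \<le> \<bar>arch_part (y - a)\<bar> * K" using Kc by (intro mult_left_mono) auto
      also have "\<dots> < d * K" using y K by (intro mult_strict_right_mono) (auto simp: adele_nbhd_def)
      finally show ?thesis using d by simp
    qed
    moreover have "adele_padic_abs p (y * c - a * c) < e" if "p \<in> S" "prime p" for p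
      using small[of p] that by (simp add: S'_def)
    ultimately show ?thesis by (simp add: adele_nbhd_def)
  qed
  then show "\<exists>e'>0. \<exists>S'. finite S' \<and> (\<forall>y\<in>adele_nbhd a e' S'. y * c \<in> adele_nbhd (a * c) e S)"
    using d fin by blast
qed

lemma continuous_on_adele_mult_const [continuous_intros]:
  fixes f :: "'a::topological_space \<Rightarrow> adele"
  assumes "continuous_on A f" shows "continuous_on A (\<lambda>x. f x * c)"
proof -
  have "continuous_on UNIV (\<lambda>x. x * c)"
    unfolding continuous_on_def by (intro ballI tendsto_mono[OF at_within_le_nhds] tendsto_adele_mult_const)
  then show ?thesis by (rule continuous_on_compose2[OF _ assms]) auto
qed

lemma continuous_on_arch_part: "continuous_on A arch_part"
proof -
  have "(arch_part \<longlongrightarrow> arch_part a) (nhds a)" for a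
    unfolding tendsto_iff eventually_nhds_adele
  proof (intro allI impI)
    fix e :: real assume "e > 0"
    moreover have "dist (arch_part x) (arch_part a) < e" if "x \<in> adele_nbhd a e {}" for x
      using that unfolding adele_nbhd_def mem_Collect_eq dist_real_def arch_part_diff by (elim conjE)
    ultimately show "\<exists>e'>0. \<exists>S. finite S \<and> (\<forall>x\<in>adele_nbhd a e' S. dist (arch_part x) (arch_part a) < e)"
      by (meson finite.emptyI)
  qed
  then show ?thesis
    unfolding continuous_on_def by (intro ballI tendsto_mono[OF at_within_le_nhds])
qed

text \<open>A countable dense set: adeles with a rational real part, rational components at finitely
  many primes and zero elsewhere. The finitely many components are given as a list so that the index
  type is countable.\<close>

definition adele_step :: "rat \<times> (nat \<times> rat) list \<Rightarrow> adele" where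
  "adele_step s = abs_adele (of_rat (fst s), \<lambda>p _. case map_of (snd s) p of None \<Rightarrow> 0 | Some q \<Rightarrow> q)"

lemma adele_rep_step:
  "adele_rep (r, \<lambda>p _. case map_of xs p of None \<Rightarrow> 0 | Some q \<Rightarrow> q)"
proof -
  have "{p. prime p \<and> \<not> padic_integral p (\<lambda>_. case map_of xs p of None \<Rightarrow> 0 | Some q \<Rightarrow> q)} \<subseteq> fst ` set xs"
  proof
    fix p assume "p \<in> {p. prime p \<and> \<not> padic_integral p (\<lambda>_. case map_of xs p of None \<Rightarrow> 0 | Some q \<Rightarrow> q)}"
    then have "map_of xs p \<noteq> None" by (auto simp: padic_integral_def split: option.splits)
    then show "p \<in> fst ` set xs" by (simp add: map_of_eq_None_iff)
  qed
  then show ?thesis using finite_subset by (auto simp: adele_rep_def)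
qed

lemma adele_padic_abs_step:
  assumes p: "prime p"
  shows "adele_padic_abs p (x - adele_step s) =
    adele_padic_abs p (x - adele_of_rat (case map_of (snd s) p of None \<Rightarrow> 0 | Some q \<Rightarrow> q))"
proof -
  obtain r where r: "x = abs_adele r" "adele_rep r" by (rule adele_cases)
  let ?q = "case map_of (snd s) p of None \<Rightarrow> 0 | Some q \<Rightarrow> q"
  have diff: "abs_adele u - abs_adele v = abs_adele (fst u - fst v, \<lambda>p n. snd u p n - snd v p n)"
    "adele_rep (fst u - fst v, \<lambda>p n. snd u p n - snd v p n)"
    if "adele_rep u" "adele_rep v" for u v
    using that adele_rep_add[OF that(1) adele_rep_uminus[OF that(2)]]
    by (simp_all only: diff_conv_add_uminus uminus_abs_adele plus_abs_adele adele_rep_uminus fst_conv snd_conv)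
  have "(\<lambda>n. padic_abs p (snd r p n - ?q)) \<longlonglongrightarrow> adele_padic_abs p (x - adele_step s)"
    using padic_abs_tendsto[OF diff(2)[OF r(2) adele_rep_step] p]
    unfolding r(1) adele_step_def diff(1)[OF r(2) adele_rep_step] snd_conv .
  moreover have "(\<lambda>n. padic_abs p (snd r p n - ?q)) \<longlonglongrightarrow> adele_padic_abs p (x - adele_of_rat ?q)"
    using padic_abs_tendsto[OF diff(2)[OF r(2) adele_rep_const] p]
    unfolding r(1) adele_of_rat.abs_eq diff(1)[OF r(2) adele_rep_const] snd_conv .
  ultimately show ?thesis by (rule LIMSEQ_unique)
qed

lemma adele_step_dense:
  assumes e: "e > 0" "finite S"
  obtains s where "adele_step s \<in> adele_nbhd x e S"
proof -
  \<comment> \<open>Outside \<open>P\<close> the approximant has component zero, which is admissible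
    because \<open>x\<close> is integral there.\<close>
  define P where "P = S \<union> {p. prime p \<and> adele_padic_abs p x > 1}"
  have P: "finite P" using e finite_adele_nonintegral by (simp add: P_def)
  have "\<exists>q. prime p \<longrightarrow> adele_padic_abs p (x - adele_of_rat q) < min e 1" for p
    using adele_approx_rat[of p "min e 1" x] e by (metis min_less_iff_conj zero_less_one)
  then obtain q where q: "\<And>p. prime p \<Longrightarrow> adele_padic_abs p (x - adele_of_rat (q p)) < min e 1"
    by metis
  obtain r where r: "arch_part x < of_rat r" "of_rat r < arch_part x + e"
    using of_rat_dense[of "arch_part x" "arch_part x + e"] e by auto
  define s where "s = (r, map (\<lambda>p. (p, q p)) (sorted_list_of_set P))"
  have m: "map_of (snd s) p = (if p \<in> P then Some (q p) else None)" for p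
    using P by (simp add: s_def map_of_map_restrict restrict_map_def)
  have val: "adele_padic_abs p (x - adele_step s) = adele_padic_abs p (if p \<in> P then x - adele_of_rat (q p) else x)"
    if "prime p" for p using that by (simp add: adele_padic_abs_step m)
  have "x \<in> adele_nbhd (adele_step s) e S"
    unfolding adele_nbhd_def mem_Collect_eq
  proof (intro conjI ballI allI impI)
    have "arch_part (adele_step s) = of_rat r"
      using adele_rep_step by (simp add: adele_step_def s_def arch_part.abs_eq adele_relI)
    then show "\<bar>arch_part (x - adele_step s)\<bar> < e" using r by simp
  next
    fix p assume p: "p \<in> S" "prime p"
    then have "p \<in> P" by (simp add: P_def)
    then show "adele_padic_abs p (x - adele_step s) < e" using q[OF p(2)] val[OF p(2)] by simp
  next
    fix p :: nat assume p: "prime p"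
    show "adele_padic_abs p (x - adele_step s) \<le> 1"
    proof (cases "p \<in> P")
      case True then show ?thesis using q[OF p] val[OF p] by simp
    next
      case False
      then have "adele_padic_abs p x \<le> 1" using p unfolding P_def by simp
      then show ?thesis using False val[OF p] by simp
    qed
  qed
  then show ?thesis using that adele_nbhd_sym by blast
qed

text \<open>Second countability makes the Borel sets of a finite power of the adeles the product
  \<open>\<sigma>\<close>-algebra, which gives the measurability of the integrands.\<close>

instance adele :: second_countable_topology
proof
  \<comment> \<open>The single number \<open>k\<close> controls both the radius and the finite set
    of primes, which keeps the family countable while every basic neighbourhood is still
    refined.\<close>
  define B where "B = (\<lambda>(s, k). adele_nbhd (adele_step s) (1 / real (Suc k)) {..k}) ` (UNIV :: ((rat \<times> (nat \<times> rat) list) \<times> nat) set)"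
  have "countable B" unfolding B_def by (rule countable_image) simp
  moreover have "topological_basis B"
  proof (rule topological_basisI)
    fix U assume "U \<in> B" then show "open U" by (auto simp: B_def open_adele_nbhd)
  next
    fix U and x :: adele assume U: "open U" "x \<in> U"
    then obtain e S where e: "e > 0" "finite S" and sub: "adele_nbhd x e S \<subseteq> U"
      unfolding open_adele_iff by metis
    obtain k1 where k1: "1 / real (Suc k1) < e / 2"
      using reals_Archimedean[of "e/2"] e by (auto simp: inverse_eq_divide)
    obtain k2 where k2: "S \<subseteq> {..k2}" using e(2) finite_nat_iff_bounded_le by blast
    define k where "k = max k1 k2"
    have "1 / real (Suc k) \<le> 1 / real (Suc k1)" by (simp add: k_def frac_le)
    then have k: "1 / real (Suc k) < e / 2" "S \<subseteq> {..k}" using k1 k2 by (auto simp: k_def)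
    have pos: "1 / real (Suc k) > 0" by simp
    obtain s where s: "adele_step s \<in> adele_nbhd x (1 / real (Suc k)) {..k}"
      using adele_step_dense[OF pos finite_atMost] by blast
    let ?N = "adele_nbhd (adele_step s) (1 / real (Suc k)) {..k}"
    have "?N \<subseteq> U"
    proof
      fix y assume y: "y \<in> ?N"
      have "y \<in> adele_nbhd x e {..k}"
        by (rule adele_nbhd_add[OF s y]) (use k pos in linarith)+
      then show "y \<in> U" using sub adele_nbhd_mono[OF order_refl k(2)] by blast
    qed
    moreover have "?N \<in> B" unfolding B_def by (rule image_eqI[of _ _ "(s, k)"]) auto
    ultimately show "\<exists>B'\<in>B. x \<in> B' \<and> B' \<subseteq> U" using adele_nbhd_sym[OF s] by blast
  qed
  ultimately show "\<exists>B::adele set set. countable B \<and> open = generate_topology B"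
    using topological_basis_imp_subbasis by blast
qed

section \<open>The fundamental domain\<close>

lemma padic_abs_of_int_le_1: "prime p \<Longrightarrow> padic_abs p (of_int a) \<le> 1"
  by (rule padic_abs_le_1) auto

lemma padic_abs_of_int_eq_1:
  assumes "prime p" "\<not> int p dvd a"
  shows "padic_abs p (of_int a) = 1"
proof -
  have "a \<noteq> 0" using assms by auto
  then show ?thesis using padic_abs_quot[OF assms(1), of a 1] assms
    by (simp add: not_dvd_imp_multiplicity_0)
qed

lemma padic_abs_inverse:
  assumes "prime p" shows "padic_abs p (inverse x) = inverse (padic_abs p x)"
proof (cases "x = 0")
  case False
  then have "padic_abs p x * padic_abs p (inverse x) = 1"
    using padic_abs_mult[OF assms, of x "inverse x"] by simp
  then show ?thesis by (metis inverse_unique)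
qed simp

text \<open>Partial fractions: write q = c / (p^k d') with d' prime to p. A Bezout relation u d' + v
  p^k = 1 splits q into c u / p^k, the required \<open>r\<close>, and c v / d', which is integral at
  p.\<close>

lemma padic_principal_part:
  assumes p: "prime p"
  obtains r where "padic_abs p (q - r) \<le> 1" "\<And>l. prime l \<Longrightarrow> l \<noteq> p \<Longrightarrow> padic_abs l r \<le> 1"
proof -
  obtain c d where cd: "q = of_int c / of_int d" "d \<noteq> 0" by (rule rat_quotE)
  have unit: "\<not> is_unit (int p)" using p by auto
  obtain d' where d': "d = int p ^ multiplicity (int p) d * d'" "\<not> int p dvd d'"
    using multiplicity_decompose'[OF cd(2) unit] by metis
  define k where "k = multiplicity (int p) d"
  have "coprime (int p ^ k) d'" using p d'(2) by (simp add: prime_imp_coprime)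
  then obtain u v where uv: "u * d' + v * int p ^ k = 1"
    by (metis bezout_int coprime_commute coprime_imp_gcd_eq_1)
  have p0: "of_nat p ^ k \<noteq> (0::rat)" using p by auto
  have d0: "(of_int d' :: rat) \<noteq> 0" using d'(2) by auto
  have uv': "of_int u * of_int d' + of_int v * of_nat p ^ k = (1::rat)"
    using arg_cong[OF uv, of "of_int :: int \<Rightarrow> rat"] by simp
  have d_rat: "(of_int d :: rat) = of_nat p ^ k * of_int d'"
    using arg_cong[OF d'(1), of "of_int :: int \<Rightarrow> rat"] by (simp add: k_def)
  define r :: rat where "r = of_int (c * u) * inverse (of_int (int p ^ k))"
  have "q = of_int c * (of_int u * of_int d' + of_int v * of_nat p ^ k) / (of_nat p ^ k * of_int d')"
    unfolding uv' by (simp add: cd(1) d_rat)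
  then have qr: "q - r = of_int (c * v) * inverse (of_int d')"
    using p0 d0 p by (simp add: r_def field_simps prime_gt_0_nat)
  have "padic_abs p (q - r) \<le> 1"
    unfolding qr padic_abs_mult[OF p] padic_abs_inverse[OF p]
    using padic_abs_of_int_le_1[OF p, of "c * v"] padic_abs_of_int_eq_1[OF p d'(2)] by simp
  moreover have "padic_abs l r \<le> 1" if l: "prime l" "l \<noteq> p" for l
  proof -
    have "\<not> l dvd p" using l p primes_dvd_imp_eq by blast
    then have "\<not> int l dvd int p ^ k" using l prime_dvd_power_int_iff
      by (metis of_nat_dvd_iff prime_dvd_power prime_int_nat_transfer nat_int of_nat_power)
    then show ?thesis
      unfolding r_def padic_abs_mult[OF l(1)] padic_abs_inverse[OF l(1)]
      using padic_abs_of_int_le_1[OF l(1), of "c * u"] padic_abs_of_int_eq_1[OF l(1), of "int p ^ k"]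
      by (simp del: of_int_mult of_int_power)
  qed
  ultimately show ?thesis using that by blast
qed

text \<open>Strong approximation for the additive group. Subtracting the principal parts at the
  finitely many bad primes makes the adele integral at every prime; subtracting the integer part at
  the real place then leaves integrality intact.\<close>

lemma adele_decompose:
  obtains q where "x - adele_of_rat q \<in> adele_fund_domain"
proof -
  define P where "P = {p. prime p \<and> adele_padic_abs p x > 1}"
  have P: "finite P" unfolding P_def by (rule finite_adele_nonintegral)
  have "\<exists>r. adele_padic_abs p (x - adele_of_rat r) \<le> 1 \<and> (\<forall>l. prime l \<and> l \<noteq> p \<longrightarrow> padic_abs l r \<le> 1)"
    if p: "prime p" for p
  proof -
    obtain q where q: "adele_padic_abs p (x - adele_of_rat q) < 1"
      using adele_approx_rat[OF p zero_less_one] by blast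
    obtain r where r: "padic_abs p (q - r) \<le> 1" "\<And>l. prime l \<Longrightarrow> l \<noteq> p \<Longrightarrow> padic_abs l r \<le> 1"
      using padic_principal_part[OF p] by blast
    have eq: "x - adele_of_rat r = (x - adele_of_rat q) + adele_of_rat (q - r)"
      using adele_of_rat_add[of r "q - r"] by (simp add: algebra_simps)
    have "adele_padic_abs p (x - adele_of_rat r) \<le> 1"
      unfolding eq using adele_padic_abs_add[OF p, of "x - adele_of_rat q" "adele_of_rat (q - r)"] q r(1) p
      by simp
    then show ?thesis using r(2) by blast
  qed
  then obtain r where r: "\<And>p. prime p \<Longrightarrow> adele_padic_abs p (x - adele_of_rat (r p)) \<le> 1"
      "\<And>p l. prime p \<Longrightarrow> prime l \<Longrightarrow> l \<noteq> p \<Longrightarrow> padic_abs l (r p) \<le> 1"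
    by metis
  define y where "y = x - (\<Sum>p\<in>P. adele_of_rat (r p))"
  have y: "adele_padic_abs l y \<le> 1" if l: "prime l" for l
  proof -
    have *: "adele_padic_abs l (\<Sum>p\<in>P - {l}. adele_of_rat (r p)) \<le> 1"
      by (rule adele_padic_abs_sum_le[OF l]) (use r(2) l in \<open>auto simp: P_def\<close>)
    \<comment> \<open>At \<open>l\<close> only the summand \<open>r l\<close> can fail to be
      integral, and it is grouped with \<open>x\<close>, whose principal part it cancels.\<close>
    obtain z where z: "y = z - (\<Sum>p\<in>P - {l}. adele_of_rat (r p))" "adele_padic_abs l z \<le> 1"
    proof (cases "l \<in> P")
      case True
      then show ?thesis using that[of "x - adele_of_rat (r l)"] r(1)[OF l] P
        by (simp add: y_def sum.remove algebra_simps)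
    next
      case False
      then show ?thesis using that[of x] l by (simp add: y_def P_def)
    qed
    then show ?thesis using adele_padic_abs_diff[OF l, of z "\<Sum>p\<in>P - {l}. adele_of_rat (r p)"] * by simp
  qed
  define n where "n = \<lfloor>arch_part y\<rfloor>"
  have "y - adele_of_rat (of_int n) \<in> adele_fund_domain"
    unfolding adele_fund_domain_def mem_Collect_eq
  proof (intro conjI allI impI)
    show "0 \<le> arch_part (y - adele_of_rat (of_int n))" "arch_part (y - adele_of_rat (of_int n)) < 1"
      unfolding arch_part_diff arch_part_of_rat of_rat_of_int_eq n_def by linarith+
    fix p :: nat assume p: "prime p"
    show "adele_padic_abs p (y - adele_of_rat (of_int n)) \<le> 1"
      using adele_padic_abs_diff[OF p, of y "adele_of_rat (of_int n)"] y[OF p] padic_abs_of_int_le_1[OF p, of n] p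
      by simp
  qed
  then show ?thesis
    using that[of "(\<Sum>p\<in>P. r p) + of_int n"] by (simp add: y_def adele_of_rat_add adele_of_rat_sum diff_diff_add)
qed

lemma rat_everywhere_integral:
  assumes "\<And>p. prime p \<Longrightarrow> padic_abs p q \<le> 1"
  shows "q \<in> \<int>"
proof -
  obtain c d where cd: "quotient_of q = (c, d)" by force
  have d: "d > 0" using cd quotient_of_denom_pos by blast
  have "d = 1"
  proof (rule ccontr)
    assume "d \<noteq> 1"
    then have "nat d \<noteq> 1" using d by linarith
    then obtain p where p: "prime p" "p dvd nat d"
      using prime_factor_nat by blast
    then have pd: "int p dvd d" using d by (simp add: int_dvd_int_iff[symmetric])
    have pc: "\<not> int p dvd c" using quotient_of_coprime[OF cd] pd p(1)
      by (metis coprime_common_divisor not_prime_unit prime_nat_int_transfer)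
    have "multiplicity (int p) d > 0" using pd d p(1)
      by (simp add: prime_multiplicity_gt_zero_iff)
    moreover have "multiplicity (int p) c = 0" using pc by (rule not_dvd_imp_multiplicity_0)
    moreover have "q \<noteq> 0" using pd cd p by auto
    ultimately have "padic_abs p q = real p ^ multiplicity (int p) d"
      using cd by (simp add: padic_abs_def power_int_def)
    moreover have "real p ^ multiplicity (int p) d > 1"
      using p \<open>multiplicity (int p) d > 0\<close> prime_gt_1_nat by (intro one_less_power) force+
    ultimately show False using assms[OF p(1)] by simp
  qed
  then show ?thesis using quotient_of_div[OF cd] by simp
qed

text \<open>The two representatives differ by a rational number that is integral at every prime,
  hence by an integer, and the half-open unit interval at the real place leaves only zero.\<close>

lemma adele_fund_domain_unique:
  assumes "x - adele_of_rat q \<in> adele_fund_domain" "x - adele_of_rat r \<in> adele_fund_domain"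
  shows "q = r"
proof -
  have "padic_abs p (q - r) \<le> 1" if p: "prime p" for p
  proof -
    have "adele_of_rat (q - r) = (x - adele_of_rat r) - (x - adele_of_rat q)"
      using adele_of_rat_add[of "q - r" r] by (simp add: algebra_simps)
    then have "adele_padic_abs p (adele_of_rat (q - r)) \<le>
        max (adele_padic_abs p (x - adele_of_rat r)) (adele_padic_abs p (x - adele_of_rat q))"
      using adele_padic_abs_diff[OF p] by metis
    moreover have "adele_padic_abs p (x - adele_of_rat r) \<le> 1" "adele_padic_abs p (x - adele_of_rat q) \<le> 1"
      using assms p by (auto simp: adele_fund_domain_def)
    ultimately show ?thesis using p by simp
  qed
  then have "q - r \<in> \<int>" by (rule rat_everywhere_integral)
  then obtain n where n: "q - r = of_int n" by (rule Ints_cases)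
  have "(of_rat (q - r) :: real) = of_int n" unfolding n by simp
  then have "of_rat q - of_rat r = (of_int n :: real)" by (simp add: of_rat_diff)
  then have "\<bar>of_int n :: real\<bar> < 1" using assms by (simp add: adele_fund_domain_def)
  then have "n = 0" by linarith
  then show ?thesis using n by simp
qed

lemma adele_fund_domain_borel [measurable]: "adele_fund_domain \<in> sets borel"
proof -
  \<comment> \<open>Every basic neighbourhood already demands integral differences at all primes, so
    by the ultrametric inequality it stays inside this set, even with no prime singled out.\<close>
  have "open {x. \<forall>p. prime p \<longrightarrow> adele_padic_abs p x \<le> 1}"
    unfolding open_adele_iff
  proof
    fix x assume x: "x \<in> {x. \<forall>p. prime p \<longrightarrow> adele_padic_abs p x \<le> 1}"
    have "adele_padic_abs p y \<le> 1" if "prime p" "y \<in> adele_nbhd x 1 {}" for p y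
    proof -
      have "adele_padic_abs p (y - x) \<le> 1" using that by (simp add: adele_nbhd_def)
      moreover have "adele_padic_abs p x \<le> 1" using x that(1) by simp
      ultimately show ?thesis using adele_padic_abs_add[OF that(1), of "y - x" x] by simp
    qed
    then show "\<exists>e>0. \<exists>S. finite S \<and> adele_nbhd x e S \<subseteq> {x. \<forall>p. prime p \<longrightarrow> adele_padic_abs p x \<le> 1}"
      by (intro exI[of _ 1] conjI exI[of _ "{}"]) auto
  qed
  then have fin: "{x. \<forall>p. prime p \<longrightarrow> adele_padic_abs p x \<le> 1} \<in> sets borel"
    by (rule borel_open)
  have [measurable]: "arch_part \<in> borel_measurable borel"
    by (intro borel_measurable_continuous_onI continuous_on_arch_part)
  have "{x. 0 \<le> arch_part x \<and> arch_part x < 1} \<in> sets borel" by measurable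
  then have "{x. 0 \<le> arch_part x \<and> arch_part x < 1} \<inter> {x. \<forall>p. prime p \<longrightarrow> adele_padic_abs p x \<le> 1} \<in> sets borel"
    using fin by (rule sets.Int)
  moreover have "adele_fund_domain = {x. 0 \<le> arch_part x \<and> arch_part x < 1} \<inter> {x. \<forall>p. prime p \<longrightarrow> adele_padic_abs p x \<le> 1}"
    by (auto simp: adele_fund_domain_def)
  ultimately show ?thesis by simp
qed

section \<open>Integration over the quotient of the adeles\<close>

text \<open>The normalization gives the quotient total mass 1, so finite powers of
  \<open>\<mu>\<close> are finite measures and bounded measurable functions are integrable.\<close>

locale normalized_haar =
  fixes dx :: "adele measure"
  assumes haar: "haar_measure dx" and normalized: "emeasure dx adele_fund_domain = 1"
begin

abbreviation \<mu> :: "adele measure" where "\<mu> \<equiv> adele_quot_measure dx"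

lemma sets_dx [simp, measurable_cong]: "sets dx = sets borel"
  using haar by (simp add: haar_measure_def)

lemma space_dx [simp]: "space dx = UNIV"
  using sets_eq_imp_space_eq[OF sets_dx] by simp

lemma sets_quot [simp, measurable_cong]: "sets \<mu> = sets borel"
  by (simp add: adele_quot_measure_def)

lemma space_quot [simp]: "space \<mu> = UNIV"
  by (simp add: adele_quot_measure_def)

lemma emeasure_quot: "B \<in> sets borel \<Longrightarrow> emeasure \<mu> B = emeasure dx (adele_fund_domain \<inter> B)"
  unfolding adele_quot_measure_def by (intro emeasure_restricted) auto

lemma emeasure_quot_UNIV [simp]: "emeasure \<mu> UNIV = 1"
  by (simp add: emeasure_quot normalized)

lemma finite_measure_quot: "finite_measure \<mu>"
  by (intro finite_measureI) simp

lemma product_sigma_finite_quot: "product_sigma_finite (\<lambda>_. \<mu>)"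
  by (simp add: product_sigma_finite_def finite_measure.axioms(1) finite_measure_quot)

lemma finite_measure_PiM_quot:
  assumes "finite I" shows "finite_measure (PiM I (\<lambda>_. \<mu>))"
proof (intro finite_measureI)
  interpret product_sigma_finite "\<lambda>_. \<mu>" by (rule product_sigma_finite_quot)
  show "emeasure (PiM I (\<lambda>_. \<mu>)) (space (PiM I (\<lambda>_. \<mu>))) \<noteq> \<infinity>"
    unfolding space_PiM using emeasure_PiM[OF assms, of "\<lambda>_. UNIV"] by simp
qed

lemma sets_PiM_quot [simp, measurable_cong]:
  "sets (PiM I (\<lambda>_. \<mu>)) = sets (PiM I (\<lambda>_. borel))"
  by (intro sets_PiM_cong) auto

lemma integrable_PiM_quot:
  fixes f :: "('i \<Rightarrow> adele) \<Rightarrow> complex"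
  assumes "finite I" "f \<in> borel_measurable (PiM I (\<lambda>_. borel))" "\<And>x. norm (f x) \<le> K"
  shows "integrable (PiM I (\<lambda>_. \<mu>)) f"
proof -
  have "f \<in> borel_measurable (PiM I (\<lambda>_. \<mu>))"
    using assms(2) by (simp cong: measurable_cong_sets)
  then show ?thesis
    using assms by (intro finite_measure.integrable_const_bound[OF finite_measure_PiM_quot]) auto
qed

lemma measurable_adele_add_const [measurable]: "(\<lambda>x::adele. x + a) \<in> borel \<rightarrow>\<^sub>M borel"
  by (intro borel_measurable_continuous_onI continuous_intros)

lemma emeasure_dx_translate:
  assumes "B \<in> sets borel"
  shows "emeasure dx {x. x + a \<in> B} = emeasure dx B"
proof -
  have "{x. x + a \<in> B} = (+) (- a) ` B"
    by (auto simp: image_iff algebra_simps intro: bexI[of _ "_ + a"])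
  then show ?thesis using haar assms unfolding haar_measure_def by metis
qed

text \<open>Cutting \<open>F - a\<close> along the tiling of the adeles by the rational translates of the fundamental
  domain \<open>F\<close>, and moving each piece back into \<open>F\<close>, gives the tiling of \<open>F\<close> by the sets
  \<open>F \<inter> (F + a - q)\<close>.\<close>

lemma emeasure_quot_translate:
  assumes B: "B \<in> sets borel" and per: "\<And>x q. x + adele_of_rat q \<in> B \<longleftrightarrow> x \<in> B"
  shows "emeasure \<mu> {x. x + a \<in> B} = emeasure \<mu> B"
proof -
  let ?F = adele_fund_domain
  have m: "{x. x + c \<in> X} \<in> sets borel" if "X \<in> sets borel" for X and c :: adele
    using measurable_sets[OF measurable_adele_add_const that, of c] by (simp add: vimage_def)
  have dec: "\<exists>q. x + c + adele_of_rat q \<in> ?F" for x c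
    using adele_decompose[of "x + c"] by (metis adele_of_rat_minus diff_conv_add_uminus)
  have uniq: "q = r" if "x + adele_of_rat q \<in> ?F" "x + adele_of_rat r \<in> ?F" for x q r
    using adele_fund_domain_unique[of x "- q" "- r"] that by (simp add: adele_of_rat_minus)
  \<comment> \<open>With F the fundamental domain, \<open>D q\<close> is the part of
    \<open>B\<close> in F + a whose translate by \<open>q\<close> lies in F. Periodicity of
    \<open>B\<close> makes that translate equal to \<open>E q\<close>.\<close>
  define D where "D q = {x. x + - a \<in> ?F} \<inter> B \<inter> {x. x + adele_of_rat q \<in> ?F}" for q
  define E where "E q = ?F \<inter> B \<inter> {x. x + (- a - adele_of_rat q) \<in> ?F}" for q
  have DE: "D q = {x. x + adele_of_rat q \<in> E q}" for q
    using per[of _ q] by (auto simp: D_def E_def algebra_simps)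
  have mE: "E q \<in> sets borel" for q
    unfolding E_def using B m by (intro sets.Int) auto
  have mD: "D q \<in> sets borel" for q unfolding DE using mE by (rule m)
  have "emeasure \<mu> {x. x + a \<in> B} = emeasure dx (?F \<inter> {x. x + a \<in> B})"
    using m[OF B] by (rule emeasure_quot)
  also have "\<dots> = emeasure dx {x. x + - a \<in> ?F \<inter> {x. x + a \<in> B}}"
    using m[OF B] by (intro emeasure_dx_translate[symmetric] sets.Int) auto
  also have "{x. x + - a \<in> ?F \<inter> {x. x + a \<in> B}} = (\<Union>q. D q)"
    using dec[of _ 0] by (auto simp: D_def)
  also have "emeasure dx (\<Union>q. D q) = (\<integral>\<^sup>+q. emeasure dx (D q) \<partial>count_space UNIV)"
    using mD uniq by (intro emeasure_UN_countable) (auto simp: disjoint_family_on_def D_def)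
  also have "\<dots> = (\<integral>\<^sup>+q. emeasure dx (E q) \<partial>count_space UNIV)"
    unfolding DE using emeasure_dx_translate[OF mE] by simp
  also have "\<dots> = emeasure dx (\<Union>q. E q)"
  proof (intro emeasure_UN_countable[symmetric])
    have "q = r" if "x \<in> E q" "x \<in> E r" for x q r
      using uniq[of "x - a" "- q" "- r"] that
      by (simp add: E_def adele_of_rat_minus algebra_simps)
    then show "disjoint_family_on E UNIV" by (auto simp: disjoint_family_on_def)
  qed (use mE in auto)
  also have "(\<Union>q. E q) = ?F \<inter> B"
  proof -
    have "\<exists>q. x \<in> E q" if x: "x \<in> ?F \<inter> B" for x
    proof -
      obtain r where "x + - a + adele_of_rat r \<in> ?F" using dec by blast
      then have "x \<in> E (- r)" using x by (simp add: E_def adele_of_rat_minus algebra_simps)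
      then show ?thesis ..
    qed
    then show ?thesis by (auto simp: E_def)
  qed
  also have "emeasure dx (?F \<inter> B) = emeasure \<mu> B" using B by (rule emeasure_quot[symmetric])
  finally show ?thesis .
qed

text \<open>The preimages of Borel sets under a periodic \<open>f\<close> are periodic sets, so
  \<open>f\<close> and its translate have the same image measure, and the integral depends only on
  that measure.\<close>

lemma integral_quot_translate:
  fixes f :: "adele \<Rightarrow> complex"
  assumes f [measurable]: "f \<in> borel_measurable borel"
    and per: "\<And>x q. f (x + adele_of_rat q) = f x"
  shows "(\<integral>x. f (x + a) \<partial>\<mu>) = (\<integral>x. f x \<partial>\<mu>)"
proof -
  have "distr \<mu> borel (\<lambda>x. f (x + a)) = distr \<mu> borel f"
  proof (rule measure_eqI)
    fix B assume "B \<in> sets (distr \<mu> borel (\<lambda>x. f (x + a)))"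
    then have B [measurable]: "B \<in> sets borel" by simp
    have "emeasure \<mu> {x. x + a \<in> f -` B} = emeasure \<mu> (f -` B)"
      using measurable_sets[OF f B] per by (intro emeasure_quot_translate) auto
    then show "emeasure (distr \<mu> borel (\<lambda>x. f (x + a))) B = emeasure (distr \<mu> borel f) B"
      by (simp add: emeasure_distr vimage_def)
  qed simp
  moreover have "(\<integral>x. f (x + a) \<partial>\<mu>) = (\<integral>z. z \<partial>distr \<mu> borel (\<lambda>x. f (x + a)))"
    by (subst integral_distr) simp_all
  moreover have "(\<integral>x. f x \<partial>\<mu>) = (\<integral>z. z \<partial>distr \<mu> borel f)"
    by (subst integral_distr) simp_all
  ultimately show ?thesis by simp
qed

text \<open>With the coordinate \<open>t\<close> integrated innermost, \<open>\<tau> x\<close> is a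
  constant for the inner integral, because it ignores that coordinate; translation invariance in one
  variable finishes. The bound provides the integrability that Fubini asks for.\<close>

lemma integral_PiM_quot_shear1:
  fixes f :: "('i \<Rightarrow> adele) \<Rightarrow> complex"
  assumes I: "finite I" "t \<in> I" and f: "f \<in> borel_measurable (PiM I (\<lambda>_. borel))"
    and bound: "\<And>x. norm (f x) \<le> K"
    and per: "\<And>x q. f (x(t := x t + adele_of_rat q)) = f x"
    and \<tau>: "\<tau> \<in> borel_measurable (PiM I (\<lambda>_. borel))" "\<And>x y. \<tau> (x(t := y)) = \<tau> x"
  shows "(\<integral>x. f (x(t := x t + \<tau> x)) \<partial>PiM I (\<lambda>_. \<mu>)) = (\<integral>x. f x \<partial>PiM I (\<lambda>_. \<mu>))"
proof -
  interpret product_sigma_finite "\<lambda>_. \<mu>" by (rule product_sigma_finite_quot)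
  define J where "J = I - {t}"
  have J: "finite J" "t \<notin> J" and IJ: "I = insert t J" using I by (auto simp: J_def)
  have "(\<lambda>x. x(t := x t + \<tau> x)) \<in> PiM I (\<lambda>_. borel) \<rightarrow>\<^sub>M PiM I (\<lambda>_. borel)"
    using I \<tau> by (intro measurable_fun_upd[where J = I] borel_measurable_add measurable_component_singleton) auto
  from measurable_compose[OF this f] have m: "(\<lambda>x. f (x(t := x t + \<tau> x))) \<in> borel_measurable (PiM I (\<lambda>_. borel))" .
  have "(\<integral>x. f (x(t := x t + \<tau> x)) \<partial>PiM I (\<lambda>_. \<mu>)) =
      (\<integral>x. (\<integral>y. f (x(t := y + \<tau> x)) \<partial>\<mu>) \<partial>PiM J (\<lambda>_. \<mu>))"
    using product_integral_insert[OF J, of "\<lambda>x. f (x(t := x t + \<tau> x))"]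
      integrable_PiM_quot[OF I(1) m bound] by (simp add: IJ[symmetric] \<tau>(2))
  also have "\<dots> = (\<integral>x. (\<integral>y. f (x(t := y)) \<partial>\<mu>) \<partial>PiM J (\<lambda>_. \<mu>))"
  proof (rule Bochner_Integration.integral_cong[OF refl])
    fix x assume "x \<in> space (PiM J (\<lambda>_. \<mu>))"
    then have x: "x \<in> space (PiM J (\<lambda>_. borel :: adele measure))" by (simp add: space_PiM)
    have "(\<lambda>y. x(t := y)) \<in> borel \<rightarrow>\<^sub>M PiM I (\<lambda>_. borel)"
      using x by (intro measurable_fun_upd[where J = J]) (auto simp: IJ)
    from measurable_compose[OF this f] have my: "(\<lambda>y. f (x(t := y))) \<in> borel_measurable borel" .
    show "(\<integral>y. f (x(t := y + \<tau> x)) \<partial>\<mu>) = (\<integral>y. f (x(t := y)) \<partial>\<mu>)"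
      using per[of "x(t := _)"] by (intro integral_quot_translate[OF my]) simp
  qed
  also have "\<dots> = (\<integral>x. f x \<partial>PiM I (\<lambda>_. \<mu>))"
    using product_integral_insert[OF J, of f] integrable_PiM_quot[OF I(1) f bound]
    by (simp add: IJ[symmetric])
  finally show ?thesis .
qed

lemma measurable_shear:
  fixes \<tau> :: "'i \<Rightarrow> ('i \<Rightarrow> adele) \<Rightarrow> adele"
  assumes "B \<subseteq> I" "\<And>t. t \<in> B \<Longrightarrow> \<tau> t \<in> borel_measurable (PiM I (\<lambda>_. borel))"
  shows "(\<lambda>x t. if t \<in> B then x t + \<tau> t x else x t) \<in> PiM I (\<lambda>_. borel) \<rightarrow>\<^sub>M PiM I (\<lambda>_. borel)"
proof (rule measurable_PiM_single')
  fix i assume i: "i \<in> I"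
  show "(\<lambda>x. if i \<in> B then x i + \<tau> i x else x i) \<in> PiM I (\<lambda>_. borel) \<rightarrow>\<^sub>M borel"
    using i assms(2)[of i]
    by (cases "i \<in> B") (auto intro!: borel_measurable_add measurable_component_singleton)
qed (use assms in \<open>auto simp: space_PiM PiE_def extensional_def\<close>)

text \<open>Induction on \<open>B\<close>, one coordinate at a time. Every shift ignores all
  coordinates in \<open>B\<close>, so the simultaneous shear is a composition of single shifts whose
  amounts are not disturbed by the others.\<close>

lemma integral_PiM_quot_shear:
  fixes f :: "('i \<Rightarrow> adele) \<Rightarrow> complex"
  assumes I: "finite I" "B \<subseteq> I" and f: "f \<in> borel_measurable (PiM I (\<lambda>_. borel))"
    and bound: "\<And>x. norm (f x) \<le> K"
    and per: "\<And>x t q. t \<in> I \<Longrightarrow> f (x(t := x t + adele_of_rat q)) = f x"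
    and \<tau>: "\<And>t. t \<in> B \<Longrightarrow> \<tau> t \<in> borel_measurable (PiM I (\<lambda>_. borel))"
      "\<And>x y s t. s \<in> B \<Longrightarrow> t \<in> B \<Longrightarrow> \<tau> t (x(s := y)) = \<tau> t x"
  shows "(\<integral>x. f (\<lambda>t. if t \<in> B then x t + \<tau> t x else x t) \<partial>PiM I (\<lambda>_. \<mu>)) = (\<integral>x. f x \<partial>PiM I (\<lambda>_. \<mu>))"
proof -
  have "finite B" using I finite_subset by blast
  then show ?thesis using I(2) \<tau>
  proof (induction B)
    case empty then show ?case by simp
  next
    case (insert b B)
    define S where "S x = (\<lambda>t. if t \<in> B then x t + \<tau> t x else x t)" for x
    have \<tau>_upd: "\<tau> t (x(b := y)) = \<tau> t x" if "t \<in> insert b B" for t x y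
      using insert.prems(3)[of b t] that by blast
    have S_insert: "(\<lambda>t. if t \<in> insert b B then x t + \<tau> t x else x t) = S (x(b := x b + \<tau> b x))" for x
      using insert.hyps(2) by (intro ext) (auto simp: S_def \<tau>_upd)
    have S_upd: "S (x(b := x b + c)) = (S x)(b := S x b + c)" for x c
      using insert.hyps(2) by (intro ext) (auto simp: S_def \<tau>_upd)
    have mS: "S \<in> PiM I (\<lambda>_. borel) \<rightarrow>\<^sub>M PiM I (\<lambda>_. borel)"
      unfolding S_def using insert.prems by (intro measurable_shear) auto
    have "(\<integral>x. f (\<lambda>t. if t \<in> insert b B then x t + \<tau> t x else x t) \<partial>PiM I (\<lambda>_. \<mu>)) =
        (\<integral>x. f (S (x(b := x b + \<tau> b x))) \<partial>PiM I (\<lambda>_. \<mu>))"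
      by (simp only: S_insert)
    also have "\<dots> = (\<integral>x. f (S x) \<partial>PiM I (\<lambda>_. \<mu>))"
      using insert.prems I(1) measurable_compose[OF mS f] bound per
      by (intro integral_PiM_quot_shear1[where f = "\<lambda>x. f (S x)"]) (auto simp: S_upd \<tau>_upd)
    also have "\<dots> = (\<integral>x. f x \<partial>PiM I (\<lambda>_. \<mu>))"
      using insert.IH insert.prems by (simp add: S_def o_def)
    finally show ?case .
  qed
qed

end

section \<open>Matrices over the adeles\<close>

lemma map_matrix_mult:
  assumes "\<And>x y. f (x + y) = f x + f y" "\<And>x y. f (x * y) = f x * f y" "f 0 = 0"
  shows "map_matrix f ((A::'a::semiring_1^'n^'m) ** B) = (map_matrix f A :: 'b::semiring_1^'n^'m) ** map_matrix f B"
proof -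
  have "f (sum g S) = (\<Sum>x\<in>S. f (g x))" for g :: "'n \<Rightarrow> 'a" and S
    by (induction S rule: infinite_finite_induct) (auto simp: assms)
  then show ?thesis by (simp add: vec_eq_iff matrix_matrix_mult_def assms)
qed

lemmas rat_matrix_mult = map_matrix_mult[of adele_of_rat, OF adele_of_rat_add adele_of_rat_mult adele_of_rat_0]

lemma map_matrix_mat_1: "f 0 = 0 \<Longrightarrow> f 1 = 1 \<Longrightarrow> map_matrix f (mat 1) = mat 1"
  by (simp add: vec_eq_iff mat_def)

lemmas rat_matrix_1 [simp] = map_matrix_mat_1[of adele_of_rat, OF adele_of_rat_0 adele_of_rat_1]

lemma det_map_matrix_4:
  assumes "\<And>x y. f (x + y) = f x + f y" "\<And>x y. f (x * y) = f x * f y" "\<And>x. f (- x) = - f x"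
  shows "det (map_matrix f (A::'a::comm_ring_1^4^4)) = (f (det A) :: 'b::comm_ring_1)"
proof -
  have "f (x - y) = f x - f y" for x y using assms(1)[of x "- y"] assms(3)[of y] by simp
  then show ?thesis by (simp add: det_4 assms)
qed

lemma rat_matrix_SL4: "\<gamma> \<in> SL4 \<Longrightarrow> rat_matrix \<gamma> \<in> SL4"
  using det_map_matrix_4[of adele_of_rat \<gamma>, OF adele_of_rat_add adele_of_rat_mult adele_of_rat_minus]
  by (simp add: SL4_def)

lemma arch_matrix_SL4: "g \<in> SL4 \<Longrightarrow> map_matrix arch_part g \<in> SL4"
  using det_map_matrix_4[of arch_part g] by (simp add: SL4_def)

lemma SL4_mult: "A \<in> SL4 \<Longrightarrow> B \<in> SL4 \<Longrightarrow> A ** B \<in> SL4"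
  by (simp add: SL4_def det_mul)

text \<open>The adjugate, as the adeles are only a ring: \<open>B $ i $ j\<close> is the determinant
  of \<open>A\<close> with row \<open>j\<close> replaced by the \<open>i\<close>-th unit vector.
  Linearity in that row turns \<open>(A ** B) $ m $ j\<close> into the determinant of
  \<open>A\<close> with row \<open>j\<close> replaced by row \<open>m\<close>.\<close>

lemma det_1_right_inverse:
  fixes A :: "'a::comm_ring_1^'n^'n"
  assumes "det A = 1"
  obtains B where "A ** B = mat 1"
proof -
  define B :: "'a^'n^'n" where "B = (\<chi> i j. det (\<chi> k. if k = j then axis i 1 else row k A))"
  have "(A ** B) $ m $ j = mat 1 $ m $ j" for m j
  proof -
    have "(A ** B) $ m $ j = (\<Sum>i\<in>UNIV. A $ m $ i * det (\<chi> k. if k = j then axis i 1 else row k A))"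
      by (simp add: matrix_matrix_mult_def B_def)
    also have "\<dots> = (\<Sum>i\<in>UNIV. det (\<chi> k. if k = j then A $ m $ i *s axis i 1 else row k A))"
      by (simp only: det_row_mul)
    also have "\<dots> = det (\<chi> k. if k = j then (\<Sum>i\<in>UNIV. A $ m $ i *s axis i 1) else row k A)"
      by (rule det_linear_row_sum[symmetric]) simp
    also have "(\<Sum>i\<in>UNIV. A $ m $ i *s axis i 1) = row m A"
      by (simp add: vec_eq_iff row_def axis_def if_distrib[of "(*) _"] cong: if_cong)
    also have "det (\<chi> k. if k = j then row m A else row k A) = (if m = j then 1 else 0)"
    proof (cases "m = j")
      case True
      then have "(\<chi> k. if k = j then row m A else row k A) = A"
        by (simp add: vec_eq_iff row_def)
      then show ?thesis using True assms by simp
    next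
      case False
      then show ?thesis by (simp, intro det_identical_rows[OF False]) (simp add: row_def vec_eq_iff)
    qed
    finally show ?thesis by (simp add: mat_def)
  qed
  then have "A ** B = mat 1" by (simp add: vec_eq_iff)
  then show ?thesis by (rule that)
qed

text \<open>The right inverse has determinant 1 as well, hence a right inverse of its own, which
  associativity identifies with \<open>A\<close>.\<close>

lemma det_1_inverse:
  fixes A :: "'a::comm_ring_1^'n^'n"
  assumes "det A = 1"
  obtains B where "A ** B = mat 1" "B ** A = mat 1"
proof -
  obtain B where AB: "A ** B = mat 1" using assms by (rule det_1_right_inverse)
  then have "det B = 1" by (metis assms det_I det_mul mult_1)
  then obtain C where BC: "B ** C = mat 1" by (rule det_1_right_inverse)
  have "A = A ** (B ** C)" unfolding BC by simp
  also have "\<dots> = C" unfolding matrix_mul_assoc AB by simp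
  finally show ?thesis using that AB BC by blast
qed

lemma matrix_inv_unique:
  fixes A B :: "'a::semiring_1^'n^'n"
  assumes "A ** B = mat 1" "B ** A = mat 1"
  shows "matrix_inv A = B"
proof -
  have "A ** matrix_inv A = mat 1 \<and> matrix_inv A ** A = mat 1"
    unfolding matrix_inv_def by (rule someI[of _ B]) (use assms in simp)
  then have "matrix_inv A = matrix_inv A ** (A ** B)" using assms by simp
  also have "\<dots> = B" using \<open>A ** matrix_inv A = mat 1 \<and> matrix_inv A ** A = mat 1\<close>
    by (simp add: matrix_mul_assoc)
  finally show ?thesis .
qed

lemma det_unip_matrix:
  assumes "S \<subseteq> {(1,2), (1,3), (1,4), (2,3), (2,4), (3,4)}"
  shows "det (unip_matrix S x :: 'a::comm_ring_1^4^4) = 1"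
proof -
  have notin: "t \<notin> S" if "t \<notin> {(1,2), (1,3), (1,4), (2,3), (2,4), (3,4)}" for t
    using assms that by blast
  have "(2,1) \<notin> S" "(3,1) \<notin> S" "(4,1) \<notin> S" "(3,2) \<notin> S" "(4,2) \<notin> S" "(4,3) \<notin> S"
    by (rule notin, simp)+
  then have "unip_matrix S x $ 2 $ 1 = 0" "unip_matrix S x $ 3 $ 1 = 0" "unip_matrix S x $ 4 $ 1 = 0"
    "unip_matrix S x $ 3 $ 2 = 0" "unip_matrix S x $ 4 $ 2 = 0" "unip_matrix S x $ 4 $ 3 = 0"
    by (simp_all add: unip_matrix_def)
  moreover have "unip_matrix S x $ i $ i = 1" for i by (simp add: unip_matrix_def)
  ultimately show ?thesis by (simp add: det_4)
qed

lemma matrix_add_rdistrib: "((A::'a::semiring_1^'n^'m) + B) ** C = A ** C + B ** C"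
  by (simp add: vec_eq_iff matrix_matrix_mult_def sum.distrib distrib_right)

lemma rat_matrix_unip: "rat_matrix (unip_matrix S r) = unip_matrix S (\<lambda>t. adele_of_rat (r t))"
  by (simp add: vec_eq_iff unip_matrix_def)

definition block_matrix :: "4 set \<Rightarrow> 4 set \<Rightarrow> (4 \<times> 4 \<Rightarrow> 'a) \<Rightarrow> ('a::zero)^4^4" where
  "block_matrix R C x = (\<chi> i j. if i \<in> R \<and> j \<in> C then x (i, j) else 0)"

lemma unip_matrix_eq_block:
  "R \<inter> C = {} \<Longrightarrow> unip_matrix (R \<times> C) x = mat 1 + block_matrix R C (x :: _ \<Rightarrow> 'a::comm_ring_1)"
  by (auto simp: vec_eq_iff unip_matrix_def block_matrix_def mat_def)

text \<open>A nonzero term would need a middle index in both \<open>C\<close> and \<open>R\<close>.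
  This is what turns the group law in \<open>unip_matrix_mult\<close> into addition of
  coordinates.\<close>

lemma block_matrix_mult:
  "R \<inter> C = {} \<Longrightarrow> block_matrix R C x ** block_matrix R C y = (0 :: 'a::comm_ring_1^4^4)"
  by (auto simp: vec_eq_iff matrix_matrix_mult_def block_matrix_def intro!: sum.neutral)

lemma unip_matrix_mult:
  assumes "R \<inter> C = {}"
  shows "unip_matrix (R \<times> C) x ** unip_matrix (R \<times> C) y = unip_matrix (R \<times> C) (\<lambda>t. x t + y t :: 'a::comm_ring_1)"
proof -
  have "block_matrix R C x + block_matrix R C y = block_matrix R C (\<lambda>t. x t + y t)"
    by (simp add: vec_eq_iff block_matrix_def)
  then show ?thesis
    by (simp add: unip_matrix_eq_block assms matrix_add_ldistrib matrix_add_rdistrib block_matrix_mult add.assoc)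
qed

section \<open>Continuity and growth of automorphic forms\<close>

text \<open>Near \<open>g\<close> the form depends only on the real component, through a function
  with a continuous local extension \<open>F\<close>; continuity of \<open>arch_part\<close>
  transports the limit back to the adeles.\<close>

lemma smooth_adelic_continuous_on:
  assumes "smooth_adelic \<phi>" shows "continuous_on SL4 \<phi>"
  unfolding continuous_on_def
proof
  fix g :: "adele^4^4" assume g: "g \<in> SL4"
  obtain W f where W: "open W" "g \<in> W" "smooth_on_SL4R f"
    "\<And>h. h \<in> W \<inter> SL4 \<Longrightarrow> \<phi> h = f (map_matrix arch_part h)"
    using assms g unfolding smooth_adelic_def by meson
  let ?a = "map_matrix arch_part :: adele^4^4 \<Rightarrow> real^4^4"
  have "?a g \<in> SL4" using g by (rule arch_matrix_SL4)
  then obtain U F where U: "open U" "?a g \<in> U" "\<And>k. Ck_on k F U" "\<And>y. y \<in> U \<inter> SL4 \<Longrightarrow> F y = f y"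
    using W(3) unfolding smooth_on_SL4R_def by meson
  have "continuous_on UNIV ?a"
    unfolding map_matrix_def
    by (intro continuous_intros continuous_on_compose2[OF continuous_on_arch_part]) auto
  then have a: "(?a \<longlongrightarrow> ?a g) (at g within SL4)"
    using tendsto_mono[OF at_le[OF subset_UNIV]] unfolding continuous_on_def by blast
  have "continuous_on U F" using U(3)[of 0] by simp
  then have "isCont F (?a g)" using U continuous_on_eq_continuous_at by blast
  then have lim: "((\<lambda>h. F (?a h)) \<longlongrightarrow> F (?a g)) (at g within SL4)"
    using a by (rule isCont_tendsto_compose)
  have "\<forall>\<^sub>F h in at g within SL4. h \<in> W" "\<forall>\<^sub>F h in at g within SL4. ?a h \<in> U" "\<forall>\<^sub>F h in at g within SL4. h \<in> SL4"
    using W(1,2) topological_tendstoD[OF a U(1,2)]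
    by (auto simp: eventually_at_topological)
  then have "\<forall>\<^sub>F h in at g within SL4. \<phi> h = F (?a h)"
  proof eventually_elim
    case (elim h)
    then show ?case using W(4)[of h] U(4)[of "?a h"] arch_matrix_SL4[of h] by simp
  qed
  moreover have "\<phi> g = F (?a g)" using W(2,4) U(2,4) g arch_matrix_SL4[of g] by simp
  ultimately show "(\<phi> \<longlongrightarrow> \<phi> g) (at g within SL4)" using lim by (simp add: tendsto_cong)
qed

lemma continuous_on_unip_mult:
  fixes g :: "adele^4^4"
  shows "continuous_on A (\<lambda>x. unip_matrix S x ** g)"
proof -
  have "continuous_on A (\<lambda>x. unip_matrix S x $ i $ j :: adele)" for i j
    by (cases "i = j"; cases "(i, j) \<in> S")
      (auto simp: unip_matrix_def intro: continuous_on_product_coordinates continuous_on_subset)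
  then show ?thesis
    unfolding matrix_matrix_mult_def
    by (intro continuous_on_vec_lambda continuous_on_sum continuous_on_adele_mult_const)
qed

text \<open>On the full countable power, second countability makes continuous functions product
  measurable. Padding the coordinates outside \<open>I\<close> with an arbitrary constant
  \<open>d\<close> pulls this back to the partial product, and \<open>f\<close> does not see the
  padding.\<close>

lemma measurable_PiM_of_continuous:
  fixes f :: "('i::countable \<Rightarrow> 'b::second_countable_topology) \<Rightarrow> 'c::topological_space"
  assumes "continuous_on UNIV f" and dep: "\<And>x y. (\<And>t. t \<in> I \<Longrightarrow> x t = y t) \<Longrightarrow> f x = f y"
  shows "f \<in> PiM I (\<lambda>_. borel) \<rightarrow>\<^sub>M borel"
proof -
  obtain d :: 'b where True by blast
  have m: "(\<lambda>x t. if t \<in> I then x t else d) \<in> PiM I (\<lambda>_. borel) \<rightarrow>\<^sub>M PiM UNIV (\<lambda>_. borel)"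
  proof (rule measurable_PiM_single')
    fix t
    show "(\<lambda>x. if t \<in> I then x t else d) \<in> PiM I (\<lambda>_. borel) \<rightarrow>\<^sub>M borel"
      by (cases "t \<in> I") (auto intro: measurable_component_singleton)
  qed auto
  have "f \<in> PiM UNIV (\<lambda>_. borel) \<rightarrow>\<^sub>M borel"
    using assms(1) by (simp add: sets_PiM_equal_borel borel_measurable_continuous_onI cong: measurable_cong_sets)
  from measurable_compose[OF m this]
  have "(\<lambda>x. f (\<lambda>t. if t \<in> I then x t else d)) \<in> PiM I (\<lambda>_. borel) \<rightarrow>\<^sub>M borel" .
  moreover have "(\<lambda>x. f (\<lambda>t. if t \<in> I then x t else d)) = f" by (intro ext dep) simp
  ultimately show ?thesis by simp
qed

lemma local_norm_le:
  assumes "\<And>i j. v (g $ i $ j) \<le> B" "\<And>i j. v (matrix_inv g $ i $ j) \<le> B"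
  shows "local_norm v g \<le> B"
  unfolding local_norm_def using assms by (intro Max.boundedI) auto

lemma local_norm_ge:
  "v (g $ i $ j) \<le> local_norm v g" "v (matrix_inv g $ i $ j) \<le> local_norm v g"
proof -
  have "(case (i, j) of (i, j) \<Rightarrow> max (v (g $ i $ j)) (v (matrix_inv g $ i $ j))) \<le> local_norm v g"
    unfolding local_norm_def by (rule Max_ge) (auto simp: image_iff)
  then show "v (g $ i $ j) \<le> local_norm v g" "v (matrix_inv g $ i $ j) \<le> local_norm v g" by auto
qed

lemma matrix_inv_mult_SL4:
  assumes "g \<in> SL4" "k ** k' = mat 1" "k' ** k = mat 1"
  shows "matrix_inv (k ** g) = matrix_inv g ** (k' :: 'a::comm_ring_1^4^4)"
proof -
  obtain h where h: "g ** h = mat 1" "h ** g = mat 1"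
    using det_1_inverse assms(1) by (auto simp: SL4_def)
  have "matrix_inv g = h" using h by (rule matrix_inv_unique)
  moreover have "matrix_inv (k ** g) = h ** k'"
  proof (rule matrix_inv_unique)
    have "k ** g ** (h ** k') = k ** (g ** h) ** k'" "h ** k' ** (k ** g) = h ** (k' ** k) ** g"
      by (simp_all only: matrix_mul_assoc)
    then show "k ** g ** (h ** k') = mat 1" "h ** k' ** (k ** g) = mat 1"
      using assms h by simp_all
  qed
  ultimately show ?thesis by simp
qed

lemma local_norm_padic_mult_le:
  assumes p: "prime p" and g: "g \<in> SL4" and k: "k ** k' = mat 1" "k' ** k = mat 1"
    and int: "\<And>i j. adele_padic_abs p (k $ i $ j) \<le> 1" "\<And>i j. adele_padic_abs p (k' $ i $ j) \<le> 1"
  shows "local_norm (adele_padic_abs p) (k ** g) \<le> local_norm (adele_padic_abs p) g"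
proof (rule local_norm_le)
  let ?N = "local_norm (adele_padic_abs p) g"
  have N: "?N \<ge> 0" using local_norm_ge(1)[of "adele_padic_abs p" g 1 1] order_trans adele_padic_abs_nonneg by blast
  have ab: "a * b \<le> ?N" "b * a \<le> ?N" if "0 \<le> a" "a \<le> 1" "0 \<le> b" "b \<le> ?N" for a b :: real
    using that mult_left_le_one_le[of b a] by (auto simp: mult.commute intro: order_trans)
  fix i j
  show "adele_padic_abs p ((k ** g) $ i $ j) \<le> ?N"
    unfolding matrix_matrix_mult_def vec_lambda_beta
    by (intro adele_padic_abs_sum_le[OF p _ N]) (simp add: adele_padic_abs_mult[OF p] ab int local_norm_ge)
  show "adele_padic_abs p (matrix_inv (k ** g) $ i $ j) \<le> ?N"
    unfolding matrix_inv_mult_SL4[OF g k] unfolding matrix_matrix_mult_def vec_lambda_beta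
    by (intro adele_padic_abs_sum_le[OF p _ N]) (simp add: adele_padic_abs_mult[OF p] ab int local_norm_ge)
qed

text \<open>Multiplication by an integral matrix cannot increase the norm; since the inverse
  \<open>k'\<close> is integral too, the same bound applied to \<open>k'\<close> gives
  equality.\<close>

lemma local_norm_padic_mult:
  assumes p: "prime p" and g: "g \<in> SL4" and k: "k \<in> SL4" "k ** k' = mat 1" "k' ** k = mat 1"
    and int: "\<And>i j. adele_padic_abs p (k $ i $ j) \<le> 1" "\<And>i j. adele_padic_abs p (k' $ i $ j) \<le> 1"
  shows "local_norm (adele_padic_abs p) (k ** g) = local_norm (adele_padic_abs p) g"
proof (rule antisym)
  show "local_norm (adele_padic_abs p) (k ** g) \<le> local_norm (adele_padic_abs p) g"
    using local_norm_padic_mult_le[OF p g k(2,3) int] .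
  have "k' ** (k ** g) = g" using k by (simp add: matrix_mul_assoc)
  then show "local_norm (adele_padic_abs p) g \<le> local_norm (adele_padic_abs p) (k ** g)"
    using local_norm_padic_mult_le[OF p SL4_mult[OF k(1) g] k(3,2) int(2,1)] by simp
qed

text \<open>The factor 4 counts the summands in an entry of a product of matrices of size 4.\<close>

lemma local_norm_arch_mult_le:
  assumes g: "g \<in> SL4" and k: "k ** k' = mat 1" "k' ** k = mat 1"
    and bd: "\<And>i j. \<bar>arch_part (k $ i $ j)\<bar> \<le> 1" "\<And>i j. \<bar>arch_part (k' $ i $ j)\<bar> \<le> 1"
  shows "local_norm (\<lambda>x. \<bar>arch_part x\<bar>) (k ** g) \<le> 4 * local_norm (\<lambda>x. \<bar>arch_part x\<bar>) g"
proof (rule local_norm_le)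
  let ?N = "local_norm (\<lambda>x. \<bar>arch_part x\<bar>) g"
  have ab: "\<bar>arch_part (x * y)\<bar> \<le> ?N" "\<bar>arch_part (y * x)\<bar> \<le> ?N"
    if "\<bar>arch_part x\<bar> \<le> 1" "\<bar>arch_part y\<bar> \<le> ?N" for x y
    using that mult_mono[OF that] by (auto simp: abs_mult mult.commute)
  have four: "\<bar>arch_part (\<Sum>k\<in>UNIV. f k)\<bar> \<le> 4 * ?N" if "\<And>k. \<bar>arch_part (f k)\<bar> \<le> ?N" for f :: "4 \<Rightarrow> adele"
    using that[of 1] that[of 2] that[of 3] that[of 4] by (simp add: sum_4)
  fix i j
  show "\<bar>arch_part ((k ** g) $ i $ j)\<bar> \<le> 4 * ?N"
    unfolding matrix_matrix_mult_def vec_lambda_beta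
    using local_norm_ge(1)[of "\<lambda>x. \<bar>arch_part x\<bar>" g] by (intro four ab bd)
  show "\<bar>arch_part (matrix_inv (k ** g) $ i $ j)\<bar> \<le> 4 * ?N"
    unfolding matrix_inv_mult_SL4[OF g k] unfolding matrix_matrix_mult_def vec_lambda_beta
    using local_norm_ge(2)[of "\<lambda>x. \<bar>arch_part x\<bar>" g] by (intro four ab bd)
qed

text \<open>Unipotent matrices with entries in the fundamental domain do not change the local norms at
  the primes and change the archimedean norm by a bounded factor, so moderate growth gives
  boundedness without any appeal to the compactness of \<open>Q\A\<close>.\<close>

lemma automorphic_form_bounded:
  assumes \<phi>: "automorphic_form \<phi>" and g: "g \<in> SL4" and RC: "R \<inter> C = {}"
    and upper: "R \<times> C \<subseteq> {(1,2), (1,3), (1,4), (2,3), (2,4), (3,4)}"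
  obtains K where "\<And>x. (\<And>t. x t \<in> adele_fund_domain) \<Longrightarrow> norm (\<phi> (unip_matrix (R \<times> C) x ** g)) \<le> K"
proof -
  obtain c n where c: "\<And>h. h \<in> SL4 \<Longrightarrow> norm (\<phi> h) \<le> c * adelic_norm h ^ n"
    using \<phi> unfolding automorphic_form_def by blast
  let ?a = "\<lambda>x. \<bar>arch_part x\<bar>"
  define Pr where "Pr = (\<Prod>p\<in>{p. prime p \<and> local_norm (adele_padic_abs p) g \<noteq> 1}. local_norm (adele_padic_abs p) g)"
  have local_nonneg: "local_norm v h \<ge> 0" if "\<And>x. v x \<ge> 0" for v h
    using local_norm_ge(1)[of v h 1 1] that order_trans by blast
  have Pr: "Pr \<ge> 0" unfolding Pr_def by (intro prod_nonneg ballI local_nonneg) simp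
  \<comment> \<open>The growth constant carries no sign, hence \<open>\<bar>c\<bar>\<close>. The
    factor 4 is the loss at the real place, and the product \<open>Pr\<close> over the primes is the
    one belonging to \<open>g\<close>.\<close>
  have "norm (\<phi> (unip_matrix (R \<times> C) x ** g)) \<le> \<bar>c\<bar> * (4 * local_norm ?a g * Pr) ^ n"
    if x: "\<And>t. x t \<in> adele_fund_domain" for x
  proof -
    define k where "k = unip_matrix (R \<times> C) x"
    define k' where "k' = unip_matrix (R \<times> C) (\<lambda>t. - x t)"
    have one: "unip_matrix (R \<times> C) (\<lambda>t. 0) = (mat 1 :: adele^4^4)"
      by (auto simp: vec_eq_iff unip_matrix_def mat_def)
    have k: "k ** k' = mat 1" "k' ** k = mat 1"
      by (simp_all add: k_def k'_def unip_matrix_mult[OF RC] one)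
    have kSL: "k \<in> SL4" using det_unip_matrix[OF upper] by (simp add: SL4_def k_def)
    have int: "adele_padic_abs p (k $ i $ j) \<le> 1" "adele_padic_abs p (k' $ i $ j) \<le> 1" if "prime p" for p i j
      using that x[of "(i, j)"] by (auto simp: k_def k'_def unip_matrix_def adele_fund_domain_def)
    have arch: "\<bar>arch_part (k $ i $ j)\<bar> \<le> 1" "\<bar>arch_part (k' $ i $ j)\<bar> \<le> 1" for i j
      using x[of "(i, j)"] by (auto simp: k_def k'_def unip_matrix_def adele_fund_domain_def)
    have loc: "local_norm (adele_padic_abs p) (k ** g) = local_norm (adele_padic_abs p) g" if "prime p" for p
      using local_norm_padic_mult[OF that g kSL k] int that by blast
    have "{p. prime p \<and> local_norm (adele_padic_abs p) (k ** g) \<noteq> 1}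
        = {p. prime p \<and> local_norm (adele_padic_abs p) g \<noteq> 1}"
      using loc by auto
    then have "adelic_norm (k ** g) = local_norm ?a (k ** g) * Pr"
      unfolding adelic_norm_def Pr_def using loc by (auto intro!: prod.cong)
    also have "\<dots> \<le> 4 * local_norm ?a g * Pr"
      using local_norm_arch_mult_le[OF g k arch] Pr by (intro mult_right_mono)
    finally have le: "adelic_norm (k ** g) \<le> 4 * local_norm ?a g * Pr" .
    have nonneg: "adelic_norm (k ** g) \<ge> 0"
      unfolding adelic_norm_def by (intro mult_nonneg_nonneg prod_nonneg ballI local_nonneg) auto
    have "norm (\<phi> (k ** g)) \<le> c * adelic_norm (k ** g) ^ n" using c SL4_mult[OF kSL g] by blast
    also have "\<dots> \<le> \<bar>c\<bar> * adelic_norm (k ** g) ^ n" using nonneg by (intro mult_right_mono) auto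
    also have "\<dots> \<le> \<bar>c\<bar> * (4 * local_norm ?a g * Pr) ^ n"
      using le nonneg by (intro mult_left_mono power_mono) auto
    finally show ?thesis by (simp add: k_def)
  qed
  then show ?thesis by (rule that)
qed

section \<open>Conjugation by the Levi subgroup\<close>

text \<open>A product of commuting transvections with a common column \<open>b\<close>, so that
  several entries are treated at once. When \<open>c b = 0\<close> the added matrix squares to zero,
  and the inverse is obtained by negating \<open>c\<close>.\<close>

definition column_shear :: "4 \<Rightarrow> (4 \<Rightarrow> 'a) \<Rightarrow> ('a::comm_ring_1)^4^4" where
  "column_shear b c = mat 1 + (\<chi> i j. if j = b then c i else 0)"

definition row_shear :: "4 \<Rightarrow> (4 \<Rightarrow> 'a) \<Rightarrow> ('a::comm_ring_1)^4^4" where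
  "row_shear a c = mat 1 + (\<chi> i j. if i = a then c j else 0)"

lemma column_shear_inverse:
  fixes c :: "4 \<Rightarrow> 'a::comm_ring_1"
  assumes "c b = 0" shows "column_shear b c ** column_shear b (\<lambda>i. - c i) = mat 1"
proof -
  let ?X = "\<lambda>c. (\<chi> i j. if j = b then c i else 0) :: 'a^4^4"
  have "?X c ** ?X (\<lambda>i. - c i) = 0" "?X c + ?X (\<lambda>i. - c i) = 0"
    using assms by (auto simp: vec_eq_iff matrix_matrix_mult_def intro!: sum.neutral)
  then show ?thesis
    by (simp add: column_shear_def matrix_add_ldistrib matrix_add_rdistrib add.assoc)
qed

lemma row_shear_inverse:
  fixes c :: "4 \<Rightarrow> 'a::comm_ring_1"
  assumes "c a = 0" shows "row_shear a c ** row_shear a (\<lambda>i. - c i) = mat 1"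
proof -
  let ?X = "\<lambda>c. (\<chi> i j. if i = a then c j else 0) :: 'a^4^4"
  have "?X c ** ?X (\<lambda>i. - c i) = 0" "?X c + ?X (\<lambda>i. - c i) = 0"
    using assms by (auto simp: vec_eq_iff matrix_matrix_mult_def intro!: sum.neutral)
  then show ?thesis
    by (simp add: row_shear_def matrix_add_ldistrib matrix_add_rdistrib add.assoc)
qed

lemma column_shear_SL4: "c b = 0 \<Longrightarrow> column_shear b c \<in> SL4"
  using exhaust_4[of b] by (auto simp: SL4_def det_4 column_shear_def mat_def)

lemma row_shear_SL4: "c a = 0 \<Longrightarrow> row_shear a c \<in> SL4"
  using exhaust_4[of a] by (auto simp: SL4_def det_4 row_shear_def mat_def)

lemma rat_matrix_column_shear:
  "rat_matrix (column_shear b c) = column_shear b (\<lambda>i. adele_of_rat (c i))"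
  by (simp add: vec_eq_iff column_shear_def mat_def adele_of_rat_add)

lemma rat_matrix_row_shear:
  "rat_matrix (row_shear a c) = row_shear a (\<lambda>i. adele_of_rat (c i))"
  by (simp add: vec_eq_iff row_shear_def mat_def adele_of_rat_add)

text \<open>Write the shear as 1 + X and the unipotent matrix as 1 + Y. Then X Y = 0 because
  \<open>b\<close> is not a row index of the block, and X X = 0, so (1 - X)(1 + Y)(1 + X) = 1 + Y +
  Y X: column \<open>b\<close> receives a combination of the other columns.\<close>

lemma column_shear_conj:
  fixes x :: "4 \<times> 4 \<Rightarrow> 'a::comm_ring_1"
  assumes RC: "R \<inter> C = {}" and b: "b \<in> C" and c: "\<And>i. i \<notin> C - {b} \<Longrightarrow> c i = 0"
  shows "column_shear b (\<lambda>i. - c i) ** unip_matrix (R \<times> C) x ** column_shear b c =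
    unip_matrix (R \<times> C) (\<lambda>t. if t \<in> R \<times> {b} then x t + (\<Sum>j\<in>C - {b}. c j * x (fst t, j)) else x t)"
    (is "_ = unip_matrix _ ?Lx")
proof -
  let ?X = "\<lambda>c. (\<chi> i j. if j = b then c i else 0) :: 'a^4^4"
  let ?Y = "block_matrix R C x"
  have "b \<notin> R" using RC b by auto
  then have XY: "?X (\<lambda>i. - c i) ** ?Y = 0"
    by (auto simp: vec_eq_iff matrix_matrix_mult_def block_matrix_def intro!: sum.neutral)
  have XX: "?X (\<lambda>i. - c i) ** ?X c = 0" "?X (\<lambda>i. - c i) + ?X c = 0"
    using c[of b] by (auto simp: vec_eq_iff matrix_matrix_mult_def intro!: sum.neutral)
  have YX: "?Y + ?Y ** ?X c = block_matrix R C ?Lx"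
  proof -
    have "(?Y ** ?X c) $ i $ j = (if i \<in> R \<and> j = b then (\<Sum>j\<in>C - {b}. c j * x (i, j)) else 0)" for i j
    proof -
      have "(?Y ** ?X c) $ i $ j = (if j = b then \<Sum>k\<in>UNIV. ?Y $ i $ k * c k else 0)"
        by (simp add: matrix_matrix_mult_def)
      also have "(\<Sum>k\<in>UNIV. ?Y $ i $ k * c k) = (\<Sum>k\<in>C - {b}. ?Y $ i $ k * c k)"
        by (rule sum.mono_neutral_right) (auto simp: c)
      also have "\<dots> = (if i \<in> R then (\<Sum>j\<in>C - {b}. c j * x (i, j)) else 0)"
        by (auto simp: block_matrix_def mult.commute intro!: sum.cong)
      finally show ?thesis by simp
    qed
    then show ?thesis using b by (simp add: vec_eq_iff block_matrix_def)
  qed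
  have "column_shear b (\<lambda>i. - c i) ** unip_matrix (R \<times> C) x = mat 1 + ?Y + ?X (\<lambda>i. - c i)"
    unfolding column_shear_def unip_matrix_eq_block[OF RC] matrix_add_ldistrib matrix_add_rdistrib XY
    by (simp add: add.assoc add.commute)
  then have "column_shear b (\<lambda>i. - c i) ** unip_matrix (R \<times> C) x ** column_shear b c =
     mat 1 + ?Y + ?X (\<lambda>i. - c i) + (?X c + ?Y ** ?X c + ?X (\<lambda>i. - c i) ** ?X c)"
    unfolding column_shear_def by (simp only: matrix_add_ldistrib matrix_add_rdistrib matrix_mul_lid matrix_mul_rid)
  also have "\<dots> = mat 1 + (?Y + ?Y ** ?X c) + (?X (\<lambda>i. - c i) + ?X c)"
    unfolding XX(1) by (simp only: add_0_right add_0_left add.assoc add.commute add.left_commute)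
  finally show ?thesis unfolding XX(2) YX by (simp add: unip_matrix_eq_block[OF RC])
qed

text \<open>Here Y X = 0 because \<open>a\<close> is not a column index, and the surviving term is -
  X Y. The minus sign comes from the inverse standing on the left.\<close>

lemma row_shear_conj:
  fixes x :: "4 \<times> 4 \<Rightarrow> 'a::comm_ring_1"
  assumes RC: "R \<inter> C = {}" and a: "a \<in> R" and c: "\<And>i. i \<notin> R - {a} \<Longrightarrow> c i = 0"
  shows "row_shear a (\<lambda>i. - c i) ** unip_matrix (R \<times> C) x ** row_shear a c =
    unip_matrix (R \<times> C) (\<lambda>t. if t \<in> {a} \<times> C then x t + (\<Sum>i\<in>R - {a}. - c i * x (i, snd t)) else x t)"
    (is "_ = unip_matrix _ ?Lx")
proof -
  let ?X = "\<lambda>c. (\<chi> i j. if i = a then c j else 0) :: 'a^4^4"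
  let ?Y = "block_matrix R C x"
  have "a \<notin> C" using RC a by auto
  then have YX: "?Y ** ?X c = 0"
    by (auto simp: vec_eq_iff matrix_matrix_mult_def block_matrix_def intro!: sum.neutral)
  have XX: "?X (\<lambda>i. - c i) ** ?X c = 0" "?X (\<lambda>i. - c i) + ?X c = 0"
    using c[of a] by (auto simp: vec_eq_iff matrix_matrix_mult_def intro!: sum.neutral)
  have XYX: "?X (\<lambda>i. - c i) ** ?Y ** ?X c = 0"
    unfolding matrix_mul_assoc[symmetric] YX by (simp add: vec_eq_iff matrix_matrix_mult_def)
  have XY: "?Y + ?X (\<lambda>i. - c i) ** ?Y = block_matrix R C ?Lx"
  proof -
    have "(?X (\<lambda>i. - c i) ** ?Y) $ i $ j = (if i = a \<and> j \<in> C then (\<Sum>i\<in>R - {a}. - c i * x (i, j)) else 0)" for i j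
    proof -
      have "(?X (\<lambda>i. - c i) ** ?Y) $ i $ j = (if i = a then \<Sum>k\<in>UNIV. - c k * ?Y $ k $ j else 0)"
        by (simp add: matrix_matrix_mult_def)
      also have "(\<Sum>k\<in>UNIV. - c k * ?Y $ k $ j) = (\<Sum>k\<in>R - {a}. - c k * ?Y $ k $ j)"
        by (rule sum.mono_neutral_right) (auto simp: c)
      also have "\<dots> = (if j \<in> C then (\<Sum>i\<in>R - {a}. - c i * x (i, j)) else 0)"
        by (auto simp: block_matrix_def intro!: sum.cong)
      finally show ?thesis by simp
    qed
    then show ?thesis using a by (simp add: vec_eq_iff block_matrix_def)
  qed
  have "row_shear a (\<lambda>i. - c i) ** unip_matrix (R \<times> C) x = mat 1 + ?Y + (?X (\<lambda>i. - c i) + ?X (\<lambda>i. - c i) ** ?Y)"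
    unfolding row_shear_def unip_matrix_eq_block[OF RC]
    by (simp only: matrix_add_ldistrib matrix_add_rdistrib matrix_mul_lid matrix_mul_rid add.assoc add.commute add.left_commute)
  then have "row_shear a (\<lambda>i. - c i) ** unip_matrix (R \<times> C) x ** row_shear a c =
     mat 1 + ?Y + (?X (\<lambda>i. - c i) + ?X (\<lambda>i. - c i) ** ?Y) +
       (?X c + ?Y ** ?X c + (?X (\<lambda>i. - c i) ** ?X c + ?X (\<lambda>i. - c i) ** ?Y ** ?X c))"
    unfolding row_shear_def by (simp only: matrix_add_ldistrib matrix_add_rdistrib matrix_mul_lid matrix_mul_rid)
  also have "\<dots> = mat 1 + (?Y + ?X (\<lambda>i. - c i) ** ?Y) + (?X (\<lambda>i. - c i) + ?X c)"
    unfolding XX(1) YX XYX by (simp only: add_0_right add_0_left add.assoc add.commute add.left_commute)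
  finally show ?thesis unfolding XX(2) XY by (simp add: unip_matrix_eq_block[OF RC])
qed

lemma measurable_adele_mult_const: "(\<lambda>x::adele. a * x) \<in> borel \<rightarrow>\<^sub>M borel"
  using borel_measurable_continuous_onI[OF continuous_on_adele_mult_const[OF continuous_on_id], of a]
  by (simp add: mult.commute)

section \<open>Rational conjugations that preserve the integral\<close>

locale maximal_parabolic = normalized_haar +
  fixes R C :: "4 set"
  assumes RC: "R \<inter> C = {}" and upper: "R \<times> C \<subseteq> {(1,2), (1,3), (1,4), (2,3), (2,4), (3,4)}"
    and one_in_R: "1 \<in> R" and four_in_C: "4 \<in> C"
begin

abbreviation U :: "(4 \<times> 4 \<Rightarrow> 'a) \<Rightarrow> ('a::zero_neq_one)^4^4" where
  "U \<equiv> unip_matrix (R \<times> C)"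

text \<open>The integrands to which the shear invariance applies. Only values on the unipotent group
  matter, and the bound is uniform in all adelic coordinates, not just on the fundamental
  domain.\<close>

definition periodic :: "(adele^4^4 \<Rightarrow> complex) \<Rightarrow> bool" where
  "periodic h \<longleftrightarrow> (\<lambda>x. h (U x)) \<in> borel_measurable (PiM (R \<times> C) (\<lambda>_. borel)) \<and>
     (\<exists>K. \<forall>x. norm (h (U x)) \<le> K) \<and>
     (\<forall>x r. h (U (\<lambda>t. x t + adele_of_rat (r t))) = h (U x))"

text \<open>The intended \<open>l\<close> lie in the Levi subgroup, and \<open>k\<close> is the inverse of \<open>l\<close>.\<close>

definition admissible :: "rat^4^4 \<Rightarrow> rat^4^4 \<Rightarrow> bool" where
  "admissible l k \<longleftrightarrow> l \<in> SL4 \<and> l ** k = mat 1 \<and> k ** l = mat 1 \<and>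
     (\<forall>x. \<exists>y. rat_matrix k ** U x ** rat_matrix l = U y) \<and>
     (\<forall>h. periodic h \<longrightarrow> periodic (\<lambda>u. h (rat_matrix k ** u ** rat_matrix l)) \<and>
        unip_integral dx (R \<times> C) (\<lambda>u. h (rat_matrix k ** u ** rat_matrix l)) = unip_integral dx (R \<times> C) h)"

text \<open>Admissibility includes preservation of \<open>periodic\<close> exactly so that a second
  conjugation can be applied to the result of the first.\<close>

lemma admissible_mult:
  assumes "admissible l1 k1" "admissible l2 k2"
  shows "admissible (l2 ** l1) (k1 ** k2)"
  unfolding admissible_def
proof (intro conjI allI impI)
  show "l2 ** l1 \<in> SL4" using assms by (simp add: admissible_def SL4_mult)
  have "l2 ** l1 ** (k1 ** k2) = l2 ** (l1 ** k1) ** k2" "k1 ** k2 ** (l2 ** l1) = k1 ** (k2 ** l2) ** l1"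
    by (simp_all only: matrix_mul_assoc)
  then show "l2 ** l1 ** (k1 ** k2) = mat 1" "k1 ** k2 ** (l2 ** l1) = mat 1"
    using assms by (simp_all add: admissible_def)
  have conj: "rat_matrix (k1 ** k2) ** u ** rat_matrix (l2 ** l1) =
      rat_matrix k1 ** (rat_matrix k2 ** u ** rat_matrix l2) ** rat_matrix l1" for u
    by (simp only: rat_matrix_mult matrix_mul_assoc)
  show "\<exists>y. rat_matrix (k1 ** k2) ** U x ** rat_matrix (l2 ** l1) = U y" for x
    unfolding conj using assms unfolding admissible_def by metis
  fix h assume h: "periodic h"
  define h1 where "h1 u = h (rat_matrix k1 ** u ** rat_matrix l1)" for u
  have h1: "periodic h1" "unip_integral dx (R \<times> C) h1 = unip_integral dx (R \<times> C) h"
    using assms(1) h unfolding admissible_def h1_def by blast+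
  have "periodic (\<lambda>u. h1 (rat_matrix k2 ** u ** rat_matrix l2))"
    "unip_integral dx (R \<times> C) (\<lambda>u. h1 (rat_matrix k2 ** u ** rat_matrix l2)) = unip_integral dx (R \<times> C) h1"
    using assms(2) h1(1) unfolding admissible_def by blast+
  then show "periodic (\<lambda>u. h (rat_matrix (k1 ** k2) ** u ** rat_matrix (l2 ** l1)))"
    "unip_integral dx (R \<times> C) (\<lambda>u. h (rat_matrix (k1 ** k2) ** u ** rat_matrix (l2 ** l1))) =
      unip_integral dx (R \<times> C) h"
    using h1(2) unfolding conj h1_def by simp_all
qed

lemma admissible_1: "admissible (mat 1) (mat 1)"
  by (auto simp: admissible_def SL4_def)

text \<open>The conjugation is triangular: coordinates in \<open>B\<close> are shifted by
  combinations of coordinates outside \<open>B\<close>. Rational coefficients send rational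
  translations to rational translations, which preserves periodicity, and the shear lemma preserves
  the integral.\<close>

lemma admissible_shear:
  assumes l: "l \<in> SL4" "l ** k = mat 1" "k ** l = mat 1" and B: "B \<subseteq> R \<times> C"
    and conj: "\<And>x. rat_matrix k ** U x ** rat_matrix l =
      U (\<lambda>t. if t \<in> B then x t + (\<Sum>s\<in>R \<times> C - B. adele_of_rat (\<omega> t s) * x s) else x t)"
  shows "admissible l k"
proof -
  define \<tau> where "\<tau> t x = (\<Sum>s\<in>R \<times> C - B. adele_of_rat (\<omega> t s) * x s)" for t x
  define L where "L x = (\<lambda>t. if t \<in> B then x t + \<tau> t x else x t)" for x
  have conj: "rat_matrix k ** U x ** rat_matrix l = U (L x)" for x
    unfolding conj L_def \<tau>_def ..
  have m\<tau>: "\<tau> t \<in> borel_measurable (PiM (R \<times> C) (\<lambda>_. borel))" for t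
    unfolding \<tau>_def
  proof (intro borel_measurable_sum)
    fix s assume "s \<in> R \<times> C - B"
    then have "(\<lambda>x. x s) \<in> PiM (R \<times> C) (\<lambda>_. borel :: adele measure) \<rightarrow>\<^sub>M borel"
      by (intro measurable_component_singleton) auto
    then show "(\<lambda>x. adele_of_rat (\<omega> t s) * x s) \<in> borel_measurable (PiM (R \<times> C) (\<lambda>_. borel))"
      by (rule measurable_compose[OF _ measurable_adele_mult_const])
  qed
  have mL: "L \<in> PiM (R \<times> C) (\<lambda>_. borel) \<rightarrow>\<^sub>M PiM (R \<times> C) (\<lambda>_. borel)"
    unfolding L_def using B m\<tau> by (intro measurable_shear) auto
  have \<tau>_upd: "\<tau> t (x(s := y)) = \<tau> t x" if "s \<in> B" for s t x y
    unfolding \<tau>_def using that by (intro sum.cong) auto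
  have L_rat: "L (\<lambda>t. x t + adele_of_rat (r t)) =
      (\<lambda>t. L x t + adele_of_rat (if t \<in> B then r t + (\<Sum>s\<in>R \<times> C - B. \<omega> t s * r s) else r t))" for x r
    by (auto simp: L_def \<tau>_def adele_of_rat_add adele_of_rat_sum adele_of_rat_mult distrib_left sum.distrib)
  have "periodic (\<lambda>u. h (rat_matrix k ** u ** rat_matrix l)) \<and>
      unip_integral dx (R \<times> C) (\<lambda>u. h (rat_matrix k ** u ** rat_matrix l)) = unip_integral dx (R \<times> C) h"
    if h: "periodic h" for h
  proof
    from h have mh: "(\<lambda>x. h (U x)) \<in> borel_measurable (PiM (R \<times> C) (\<lambda>_. borel))"
      and per: "\<And>x r. h (U (\<lambda>t. x t + adele_of_rat (r t))) = h (U x)"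
      unfolding periodic_def by auto
    obtain K where K: "\<And>x. norm (h (U x)) \<le> K" using h unfolding periodic_def by blast
    show "periodic (\<lambda>u. h (rat_matrix k ** u ** rat_matrix l))"
      unfolding periodic_def conj L_rat
      by (intro conjI exI[of _ K] allI measurable_compose[OF mL mh] K per)
    have "(\<integral>x. h (U (L x)) \<partial>PiM (R \<times> C) (\<lambda>_. \<mu>)) = (\<integral>x. h (U x) \<partial>PiM (R \<times> C) (\<lambda>_. \<mu>))"
      unfolding L_def
    proof (rule integral_PiM_quot_shear[where f = "\<lambda>x. h (U x)"])
      fix x :: "4 \<times> 4 \<Rightarrow> adele" and t q
      have "x(t := x t + adele_of_rat q) = (\<lambda>s. x s + adele_of_rat (if s = t then q else 0))" by auto
      then show "h (U (x(t := x t + adele_of_rat q))) = h (U x)" using per by simp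
    qed (use B mh K m\<tau> \<tau>_upd in auto)
    then show "unip_integral dx (R \<times> C) (\<lambda>u. h (rat_matrix k ** u ** rat_matrix l)) = unip_integral dx (R \<times> C) h"
      by (simp add: unip_integral_def conj)
  qed
  then show ?thesis using l conj unfolding admissible_def by blast
qed

lemma admissible_column_shear:
  assumes b: "b \<in> C" and c: "\<And>i. i \<notin> C - {b} \<Longrightarrow> c i = 0"
  shows "admissible (column_shear b c) (column_shear b (\<lambda>i. - c i))"
\<comment> \<open>Coefficients are nonzero only between entries of the same row, so the sum over the
  rectangle collapses to a sum along one row.\<close>
proof (rule admissible_shear[where B = "R \<times> {b}" and \<omega> = "\<lambda>t s. if fst s = fst t then c (snd s) else 0"])
  have cb: "c b = 0" using c by simp
  show "column_shear b c \<in> SL4" using cb by (rule column_shear_SL4)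
  show "column_shear b c ** column_shear b (\<lambda>i. - c i) = mat 1" using cb by (rule column_shear_inverse)
  show "column_shear b (\<lambda>i. - c i) ** column_shear b c = mat 1"
    using column_shear_inverse[of "\<lambda>i. - c i" b] cb by simp
  have "(\<Sum>s\<in>R \<times> C - R \<times> {b}. adele_of_rat (if fst s = i then c (snd s) else 0) * x s) =
      (\<Sum>j\<in>C - {b}. adele_of_rat (c j) * x (i, j))" if "i \<in> R" for i and x :: "4 \<times> 4 \<Rightarrow> adele"
  proof -
    have RCb: "R \<times> C - R \<times> {b} = R \<times> (C - {b})" by auto
    have inner: "(\<Sum>j\<in>C - {b}. adele_of_rat (if i' = i then c j else 0) * x (i', j)) =
        (if i' = i then \<Sum>j\<in>C - {b}. adele_of_rat (c j) * x (i, j) else 0)" for i'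
      by simp
    show ?thesis
      unfolding RCb sum.cartesian_product' fst_conv snd_conv inner using that by simp
  qed
  then have "(\<lambda>t. if t \<in> R \<times> {b} then x t + (\<Sum>s\<in>R \<times> C - R \<times> {b}. adele_of_rat (if fst s = fst t then c (snd s) else 0) * x s) else x t) =
      (\<lambda>t. if t \<in> R \<times> {b} then x t + (\<Sum>j\<in>C - {b}. adele_of_rat (c j) * x (fst t, j)) else x t)" for x :: "4 \<times> 4 \<Rightarrow> adele"
    by (intro ext) auto
  then show "rat_matrix (column_shear b (\<lambda>i. - c i)) ** U x ** rat_matrix (column_shear b c) =
      U (\<lambda>t. if t \<in> R \<times> {b} then x t + (\<Sum>s\<in>R \<times> C - R \<times> {b}. adele_of_rat (if fst s = fst t then c (snd s) else 0) * x s) else x t)" for x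
    using column_shear_conj[OF RC b, of "\<lambda>i. adele_of_rat (c i)" x] c
    by (simp add: rat_matrix_column_shear adele_of_rat_minus)
qed (use b in auto)

lemma admissible_row_shear:
  assumes a: "a \<in> R" and c: "\<And>i. i \<notin> R - {a} \<Longrightarrow> c i = 0"
  shows "admissible (row_shear a c) (row_shear a (\<lambda>i. - c i))"
proof (rule admissible_shear[where B = "{a} \<times> C" and \<omega> = "\<lambda>t s. if snd s = snd t then - c (fst s) else 0"])
  have ca: "c a = 0" using c by simp
  show "row_shear a c \<in> SL4" using ca by (rule row_shear_SL4)
  show "row_shear a c ** row_shear a (\<lambda>i. - c i) = mat 1" using ca by (rule row_shear_inverse)
  show "row_shear a (\<lambda>i. - c i) ** row_shear a c = mat 1"
    using row_shear_inverse[of "\<lambda>i. - c i" a] ca by simp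
  have "(\<Sum>s\<in>R \<times> C - {a} \<times> C. adele_of_rat (if snd s = j then - c (fst s) else 0) * x s) =
      (\<Sum>i\<in>R - {a}. - adele_of_rat (c i) * x (i, j))" if "j \<in> C" for j and x :: "4 \<times> 4 \<Rightarrow> adele"
  proof -
    have RCa: "R \<times> C - {a} \<times> C = (R - {a}) \<times> C" by auto
    have inner: "adele_of_rat (if j' = j then - c i else 0) * x (i, j') =
        (if j' = j then - adele_of_rat (c i) * x (i, j) else 0)" for i j'
      by (simp add: adele_of_rat_minus)
    show ?thesis
      unfolding RCa sum.cartesian_product' fst_conv snd_conv inner using that by simp
  qed
  then have "(\<lambda>t. if t \<in> {a} \<times> C then x t + (\<Sum>s\<in>R \<times> C - {a} \<times> C. adele_of_rat (if snd s = snd t then - c (fst s) else 0) * x s) else x t) =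
      (\<lambda>t. if t \<in> {a} \<times> C then x t + (\<Sum>i\<in>R - {a}. - adele_of_rat (c i) * x (i, snd t)) else x t)" for x :: "4 \<times> 4 \<Rightarrow> adele"
    by (intro ext) auto
  then show "rat_matrix (row_shear a (\<lambda>i. - c i)) ** U x ** rat_matrix (row_shear a c) =
      U (\<lambda>t. if t \<in> {a} \<times> C then x t + (\<Sum>s\<in>R \<times> C - {a} \<times> C. adele_of_rat (if snd s = snd t then - c (fst s) else 0) * x s) else x t)" for x
    using row_shear_conj[OF RC a, of "\<lambda>i. adele_of_rat (c i)" x] c
    by (simp add: rat_matrix_row_shear adele_of_rat_minus)
qed (use a in auto)

end

section \<open>Reduction of a rank-one block to the position (1, 4)\<close>

lemma column_shear_mult_vec:
  "column_shear b c *v (w::'a::comm_ring_1^4) = (\<chi> i. w $ i + c i * w $ b)"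
proof -
  have "(\<Sum>j\<in>UNIV. (if j = b then c i else 0) * w $ j) = c i * w $ b" for i
    by (simp add: if_distrib[of "\<lambda>z. z * _"] cong: if_cong)
  then show ?thesis
    by (simp add: column_shear_def matrix_vector_mult_add_rdistrib vec_eq_iff)
      (simp add: matrix_vector_mult_def)
qed

lemma transpose_column_shear_mult_vec:
  "transpose (column_shear b c) *v (v::'a::comm_ring_1^4) =
    (\<chi> i. v $ i + (if i = b then \<Sum>j\<in>UNIV. c j * v $ j else 0))"
proof -
  have "transpose (column_shear b c) = mat 1 + (\<chi> i j. if i = b then c j else 0)"
    by (auto simp: vec_eq_iff column_shear_def transpose_def mat_def)
  then show ?thesis
    by (simp only: matrix_vector_mult_add_rdistrib matrix_vector_mul_lid)
      (simp add: matrix_vector_mult_def vec_eq_iff)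
qed

lemma transpose_row_shear: "transpose (row_shear a c) = column_shear a c"
  by (auto simp: vec_eq_iff row_shear_def column_shear_def transpose_def mat_def)

lemma row_shear_mult_vec:
  "row_shear a c *v (w::'a::comm_ring_1^4) =
    (\<chi> i. w $ i + (if i = a then \<Sum>j\<in>UNIV. c j * w $ j else 0))"
  using transpose_column_shear_mult_vec[of a c w] by (simp flip: transpose_row_shear)

context maximal_parabolic
begin

text \<open>Gaussian elimination by column shears: make the fourth entry nonzero, then use it to
  clear the rest. The last clause keeps the row vector out of it: the transposed shear changes
  \<open>v\<close> only through entries indexed by \<open>C\<close>, where a vector supported on
  \<open>R\<close> vanishes.\<close>

lemma column_reduction:
  assumes w: "w \<noteq> 0" "\<And>j. j \<notin> C \<Longrightarrow> w $ j = 0"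
  obtains l k q where "admissible l k" "q \<noteq> 0" "l *v w = q *s axis 4 1"
    "\<And>v. (\<And>i. i \<notin> R \<Longrightarrow> v $ i = 0) \<Longrightarrow> transpose l *v v = v"
proof -
  define fixing where "fixing l \<longleftrightarrow> (\<forall>v::rat^4. (\<forall>i. i \<notin> R \<longrightarrow> v $ i = 0) \<longrightarrow> transpose l *v v = v)" for l
  have fix_shear: "fixing (column_shear b c)" if "\<And>i. i \<notin> C - {b} \<Longrightarrow> c i = 0" for b c
  proof -
    have "(\<Sum>j\<in>UNIV. c j * v $ j) = 0" if "\<forall>i. i \<notin> R \<longrightarrow> v $ i = 0" for v :: "rat^4"
      using that \<open>\<And>i. i \<notin> C - {b} \<Longrightarrow> c i = 0\<close> RC by (intro sum.neutral) fastforce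
    then show ?thesis unfolding fixing_def transpose_column_shear_mult_vec by (simp add: vec_eq_iff)
  qed
  obtain l1 k1 where l1: "admissible l1 k1" "fixing l1" "(l1 *v w) $ 4 \<noteq> 0"
    "\<And>j. j \<notin> C \<Longrightarrow> (l1 *v w) $ j = 0"
  proof (cases "w $ 4 = 0")
    case True
    obtain b where b: "w $ b \<noteq> 0" using w(1) by (auto simp: vec_eq_iff)
    then have bC: "b \<in> C" "b \<noteq> 4" using w(2) True by auto
    \<comment> \<open>This adds the nonzero entry \<open>w $ b\<close> to the vanishing fourth
      entry.\<close>
    let ?c = "\<lambda>i. if i = 4 then 1 else 0 :: rat"
    have c: "?c i = 0" if "i \<notin> C - {b}" for i using that bC four_in_C by auto
    show ?thesis
      by (rule that[OF admissible_column_shear[OF bC(1) c] fix_shear[OF c]])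
        (use True b w(2) four_in_C in \<open>auto simp: column_shear_mult_vec\<close>)
  next
    case False
    show ?thesis
      by (rule that[OF admissible_1]) (use False w(2) in \<open>auto simp: fixing_def\<close>)
  qed
  define w' where "w' = l1 *v w"
  let ?c = "\<lambda>i. if i = 4 then 0 else - w' $ i / w' $ 4"
  have c: "?c i = 0" if "i \<notin> C - {4}" for i using that l1(4) by (auto simp: w'_def)
  have adm: "admissible (column_shear 4 ?c) (column_shear 4 (\<lambda>i. - ?c i))"
    using c by (intro admissible_column_shear four_in_C)
  show ?thesis
  proof (rule that)
    show "admissible (column_shear 4 ?c ** l1) (k1 ** column_shear 4 (\<lambda>i. - ?c i))"
      using l1(1) adm by (rule admissible_mult)
    show "w' $ 4 \<noteq> 0" using l1(3) by (simp add: w'_def)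
    then show "column_shear 4 ?c ** l1 *v w = w' $ 4 *s axis 4 1"
      by (simp add: matrix_vector_mul_assoc[symmetric] flip: w'_def)
        (simp add: column_shear_mult_vec vec_eq_iff axis_def)
    show "transpose (column_shear 4 ?c ** l1) *v v = v" if "\<And>i. i \<notin> R \<Longrightarrow> v $ i = 0" for v
      using l1(2) fix_shear[OF c] that
      by (simp add: matrix_transpose_mul matrix_vector_mul_assoc[symmetric] fixing_def)
  qed
qed

text \<open>The mirror image for rows, but with \<open>v\<close> written as the image of the reduced
  vector. The elimination coefficients therefore describe how to rebuild \<open>v\<close> from a
  multiple of the first unit vector.\<close>

lemma row_reduction:
  assumes v: "v \<noteq> 0" "\<And>i. i \<notin> R \<Longrightarrow> v $ i = 0"
  obtains l k p where "admissible l k" "p \<noteq> 0" "v = transpose l *v (p *s axis 1 1)"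
    "\<And>w. (\<And>j. j \<notin> C \<Longrightarrow> w $ j = 0) \<Longrightarrow> l *v w = w"
proof -
  define fixing where "fixing l \<longleftrightarrow> (\<forall>w::rat^4. (\<forall>j. j \<notin> C \<longrightarrow> w $ j = 0) \<longrightarrow> l *v w = w)" for l
  have fix_shear: "fixing (row_shear a c)" if "\<And>i. i \<notin> R - {a} \<Longrightarrow> c i = 0" for a c
  proof -
    have "(\<Sum>j\<in>UNIV. c j * w $ j) = 0" if "\<forall>i. i \<notin> C \<longrightarrow> w $ i = 0" for w :: "rat^4"
      using that \<open>\<And>i. i \<notin> R - {a} \<Longrightarrow> c i = 0\<close> RC by (intro sum.neutral) fastforce
    then show ?thesis unfolding fixing_def row_shear_mult_vec by (simp add: vec_eq_iff)
  qed
  obtain l1 k1 v' where l1: "admissible l1 k1" "fixing l1" "v = transpose l1 *v v'" "v' $ 1 \<noteq> 0"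
    "\<And>j. j \<notin> R \<Longrightarrow> v' $ j = 0"
  proof (cases "v $ 1 = 0")
    case True
    obtain b where b: "v $ b \<noteq> 0" using v(1) by (auto simp: vec_eq_iff)
    then have bR: "b \<in> R" "b \<noteq> 1" using v(2) True by auto
    \<comment> \<open>The sign makes the first entry of the reduced vector equal to
      \<open>v $ b\<close>; the transposed shear subtracts it again to recover
      \<open>v\<close>.\<close>
    let ?c = "\<lambda>i. if i = 1 then - 1 else 0 :: rat"
    have c: "?c i = 0" if "i \<notin> R - {b}" for i using that bR one_in_R by auto
    show ?thesis
    proof (rule that[of "row_shear b ?c" "row_shear b (\<lambda>i. - ?c i)" "\<chi> i. v $ i - ?c i * v $ b",
          OF admissible_row_shear[OF bR(1) c] fix_shear[OF c]])
      show "v = transpose (row_shear b ?c) *v (\<chi> i. v $ i - ?c i * v $ b)"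
        using bR by (simp add: transpose_row_shear column_shear_mult_vec vec_eq_iff)
    qed (use True b v(2) one_in_R in auto)
  next
    case False
    show ?thesis
      by (rule that[of "mat 1" "mat 1" v, OF admissible_1]) (use False v(2) in \<open>auto simp: fixing_def\<close>)
  qed
  let ?c = "\<lambda>i. if i = 1 then 0 else v' $ i / v' $ 1"
  have c: "?c i = 0" if "i \<notin> R - {1}" for i using that l1(5) by auto
  have adm: "admissible (row_shear 1 ?c) (row_shear 1 (\<lambda>i. - ?c i))"
    using c by (intro admissible_row_shear one_in_R)
  have v': "v' = transpose (row_shear 1 ?c) *v (v' $ 1 *s axis 1 1)"
    using l1(4) by (simp add: transpose_row_shear column_shear_mult_vec vec_eq_iff axis_def)
  show ?thesis
  proof (rule that)
    show "admissible (row_shear 1 ?c ** l1) (k1 ** row_shear 1 (\<lambda>i. - ?c i))"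
      using l1(1) adm by (rule admissible_mult)
    show "v' $ 1 \<noteq> 0" by (rule l1(4))
    show "v = transpose (row_shear 1 ?c ** l1) *v (v' $ 1 *s axis 1 1)"
      unfolding matrix_transpose_mul matrix_vector_mul_assoc[symmetric] v'[symmetric] by (rule l1(3))
    show "row_shear 1 ?c ** l1 *v w = w" if "\<And>j. j \<notin> C \<Longrightarrow> w $ j = 0" for w
      using l1(2) fix_shear[OF c] that
      by (simp add: matrix_vector_mul_assoc[symmetric] fixing_def)
  qed
qed

text \<open>The two eliminations do not interfere: the transpose of \<open>l1\<close> fixes
  \<open>v\<close>, and \<open>l2\<close> fixes multiples of the fourth unit vector, which is
  supported on \<open>C\<close>.\<close>

lemma rank_one_reduction:
  assumes v: "v \<noteq> 0" "\<And>i. i \<notin> R \<Longrightarrow> v $ i = 0" and w: "w \<noteq> 0" "\<And>j. j \<notin> C \<Longrightarrow> w $ j = 0"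
  obtains l k p q where "admissible l k" "p \<noteq> 0" "q \<noteq> 0"
    "v = transpose l *v (p *s axis 1 1)" "l *v w = q *s axis 4 1"
proof -
  obtain l1 k1 q where l1: "admissible l1 k1" "q \<noteq> 0" "l1 *v w = q *s axis 4 1"
    "\<And>v. (\<And>i. i \<notin> R \<Longrightarrow> v $ i = 0) \<Longrightarrow> transpose l1 *v v = v"
    using column_reduction[OF w] by blast
  obtain l2 k2 p where l2: "admissible l2 k2" "p \<noteq> 0" "v = transpose l2 *v (p *s axis 1 1)"
    "\<And>w. (\<And>j. j \<notin> C \<Longrightarrow> w $ j = 0) \<Longrightarrow> l2 *v w = w"
    using row_reduction[OF v] by blast
  show ?thesis
  proof (rule that[OF admissible_mult[OF l1(1) l2(1)] l2(2) l1(2)])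
    show "v = transpose (l2 ** l1) *v (p *s axis 1 1)"
      unfolding matrix_transpose_mul matrix_vector_mul_assoc[symmetric] l2(3)[symmetric]
      using l1(4)[OF v(2)] by simp
    show "l2 ** l1 *v w = q *s axis 4 1"
      unfolding matrix_vector_mul_assoc[symmetric] l1(3)
      using four_in_C by (intro l2(4)) (auto simp: axis_def)
  qed
qed

section \<open>The Fourier integrand and the rational orbit in the rank-one case\<close>

lemma automorphic_form_left_invariant:
  "automorphic_form \<phi> \<Longrightarrow> \<gamma> \<in> SL4 \<Longrightarrow> g \<in> SL4 \<Longrightarrow> \<phi> (rat_matrix \<gamma> ** g) = \<phi> g"
  unfolding automorphic_form_def by (elim conjE) (drule (1) bspec, drule (1) bspec)

lemma U_SL4: "(U x :: 'a::comm_ring_1^4^4) \<in> SL4"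
  using det_unip_matrix[OF upper] by (simp add: SL4_def)

text \<open>Periodicity comes from the left invariance of \<open>\<phi>\<close> and the triviality
  of \<open>\<psi>\<close> on rational points. The growth bound is available for coordinates in the
  fundamental domain, and periodicity extends it to all coordinates.\<close>

lemma periodic_fourier_integrand:
  assumes \<phi>: "automorphic_form \<phi>" and \<alpha>: "root_shape \<alpha> = R \<times> C"
    and \<psi>: "unitary_character \<alpha> \<psi>" and g: "g \<in> SL4"
  shows "periodic (\<lambda>u. \<phi> (u ** g) * cnj (\<psi> u))"
proof -
  have U_grp: "U x \<in> unip_group (root_shape \<alpha>)" "U r \<in> unip_group (root_shape \<alpha>)"
    for x :: "4 \<times> 4 \<Rightarrow> adele" and r :: "4 \<times> 4 \<Rightarrow> rat"
    by (simp_all add: \<alpha> unip_group_def)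
  let ?h = "\<lambda>x. \<phi> (U x ** g) * cnj (\<psi> (U x))"
  have \<phi>_cont: "continuous_on UNIV (\<lambda>x. \<phi> (U x ** g))"
  proof (rule continuous_on_compose2[OF smooth_adelic_continuous_on continuous_on_unip_mult])
    show "smooth_adelic \<phi>" using \<phi> by (simp add: automorphic_form_def)
    show "range (\<lambda>x. U x ** g) \<subseteq> SL4" using SL4_mult[OF U_SL4 g] by blast
  qed
  have "continuous_on UNIV (\<lambda>x. U x ** mat 1 :: adele^4^4)" by (rule continuous_on_unip_mult)
  then have U_cont: "continuous_on UNIV (\<lambda>x. U x :: adele^4^4)" by simp
  have \<psi>_cont: "continuous_on (unip_group (root_shape \<alpha>)) \<psi>" using \<psi> by (simp add: unitary_character_def)
  have "continuous_on UNIV (\<lambda>x. \<psi> (U x))"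
    by (rule continuous_on_compose2[OF \<psi>_cont U_cont]) (simp add: image_subset_iff U_grp)
  then have "continuous_on UNIV ?h" using \<phi>_cont by (intro continuous_on_mult continuous_on_cnj)
  moreover have "?h x = ?h y" if "\<And>t. t \<in> R \<times> C \<Longrightarrow> x t = y t" for x y
  proof -
    have "U x = U y" by (simp add: unip_matrix_def vec_eq_iff that)
    then show ?thesis by simp
  qed
  ultimately have meas: "?h \<in> borel_measurable (PiM (R \<times> C) (\<lambda>_. borel))"
    by (rule measurable_PiM_of_continuous)
  have per: "?h (\<lambda>t. x t + adele_of_rat (r t)) = ?h x" for x r
  proof -
    have eq: "U (\<lambda>t. x t + adele_of_rat (r t)) = rat_matrix (U r) ** U x"
      by (simp add: rat_matrix_unip unip_matrix_mult[OF RC] add.commute)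
    have "\<phi> (rat_matrix (U r) ** (U x ** g)) = \<phi> (U x ** g)"
      by (rule automorphic_form_left_invariant[OF \<phi> U_SL4 SL4_mult[OF U_SL4 g]])
    moreover have "\<psi> (rat_matrix (U r) ** U x) = \<psi> (rat_matrix (U r)) * \<psi> (U x)"
      unfolding rat_matrix_unip
      by (rule \<psi>[unfolded unitary_character_def, THEN conjunct1, rule_format, OF U_grp(1) U_grp(1)])
    moreover have "\<psi> (rat_matrix (U r)) = 1"
      by (rule \<psi>[unfolded unitary_character_def, THEN conjunct2, THEN conjunct2, THEN conjunct2,
            rule_format, OF U_grp(2)])
    ultimately show ?thesis unfolding eq by (simp add: matrix_mul_assoc)
  qed
  obtain K where K: "\<And>x. (\<And>t. x t \<in> adele_fund_domain) \<Longrightarrow> norm (\<phi> (U x ** g)) \<le> K"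
    using automorphic_form_bounded[OF \<phi> g RC upper] by blast
  have "norm (?h x) \<le> K" for x
  proof -
    have "\<exists>r. x t - adele_of_rat r \<in> adele_fund_domain" for t using adele_decompose by blast
    then obtain r where r: "\<And>t. x t - adele_of_rat (r t) \<in> adele_fund_domain" by metis
    define y where "y t = x t - adele_of_rat (r t)" for t
    have "norm (\<psi> (U y)) = 1" using \<psi> U_grp by (simp add: unitary_character_def)
    then have "norm (?h y) \<le> K" using K[of y] r by (simp add: y_def norm_mult)
    moreover have "?h x = ?h y" using per[of y r] by (simp add: y_def)
    ultimately show ?thesis by simp
  qed
  then show ?thesis using meas per unfolding periodic_def by blast
qed

text \<open>The hypotheses say M - 1 = p q l^T E_14 (l^T)^(-1). The diagonal matrix \<open>D\<close>
  absorbs the scalar p q, and its second entry restores determinant 1. This scaling only conjugates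
  a rational matrix; no integration variable is rescaled.\<close>

lemma rank_one_orbit:
  fixes l :: "rat^4^4"
  assumes l: "l \<in> SL4" and pq: "p \<noteq> 0" "q \<noteq> 0" and v: "v = transpose l *v (p *s axis 1 1)"
    and w: "l *v w = q *s axis 4 1" and M: "\<And>i j. M $ i $ j = mat 1 $ i $ j + v $ i * w $ j"
  shows "M \<in> SL4_orbit M_min"
proof -
  define D :: "rat^4^4" where "D = (\<chi> i j. if i = j then (if i = 1 then p * q else if i = 2 then 1 / (p * q) else 1) else 0)"
  have D: "D \<in> SL4" using pq by (simp add: SL4_def det_4 D_def)
  define L where "L = transpose l ** D"
  have "L \<in> SL4" unfolding L_def using l D by (intro SL4_mult) (simp_all add: SL4_def)
  moreover have "L ** M_min = M ** L"
  proof -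
    have v_i: "v $ i = p * l $ 1 $ i" for i
      unfolding v by (simp add: matrix_vector_mult_def transpose_def axis_def if_distrib[of "(*) _"] mult.commute cong: if_cong)
    have w_i: "(\<Sum>j\<in>UNIV. l $ i $ j * w $ j) = (if i = 4 then q else 0)" for i
      using arg_cong[OF w, of "\<lambda>z. z $ i"] by (simp add: matrix_vector_mult_def axis_def)
    have Lij: "L $ i $ j = l $ j $ i * D $ j $ j" for i j
      by (simp add: L_def matrix_matrix_mult_def transpose_def D_def if_distrib[of "(*) _"] cong: if_cong)
    have "(L ** M_min) $ i $ j = L $ i $ j + (if j = 4 then L $ i $ 1 else 0)" for i j
      using exhaust_4[of j] by (auto simp: matrix_matrix_mult_def M_min_def mat_def matrix_unit_def sum_4)
    moreover have "(M ** L) $ i $ j = L $ i $ j + v $ i * (D $ j $ j * (\<Sum>k\<in>UNIV. l $ j $ k * w $ k))" for i j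
    proof -
      have "(M ** L) $ i $ j = (\<Sum>k\<in>UNIV. (if i = k then L $ k $ j else 0) + v $ i * (D $ j $ j * (l $ j $ k * w $ k)))"
        unfolding matrix_matrix_mult_def vec_lambda_beta
        by (intro sum.cong) (simp_all add: M mat_def Lij algebra_simps)
      then show ?thesis by (simp add: sum.distrib sum_distrib_left)
    qed
    ultimately show ?thesis unfolding vec_eq_iff w_i by (simp add: Lij D_def v_i)
  qed
  ultimately show ?thesis unfolding SL4_orbit_iff by blast
qed

end

section \<open>Rank-one Fourier coefficients as integrals of minimal orbit coefficients\<close>

context maximal_parabolic
begin

lemma fourier_coeff_determined_by_min:
  assumes \<phi>: "automorphic_form \<phi>" and \<alpha>: "root_shape \<alpha> = R \<times> C"
    and \<psi>: "unitary_character \<alpha> \<psi>" and char: "character_matrix \<alpha> \<psi> M"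
    and M: "\<And>i j. M $ i $ j = mat 1 $ i $ j + v $ i * w $ j"
    and l: "admissible l k" and pq: "p \<noteq> 0" "q \<noteq> 0"
    and v: "v = transpose l *v (p *s axis 1 1)" and w: "l *v w = q *s axis 4 1"
  shows "determined_by dx (orbit_coeffs_min dx \<phi>) (fourier_coeff dx \<alpha> \<psi> \<phi>)"
proof -
  define m where "m = p * q"
  define S where "S = R \<times> C - {(1, 4)}"
  let ?A = "rat_matrix l"
  have l_SL4: "l \<in> SL4" and kl: "l ** k = mat 1" "k ** l = mat 1"
    using l by (simp_all add: admissible_def)
  have k_SL4: "k \<in> SL4"
    using l_SL4 det_mul[of k l] kl(2) by (simp add: SL4_def)
  have RC_S: "R \<times> C = insert (1, 4) S" "(1, 4) \<notin> S" "finite S"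
    using one_in_R four_in_C by (auto simp: S_def)
  \<comment> \<open>After conjugation the character sees one coordinate. With A the adelic image of
    \<open>l\<close> and X, Y the blocks of \<open>x\<close>, \<open>y\<close>, the relation A Y = X
    A moves A past the block: v^T Y w = p e_1^T A Y w = p e_1^T X A w = p q x_14.\<close>
  have \<psi>_conj: "\<psi> (rat_matrix k ** U x ** ?A) = adele_char (adele_of_rat m * x (1, 4))" for x
  proof -
    obtain y where y: "rat_matrix k ** U x ** ?A = U y" using l unfolding admissible_def by blast
    let ?X = "block_matrix R C x" and ?Y = "block_matrix R C y"
    have "?A ** U y = rat_matrix (l ** k) ** U x ** ?A"
      unfolding y[symmetric] by (simp only: rat_matrix_mult matrix_mul_assoc)
    then have "?A ** U y = U x ** ?A" by (simp add: kl)
    then have AY: "?A ** ?Y = ?X ** ?A"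
      by (simp add: unip_matrix_eq_block[OF RC] matrix_add_ldistrib matrix_add_rdistrib)
    have v_i: "adele_of_rat (v $ i) = adele_of_rat p * ?A $ 1 $ i" for i
      unfolding v by (simp add: matrix_vector_mult_def transpose_def axis_def if_distrib[of "(*) _"]
          mult.commute adele_of_rat_mult[symmetric] cong: if_cong)
    have w_i: "(\<Sum>j\<in>UNIV. ?A $ i $ j * adele_of_rat (w $ j)) = (if i = 4 then adele_of_rat q else 0)" for i
      using arg_cong[OF w, of "\<lambda>z. adele_of_rat (z $ i)"]
      by (simp add: matrix_vector_mult_def axis_def adele_of_rat_sum adele_of_rat_mult)
    have "(\<Sum>(i, j)\<in>R \<times> C. adele_of_rat (M $ i $ j) * U y $ i $ j) =
        (\<Sum>(i, j)\<in>R \<times> C. adele_of_rat (v $ i) * (?Y $ i $ j * adele_of_rat (w $ j)))"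
    proof (intro sum.cong refl, clarify)
      fix i j assume ij: "i \<in> R" "j \<in> C"
      then have "i \<noteq> j" using RC by auto
      then show "adele_of_rat (M $ i $ j) * U y $ i $ j = adele_of_rat (v $ i) * (?Y $ i $ j * adele_of_rat (w $ j))"
        using ij by (simp add: M mat_def unip_matrix_def block_matrix_def adele_of_rat_mult mult_ac)
    qed
    also have "\<dots> = (\<Sum>(i, j)\<in>UNIV. adele_of_rat (v $ i) * (?Y $ i $ j * adele_of_rat (w $ j)))"
      by (rule sum.mono_neutral_left) (auto simp: block_matrix_def split: if_splits)
    also have "\<dots> = (\<Sum>i\<in>UNIV. \<Sum>j\<in>UNIV. adele_of_rat p * (?A $ 1 $ i * ?Y $ i $ j * adele_of_rat (w $ j)))"
      unfolding UNIV_Times_UNIV[symmetric] sum.cartesian_product[symmetric] v_i by (simp only: mult.assoc)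
    also have "\<dots> = adele_of_rat p * (\<Sum>j\<in>UNIV. (?A ** ?Y) $ 1 $ j * adele_of_rat (w $ j))"
      by (subst sum.swap) (simp add: matrix_matrix_mult_def sum_distrib_left sum_distrib_right)
    also have "(\<Sum>j\<in>UNIV. (?A ** ?Y) $ 1 $ j * adele_of_rat (w $ j)) =
        (\<Sum>j\<in>UNIV. \<Sum>i\<in>UNIV. ?X $ 1 $ i * (?A $ i $ j * adele_of_rat (w $ j)))"
      unfolding AY by (simp add: matrix_matrix_mult_def sum_distrib_right mult.assoc)
    also have "\<dots> = (\<Sum>i\<in>UNIV. ?X $ 1 $ i * (\<Sum>j\<in>UNIV. ?A $ i $ j * adele_of_rat (w $ j)))"
      by (subst sum.swap) (simp add: sum_distrib_left)
    also have "\<dots> = ?X $ 1 $ 4 * adele_of_rat q"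
      unfolding w_i by (simp add: if_distrib[of "(*) _"] cong: if_cong)
    also have "?X $ 1 $ 4 = x (1, 4)" using one_in_R four_in_C by (simp add: block_matrix_def)
    finally have "(\<Sum>(i, j)\<in>R \<times> C. adele_of_rat (M $ i $ j) * U y $ i $ j) = adele_of_rat m * x (1, 4)"
      by (simp add: m_def adele_of_rat_mult mult_ac)
    moreover have "U y \<in> unip_group (root_shape \<alpha>)" by (simp add: \<alpha> unip_group_def)
    then have "\<psi> (U y) = adele_char (\<Sum>(i, j)\<in>R \<times> C. adele_of_rat (M $ i $ j) * U y $ i $ j)"
      unfolding \<alpha> by (rule char[unfolded character_matrix_def \<alpha>, THEN conjunct2, rule_format])
    ultimately show ?thesis unfolding y by simp
  qed
  have "fourier_coeff dx \<alpha> \<psi> \<phi> g = unip_integral dx S (\<lambda>n. coeff_min dx \<phi> m (n ** ?A ** g))"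
    if g: "g \<in> SL4" for g
  proof -
    define h where "h u = \<phi> (u ** g) * cnj (\<psi> u)" for u
    define h' where "h' u = h (rat_matrix k ** u ** ?A)" for u
    have "periodic h" unfolding h_def by (rule periodic_fourier_integrand[OF \<phi> \<alpha> \<psi> g])
    then have h': "periodic h'" "unip_integral dx (R \<times> C) h' = unip_integral dx (R \<times> C) h"
      using l unfolding admissible_def h'_def by blast+
    \<comment> \<open>Left invariance of \<open>\<phi>\<close> removes the outer factor
      \<open>k\<close>; the inner factor \<open>l\<close> stays and becomes the translate of
      \<open>g\<close>.\<close>
    have h'_eq: "h' (U x) = \<phi> (U x ** (?A ** g)) * cnj (adele_char (adele_of_rat m * x (1, 4)))" for x
    proof -
      have "rat_matrix k ** U x ** ?A ** g = rat_matrix k ** (U x ** (?A ** g))"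
        by (simp only: matrix_mul_assoc)
      moreover have "U x ** (?A ** g) \<in> SL4"
        by (intro SL4_mult U_SL4 rat_matrix_SL4 l_SL4 g)
      then have "\<phi> (rat_matrix k ** (U x ** (?A ** g))) = \<phi> (U x ** (?A ** g))"
        by (rule automorphic_form_left_invariant[OF \<phi> k_SL4])
      ultimately show ?thesis unfolding h'_def h_def \<psi>_conj by simp
    qed
    \<comment> \<open>The (1, 4) factor is placed on the left, where \<open>coeff_min\<close>
      integrates it; the remaining unipotent factor joins the argument.\<close>
    have U_split: "U (x((1, 4) := y)) = (mat 1 + matrix_unit 1 4 y) ** unip_matrix S x" for x and y :: adele
    proof -
      have "mat 1 + matrix_unit 1 4 y = U ((\<lambda>_. 0)((1, 4) := y))"
        using one_in_R four_in_C RC by (auto simp: vec_eq_iff mat_def matrix_unit_def unip_matrix_def)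
      moreover have "unip_matrix S x = U (x((1, 4) := 0))"
        by (auto simp: vec_eq_iff unip_matrix_def S_def)
      moreover have "(\<lambda>t. ((\<lambda>_. 0)((1, 4) := y)) t + (x((1, 4) := 0)) t) = x((1, 4) := y)" by auto
      ultimately show ?thesis by (simp add: unip_matrix_mult[OF RC])
    qed
    obtain K where K: "\<And>x. norm (h' (U x)) \<le> K" using h'(1) unfolding periodic_def by blast
    have int: "integrable (PiM (R \<times> C) (\<lambda>_. \<mu>)) (\<lambda>x. h' (U x))"
      by (rule integrable_PiM_quot[OF _ _ K]) (use h'(1) in \<open>auto simp: periodic_def\<close>)
    interpret product_sigma_finite "\<lambda>_. \<mu>" by (rule product_sigma_finite_quot)
    have "fourier_coeff dx \<alpha> \<psi> \<phi> g = unip_integral dx (R \<times> C) h'"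
      unfolding h'(2) unfolding fourier_coeff_def \<alpha> h_def ..
    also have "\<dots> = (\<integral>x. (\<integral>y. h' (U (x((1, 4) := y))) \<partial>\<mu>) \<partial>PiM S (\<lambda>_. \<mu>))"
      using product_integral_insert[OF RC_S(3,2), of "\<lambda>x. h' (U x)"] int
      by (simp add: unip_integral_def RC_S(1)[symmetric])
    also have "\<dots> = unip_integral dx S (\<lambda>n. coeff_min dx \<phi> m (n ** ?A ** g))"
      unfolding unip_integral_def coeff_min_def h'_eq unfolding U_split by (simp add: matrix_mul_assoc)
    finally show ?thesis .
  qed
  moreover have "abelian_shape S"
    using upper RC by (auto simp: abelian_shape_def S_def)
  moreover have "coeff_min dx \<phi> m \<in> orbit_coeffs_min dx \<phi>"
    using pq by (auto simp: orbit_coeffs_min_def m_def)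
  ultimately show ?thesis using l_SL4 unfolding determined_by_def by blast
qed

lemma rank_one_case:
  assumes \<phi>: "automorphic_form \<phi>" and \<alpha>: "root_shape \<alpha> = R \<times> C"
    and \<psi>: "unitary_character \<alpha> \<psi>" and char: "character_matrix \<alpha> \<psi> M"
    and M: "\<And>i j. M $ i $ j = mat 1 $ i $ j + v $ i * w $ j"
    and v: "v \<noteq> 0" "\<And>i. i \<notin> R \<Longrightarrow> v $ i = 0" and w: "w \<noteq> 0" "\<And>j. j \<notin> C \<Longrightarrow> w $ j = 0"
  shows "M \<in> SL4_orbit M_min" "determined_by dx (orbit_coeffs_min dx \<phi>) (fourier_coeff dx \<alpha> \<psi> \<phi>)"
proof -
  obtain l k p q where l: "admissible l k" and pq: "p \<noteq> 0" "q \<noteq> 0"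
    and vw: "v = transpose l *v (p *s axis 1 1)" "l *v w = q *s axis 4 1"
    using rank_one_reduction[OF v w] by blast
  have "l \<in> SL4" using l by (simp add: admissible_def)
  then show "M \<in> SL4_orbit M_min" using pq vw M by (rule rank_one_orbit)
  show "determined_by dx (orbit_coeffs_min dx \<phi>) (fourier_coeff dx \<alpha> \<psi> \<phi>)"
    using \<phi> \<alpha> \<psi> char M l pq vw by (rule fourier_coeff_determined_by_min)
qed

end

section \<open>Orbits of character matrices\<close>

lemma SL4_orbit_trans:
  fixes L :: "'a::field^4^4"
  assumes "L \<in> SL4_orbit M" "M \<in> SL4_orbit N" shows "L \<in> SL4_orbit N"
proof -
  obtain a where a: "a \<in> SL4" "a ** M = L ** a" using assms(1) by (auto simp: SL4_orbit_iff)
  obtain b where b: "b \<in> SL4" "b ** N = M ** b" using assms(2) by (auto simp: SL4_orbit_iff)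
  have "a ** b ** N = L ** (a ** b)"
    using a(2) b(2) by (metis matrix_mul_assoc)
  then show ?thesis using SL4_mult[OF a(1) b(1)] by (auto simp: SL4_orbit_iff)
qed

lemma SL4_orbit_sym:
  fixes M :: "'a::field^4^4"
  assumes "M \<in> SL4_orbit N" shows "N \<in> SL4_orbit M"
proof -
  obtain a where a: "a \<in> SL4" "a ** N = M ** a" using assms by (auto simp: SL4_orbit_iff)
  obtain b where b: "a ** b = mat 1" "b ** a = mat 1"
    using det_1_inverse a(1) by (auto simp: SL4_def)
  have "b \<in> SL4" using det_mul[of a b] a(1) b(1) by (simp add: SL4_def)
  moreover have "b ** M = N ** b"
  proof -
    have "b ** M = b ** (M ** a) ** b" using b(1) by (simp add: matrix_mul_assoc[symmetric])
    also have "\<dots> = (b ** a) ** N ** b" unfolding a(2)[symmetric] by (simp only: matrix_mul_assoc)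
    finally show ?thesis by (simp add: b(2))
  qed
  ultimately show ?thesis by (auto simp: SL4_orbit_iff)
qed

text \<open>Columns 3 and 4 of a conjugation equation \<open>a ** M_ntm 1 = M ** a\<close> exhibit
  columns 1 and 2 of \<open>a\<close> as multiples of the same vector \<open>v\<close>, so
  \<open>a\<close> would be singular.\<close>

lemma rank_one_not_in_ntm_orbit:
  fixes M :: "'a::field^4^4"
  assumes M: "\<And>i j. M $ i $ j = mat 1 $ i $ j + v $ i * w $ j"
  shows "M \<notin> SL4_orbit (M_ntm 1)"
proof
  assume "M \<in> SL4_orbit (M_ntm 1)"
  then obtain a where a: "det a = 1" "a ** M_ntm 1 = M ** a" by (auto simp: SL4_orbit_iff SL4_def)
  have Ma: "(M ** a) $ i $ j = a $ i $ j + v $ i * (\<Sum>k\<in>UNIV. w $ k * a $ k $ j)" for i j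
  proof -
    have "(M ** a) $ i $ j = (\<Sum>k\<in>UNIV. (if i = k then a $ k $ j else 0) + v $ i * (w $ k * a $ k $ j))"
      unfolding matrix_matrix_mult_def vec_lambda_beta
      by (intro sum.cong) (simp_all add: M mat_def algebra_simps)
    then show ?thesis by (simp add: sum.distrib sum_distrib_left)
  qed
  have aM: "(a ** M_ntm 1) $ i $ 3 = a $ i $ 3 + a $ i $ 1" "(a ** M_ntm 1) $ i $ 4 = a $ i $ 4 + a $ i $ 2" for i
    by (simp_all add: matrix_matrix_mult_def M_ntm_def mat_def matrix_unit_def sum_4)
  define s t where "s = (\<Sum>k\<in>UNIV. w $ k * a $ k $ 3)" and "t = (\<Sum>k\<in>UNIV. w $ k * a $ k $ 4)"
  have "a $ i $ 1 = v $ i * s" "a $ i $ 2 = v $ i * t" for i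
    using aM[of i] Ma[of i 3] Ma[of i 4] unfolding a(2) by (simp_all add: s_def t_def)
  then have "det a = 0" by (simp add: det_4 algebra_simps)
  then show False using a(1) by simp
qed

text \<open>Conjugating E_14 by \<open>a\<close> gives the first column of \<open>a\<close> times
  the fourth row of its inverse.\<close>

lemma SL4_orbit_M_minE:
  assumes "M \<in> SL4_orbit M_min"
  obtains v w where "\<And>i j. M $ i $ j = mat 1 $ i $ j + v $ i * w $ j"
proof -
  obtain a where a: "a \<in> SL4" "a ** M_min = M ** a" using assms by (auto simp: SL4_orbit_iff)
  obtain b where b: "a ** b = mat 1" using det_1_inverse a(1) by (auto simp: SL4_def)
  have "M = a ** M_min ** b" unfolding a(2) by (simp add: matrix_mul_assoc[symmetric] b)
  moreover have "a ** M_min = a + (\<chi> i j. if j = 4 then a $ i $ 1 else 0)"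
    unfolding vec_eq_iff
  proof (intro allI)
    fix i j :: 4
    show "(a ** M_min) $ i $ j = (a + (\<chi> i j. if j = 4 then a $ i $ 1 else 0)) $ i $ j"
      using exhaust_4[of j] by (auto simp: matrix_matrix_mult_def M_min_def mat_def matrix_unit_def sum_4)
  qed
  ultimately have "M = mat 1 + (\<chi> i j. if j = 4 then a $ i $ 1 else 0) ** b"
    by (simp add: matrix_add_rdistrib b)
  moreover have "((\<chi> i j. if j = 4 then a $ i $ 1 else 0) ** b) $ i $ j = a $ i $ 1 * b $ 4 $ j" for i j
    by (simp add: matrix_matrix_mult_def sum_4)
  ultimately show ?thesis using that[of "\<chi> i. a $ i $ 1" "b $ 4"] by simp
qed

text \<open>A decomposition M - 1 = v w^T survives extension of scalars, so the two alternatives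
  remain exclusive even when the second is tested over a larger field.\<close>

lemma M_min_orbit_not_ntm:
  fixes M :: "rat^4^4"
  assumes "M \<in> SL4_orbit M_min"
  shows "map_matrix of_rat M \<notin> SL4_orbit (M_ntm (1::'a::field_char_0))"
proof -
  obtain v w where "\<And>i j. M $ i $ j = mat 1 $ i $ j + v $ i * w $ j"
    using SL4_orbit_M_minE[OF assms] by blast
  then have "map_matrix of_rat M $ i $ j = mat 1 $ i $ j + (\<chi> i. of_rat (v $ i)) $ i * (\<chi> j. (of_rat (w $ j) :: 'a)) $ j" for i j
    by (simp add: mat_def of_rat_add of_rat_mult)
  then show ?thesis by (rule rank_one_not_in_ntm_orbit)
qed

text \<open>Let X be the upper right block, of determinant \<open>d\<close>. The conjugating matrix
  is block diagonal with blocks X diag(1, 1/d), of determinant 1, and the identity; it carries the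
  block diag(1, d) to X.\<close>

lemma Alpha2_in_ntm_orbit:
  fixes M :: "'a::field^4^4"
  assumes M: "M \<in> unip_group (root_shape Alpha2)"
    and d: "d = M$1$3 * M$2$4 - M$1$4 * M$2$3" "d \<noteq> 0"
  shows "M \<in> SL4_orbit (M_ntm d)"
proof -
  obtain x where x: "M = unip_matrix (root_shape Alpha2) x" using M by (auto simp: unip_group_def)
  define a :: "'a^4^4" where "a = (\<chi> i j. if j = 1 then (if i = 1 then M$1$3 else if i = 2 then M$2$3 else 0)
      else if j = 2 then (if i = 1 then M$1$4 / d else if i = 2 then M$2$4 / d else 0) else if i = j then 1 else 0)"
  have "det a = (M$1$3 * M$2$4 - M$1$4 * M$2$3) / d"
    by (simp add: det_4 a_def diff_divide_distrib)
  then have "a \<in> SL4" using d by (simp add: SL4_def)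
  moreover have "a ** M_ntm d = M ** a"
    using d(2) by (simp add: vec_eq_iff forall_4 matrix_matrix_mult_def sum_4 M_ntm_def matrix_unit_def
        mat_def a_def x unip_matrix_def)
  ultimately show ?thesis by (auto simp: SL4_orbit_iff)
qed

lemma det_zero_rank_one:
  fixes a b c d :: "'a::field"
  assumes "a * d - b * c = 0"
  shows "\<exists>s t p q. a = s * p \<and> b = s * q \<and> c = t * p \<and> d = t * q"
proof (cases "a = 0")
  case True
  then have "a = 0 * c \<and> b = 0 * d \<and> c = 1 * c \<and> d = 1 * d \<or>
      a = 1 * a \<and> b = 1 * b \<and> c = d / b * a \<and> d = d / b * b"
    using assms by (cases "b = 0") auto
  then show ?thesis by blast
next
  case False
  then have "a = 1 * a \<and> b = 1 * b \<and> c = c / a * a \<and> d = c / a * b"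
    using assms by (simp add: field_simps)
  then show ?thesis by blast
qed

text \<open>The empty product measure is a point mass. It lets the rank-two coefficient count as an
  integral over the trivial group.\<close>

lemma unip_integral_empty: "unip_integral dx {} f = f (mat 1)"
proof -
  have "unip_matrix {} x = (mat 1 :: adele^4^4)" for x
    by (simp add: vec_eq_iff unip_matrix_def mat_def)
  then show ?thesis
    unfolding unip_integral_def by (simp add: PiM_empty lebesgue_integral_count_space_finite)
qed

lemma fourier_coeff_determined_by_ntm:
  assumes char: "character_matrix Alpha2 \<psi> M" and d: "M$1$3 * M$2$4 - M$1$4 * M$2$3 \<noteq> 0"
  shows "determined_by dx (orbit_coeffs_ntm dx \<phi>) (fourier_coeff dx Alpha2 \<psi> \<phi>)"
proof -
  let ?f = "coeff_ntm dx \<phi> (M$1$3) (M$1$4) (M$2$3) (M$2$4)"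
  have "fourier_coeff dx Alpha2 \<psi> \<phi> g = ?f g" for g
  proof -
    have "\<psi> (unip_matrix (root_shape Alpha2) x) = adele_char
        (adele_of_rat (M$1$3) * unip_matrix (root_shape Alpha2) x $ 1 $ 3 +
         adele_of_rat (M$1$4) * unip_matrix (root_shape Alpha2) x $ 1 $ 4 +
         adele_of_rat (M$2$3) * unip_matrix (root_shape Alpha2) x $ 2 $ 3 +
         adele_of_rat (M$2$4) * unip_matrix (root_shape Alpha2) x $ 2 $ 4)" for x
      using char by (simp add: character_matrix_def unip_group_def add.assoc)
    then show ?thesis by (simp add: fourier_coeff_def coeff_ntm_def unip_integral_def)
  qed
  moreover have "?f \<in> orbit_coeffs_ntm dx \<phi>" using d unfolding orbit_coeffs_ntm_def by blast
  ultimately show ?thesis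
    unfolding determined_by_def
    by (intro bexI[of _ ?f] exI[of _ "{}"] exI[of _ "mat 1"])
      (simp_all add: abelian_shape_def SL4_def unip_integral_empty)
qed

lemma map_of_rat_unip_matrix:
  "map_matrix of_rat (unip_matrix S x) = (unip_matrix S (\<lambda>t. of_rat (x t)) :: 'a::field_char_0^4^4)"
  by (simp add: vec_eq_iff unip_matrix_def)

text \<open>Over the complex numbers the determinant of the block has a square root, so the square
  class that obstructs rational conjugacy disappears.\<close>

lemma Alpha2_complex_orbit:
  assumes M: "M \<in> unip_group (root_shape Alpha2)" and d: "M$1$3 * M$2$4 - M$1$4 * M$2$3 \<noteq> 0"
  shows "map_matrix of_rat M \<in> SL4_orbit (M_ntm (1::complex))"
proof -
  let ?N = "map_matrix of_rat M :: complex^4^4"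
  define z where "z = ?N$1$3 * ?N$2$4 - ?N$1$4 * ?N$2$3"
  have "z = of_rat (M$1$3 * M$2$4 - M$1$4 * M$2$3)" by (simp add: z_def of_rat_diff of_rat_mult)
  then have z: "z \<noteq> 0" using d by (simp only: of_rat_eq_0_iff not_False_eq_True)
  have "?N \<in> unip_group (root_shape Alpha2)"
    using M unfolding unip_group_def by (auto simp only: map_of_rat_unip_matrix)
  then have "?N \<in> SL4_orbit (M_ntm z)" using z_def z by (rule Alpha2_in_ntm_orbit)
  moreover have "M_ntm z \<in> SL4_orbit (M_ntm 1)" using M_ntm_in_orbit_iff[OF z] power2_csqrt[of z] by metis
  ultimately show ?thesis by (rule SL4_orbit_trans)
qed

text \<open>The second alternative names the orbit over the complex numbers because the rational
  points of (2^2) form several rational orbits. The number \<open>d\<close> records which one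
  contains \<open>M\<close>, and the equivalence says when it is the orbit of 1 + E_13 + E_24
  itself.\<close>

theorem theorem4p6:
  fixes dx :: "adele measure"
    and \<phi> \<psi> :: "adele^4^4 \<Rightarrow> complex"
    and \<alpha> :: simple_root
    and M :: "rat^4^4"
  assumes "haar_measure dx" and "emeasure dx adele_fund_domain = 1"
    and "automorphic_form \<phi>"
    and "unitary_character \<alpha> \<psi>"
    and "\<exists>u\<in>unip_group (root_shape \<alpha>). \<psi> u \<noteq> 1"
    and "character_matrix \<alpha> \<psi> M"
  shows "((M \<in> SL4_orbit M_min \<and>
           determined_by dx (orbit_coeffs_min dx \<phi>) (fourier_coeff dx \<alpha> \<psi> \<phi>)) \<or>
          (map_matrix of_rat M \<in> SL4_orbit (M_ntm (1::complex)) \<and>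
           (\<exists>d. d \<noteq> 0 \<and> M \<in> SL4_orbit (M_ntm d) \<and>
                (M \<in> SL4_orbit (M_ntm 1) \<longleftrightarrow> (\<exists>q. d = q\<^sup>2))) \<and>
           determined_by dx (orbit_coeffs_ntm dx \<phi>) (fourier_coeff dx \<alpha> \<psi> \<phi>))) \<and>
         \<not> (M \<in> SL4_orbit M_min \<and> map_matrix of_rat M \<in> SL4_orbit (M_ntm (1::complex))) \<and>
         (map_matrix of_rat M \<in> SL4_orbit (M_ntm (1::complex)) \<longrightarrow> \<alpha> = Alpha2)"
proof -
  obtain x where x: "M = unip_matrix (root_shape \<alpha>) x"
    using assms(6) by (auto simp: character_matrix_def unip_group_def)
  \<comment> \<open>If M = 1, then \<psi> is constant on the group with value
    \<open>adele_char 0\<close>. Its value 1 at a rational point fixes this constant, without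
    evaluating \<open>adele_char\<close>, and contradicts nontriviality.\<close>
  have M_nontrivial: "M \<noteq> mat 1"
  proof
    assume M1: "M = mat 1"
    have "\<And>i j. (i, j) \<in> root_shape \<alpha> \<Longrightarrow> i \<noteq> j" by (cases \<alpha>) auto
    then have "(\<Sum>(i, j)\<in>root_shape \<alpha>. adele_of_rat (M $ i $ j) * u $ i $ j) = 0" for u
      by (intro sum.neutral) (auto simp: M1 mat_def)
    then have \<psi>: "\<psi> u = adele_char 0" if "u \<in> unip_group (root_shape \<alpha>)" for u
      using assms(6) that unfolding character_matrix_def by simp
    have "\<psi> (rat_matrix (unip_matrix (root_shape \<alpha>) x)) = 1"
      using assms(4) unfolding unitary_character_def unip_group_def by blast
    moreover have "rat_matrix (unip_matrix (root_shape \<alpha>) x) \<in> unip_group (root_shape \<alpha>)"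
      by (simp add: rat_matrix_unip unip_group_def)
    ultimately have "adele_char 0 = 1" using \<psi> by simp
    then show False using \<psi> assms(5) by auto
  qed
  have rank_one: "M \<in> SL4_orbit M_min \<and>
      determined_by dx (orbit_coeffs_min dx \<phi>) (fourier_coeff dx \<alpha> \<psi> \<phi>)"
    if "root_shape \<alpha> = R \<times> C" "R \<inter> C = {}" "1 \<in> R" "4 \<in> C"
      and M: "\<And>i j. M $ i $ j = mat 1 $ i $ j + v $ i * w $ j"
      and supp: "\<And>i. i \<notin> R \<Longrightarrow> v $ i = 0" "\<And>j. j \<notin> C \<Longrightarrow> w $ j = 0" for R C v w
  proof -
    have "R \<times> C \<subseteq> {(1,2), (1,3), (1,4), (2,3), (2,4), (3,4)}"
      unfolding that(1)[symmetric] by (cases \<alpha>) auto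
    then interpret maximal_parabolic dx R C
      using assms(1,2) that(2-4) by unfold_locales auto
    have "v \<noteq> 0" "w \<noteq> 0" using M M_nontrivial by (auto simp: vec_eq_iff)
    then show ?thesis using rank_one_case[OF assms(3) that(1) assms(4,6) M] supp by blast
  qed
  have not_both: "\<not> (M \<in> SL4_orbit M_min \<and> map_matrix of_rat M \<in> SL4_orbit (M_ntm (1::complex)))"
    using M_min_orbit_not_ntm by blast
  show ?thesis
  proof (cases \<alpha>)
    case Alpha1
    have "M $ i $ j = mat 1 $ i $ j + axis 1 1 $ i * (\<chi> j. if j = 1 then 0 else M $ 1 $ j) $ j" for i j
      using exhaust_4[of i] exhaust_4[of j]
      by (auto simp: x Alpha1 unip_matrix_def mat_def axis_def)
    then have "M \<in> SL4_orbit M_min \<and>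
        determined_by dx (orbit_coeffs_min dx \<phi>) (fourier_coeff dx \<alpha> \<psi> \<phi>)"
      by (rule rank_one[of "{1}" "{2, 3, 4}", rotated 4]) (use exhaust_4 in \<open>auto simp: Alpha1 axis_def\<close>)
    \<comment> \<open>Membership in the minimal orbit and exclusivity make the premise of the last
      conjunct false; for \<open>Alpha1\<close> and \<open>Alpha3\<close> this is the reason the
      second alternative cannot occur.\<close>
    then show ?thesis using not_both by blast
  next
    case Alpha3
    have "M $ i $ j = mat 1 $ i $ j + (\<chi> i. if i = 4 then 0 else M $ i $ 4) $ i * axis 4 1 $ j" for i j
      using exhaust_4[of i] exhaust_4[of j]
      by (auto simp: x Alpha3 unip_matrix_def mat_def axis_def)
    then have "M \<in> SL4_orbit M_min \<and>
        determined_by dx (orbit_coeffs_min dx \<phi>) (fourier_coeff dx \<alpha> \<psi> \<phi>)"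
      by (rule rank_one[of "{1, 2, 3}" "{4}", rotated 4]) (use exhaust_4 in \<open>auto simp: Alpha3 axis_def\<close>)
    then show ?thesis using not_both by blast
  next
    case Alpha2
    define d where "d = M$1$3 * M$2$4 - M$1$4 * M$2$3"
    have M_unip: "M \<in> unip_group (root_shape Alpha2)" by (simp add: x Alpha2 unip_group_def)
    show ?thesis
    proof (cases "d = 0")
      case True
      then obtain s t p q where st: "M$1$3 = s * p" "M$1$4 = s * q" "M$2$3 = t * p" "M$2$4 = t * q"
        using det_zero_rank_one[OF True[unfolded d_def]] by blast
      let ?v = "\<chi> i. if i = 1 then s else if i = 2 then t else 0"
      let ?w = "\<chi> j. if j = 3 then p else if j = 4 then q else 0"
      have "M $ i $ j = mat 1 $ i $ j + ?v $ i * ?w $ j" for i j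
        using exhaust_4[of i] exhaust_4[of j] st
        by (auto simp: x Alpha2 unip_matrix_def mat_def)
      then have "M \<in> SL4_orbit M_min \<and>
          determined_by dx (orbit_coeffs_min dx \<phi>) (fourier_coeff dx \<alpha> \<psi> \<phi>)"
        by (rule rank_one[of "{1, 2}" "{3, 4}", rotated 4]) (auto simp: Alpha2)
      then show ?thesis using not_both by blast
    next
      case False
      have orbit: "M \<in> SL4_orbit (M_ntm d)" using M_unip d_def False by (rule Alpha2_in_ntm_orbit)
      \<comment> \<open>Since \<open>M\<close> and \<open>M_ntm d\<close> are rationally conjugate,
        the question for \<open>M\<close> becomes the square criterion for \<open>d\<close>.\<close>
      have "M \<in> SL4_orbit (M_ntm 1) \<longleftrightarrow> M_ntm d \<in> SL4_orbit (M_ntm 1)"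
        using orbit SL4_orbit_trans SL4_orbit_sym by blast
      then have "M \<in> SL4_orbit (M_ntm 1) \<longleftrightarrow> (\<exists>q. d = q\<^sup>2)"
        unfolding M_ntm_in_orbit_iff[OF False] .
      moreover have "determined_by dx (orbit_coeffs_ntm dx \<phi>) (fourier_coeff dx \<alpha> \<psi> \<phi>)"
        using fourier_coeff_determined_by_ntm[of \<psi> M] assms(6) False unfolding Alpha2 d_def by blast
      moreover have "map_matrix of_rat M \<in> SL4_orbit (M_ntm (1::complex))"
        using Alpha2_complex_orbit[OF M_unip] False unfolding d_def by blast
      ultimately show ?thesis using orbit False not_both Alpha2 by blast
    qed
  qed
qed

end
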